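(* Let $\gamma\subset\mathbb R^2$ be a smooth curve. Then $\gamma$ is $\mathrm{Shr}^\omega(\mathbb R^2,0)$-homogeneous if and only if it is either of the form $\gamma=\{x=c\}$, $c\in\mathbb R$, or $\gamma=\{y=f(x)\}$ for a real-analytic function $f$.
   Context: Coordinates in $\mathbb R^2$ are denoted $(x,y)$. A smooth curve is a $1$-dimensional submanifold of $\mathbb R^2$ of class $C^\infty$. $\mathrm{Shr}^\omega(\mathbb R^2,0)$ is the group of germs at $0$ of analytic shears fixing $0$, i.e. germs of diffeomorphisms of the form $\psi(x,y)=(\phi(x),\,y+h(x))$, where $\phi$ is a germ at $0$ of real-analytic diffeomorphism of $\mathbb R$ fixing $0$ and $h$ is a germ at $0$ of real-analytic function (with $h(0)=0$, since $\psi$ fixes $0$). For $q\in\mathbb R^2$, $\tau_q$ is the translation $\tau_q(z)=z+q$. The curve $\gamma$ is $\mathrm{Shr}^\omega(\mathbb R^2,0)$-homogeneous if for any two points $p,q\in\gamma$ there exist a neighborhood $U$ of $p$ in $\mathbb R^2$ and a real-analytic diffeomorphism $\psi:U\to\psi(U)\subset\mathbb R^2$ such that $\psi(U\cap\gamma)=\gamma\cap\psi(U)$, $\psi(p)=q$, and the germ at $0$ of $\tau_{-q}\circ\psi\circ\tau_p$ belongs to $\mathrm{Shr}^\omega(\mathbb R^2,0)$.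
   Formalization: The curve is assumed connected (else {x=0} together with {x=1} is a counterexample); f is real-analytic on an open interval, not always all of R (y=1/x, x>0); γ={x=c} is asserted for closed γ, and in general γ is an open interval of that line. *)

theory Defs
  imports "HOL-Analysis.Analysis"
begin

text \<open>
  \<open>Ck_on k f S\<close>: class $C^k$, intended for open \<open>S\<close>. The successor clause asks for all
  directional derivatives to be of class $C^k$, which in finite dimension is the usual notion.
\<close>

primrec Ck_on ::
  "nat \<Rightarrow> ('a::euclidean_space \<Rightarrow> 'b::euclidean_space) \<Rightarrow> 'a set \<Rightarrow> bool" where
  "Ck_on 0 f S = continuous_on S f"
| "Ck_on (Suc k) f S =
     (\<exists>f'. (\<forall>x\<in>S. (f has_derivative f' x) (at x)) \<and> (\<forall>v. Ck_on k (\<lambda>x. f' x v) S))"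

definition smooth_on :: "('a::euclidean_space \<Rightarrow> 'b::euclidean_space) \<Rightarrow> 'a set \<Rightarrow> bool" where
  "smooth_on f S \<longleftrightarrow> (\<forall>k. Ck_on k f S)"

definition smooth_diffeo_on ::
  "('a::euclidean_space \<Rightarrow> 'b::euclidean_space) \<Rightarrow> 'a set \<Rightarrow> bool" where
  "smooth_diffeo_on \<Phi> U \<longleftrightarrow>
     open U \<and> smooth_on \<Phi> U \<and> inj_on \<Phi> U \<and>
     open (\<Phi> ` U) \<and> smooth_on (inv_into U \<Phi>) (\<Phi> ` U)"

text \<open>
  A one-dimensional (embedded) submanifold of the plane of class $C^\infty$. Neither
  connectedness nor closedness is part of the definition.
\<close>

definition smooth_curve :: "(real \<times> real) set \<Rightarrow> bool" where
  "smooth_curve \<gamma> \<longleftrightarrow>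
     (\<forall>p\<in>\<gamma>. \<exists>U (\<Phi> :: real \<times> real \<Rightarrow> real \<times> real).
        p \<in> U \<and> smooth_diffeo_on \<Phi> U \<and> \<Phi> ` (U \<inter> \<gamma>) = {z \<in> \<Phi> ` U. snd z = 0})"

text \<open>
  Around each point the map is the sum of an (absolutely) convergent multivariate power series.
  A multi-index is a function from \<open>Basis\<close> to the naturals, made unique by extensionality;
  on \<open>real\<close> this is an ordinary power series, on \<open>real \<times> real\<close> a double power series.
\<close>

definition real_analytic_on ::
  "('a::euclidean_space \<Rightarrow> 'b::euclidean_space) \<Rightarrow> 'a set \<Rightarrow> bool" where
  "real_analytic_on f S \<longleftrightarrow>
     (\<forall>c\<in>S. \<exists>(a :: ('a \<Rightarrow> nat) \<Rightarrow> 'b) r. r > 0 \<and>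
        (\<forall>x\<in>ball c r.
           ((\<lambda>\<alpha>. (\<Prod>b\<in>Basis. ((x - c) \<bullet> b) ^ \<alpha> b) *\<^sub>R a \<alpha>) has_sum f x)
             (Basis \<rightarrow>\<^sub>E UNIV)))"

definition real_analytic_diffeo_on ::
  "('a::euclidean_space \<Rightarrow> 'b::euclidean_space) \<Rightarrow> 'a set \<Rightarrow> bool" where
  "real_analytic_diffeo_on \<psi> U \<longleftrightarrow>
     open U \<and> real_analytic_on \<psi> U \<and> inj_on \<psi> U \<and>
     open (\<psi> ` U) \<and> real_analytic_on (inv_into U \<psi>) (\<psi> ` U)"

text \<open>
  Germs at \<open>0\<close> are represented by total maps, so this is the set of all maps whose germ at \<open>0\<close>
  is an analytic shear fixing \<open>0\<close>; values away from \<open>0\<close> are irrelevant.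
\<close>

definition analytic_shear_germs :: "(real \<times> real \<Rightarrow> real \<times> real) set" where
  "analytic_shear_germs =
     {g. \<exists>(V :: real set) (\<phi> :: real \<Rightarrow> real) (h :: real \<Rightarrow> real).
           0 \<in> V \<and> real_analytic_diffeo_on \<phi> V \<and> \<phi> 0 = 0 \<and>
           real_analytic_on h V \<and> h 0 = 0 \<and>
           (\<forall>\<^sub>F z in nhds 0. g z = (\<phi> (fst z), snd z + h (fst z)))}"

definition translation :: "real \<times> real \<Rightarrow> real \<times> real \<Rightarrow> real \<times> real" where
  "translation q z = z + q"

definition homogeneous ::
  "(real \<times> real \<Rightarrow> real \<times> real) set \<Rightarrow> (real \<times> real) set \<Rightarrow> bool" where
  "homogeneous G \<gamma> \<longleftrightarrow>
     (\<forall>p\<in>\<gamma>. \<forall>q\<in>\<gamma>. \<exists>U \<psi>.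
        p \<in> U \<and> real_analytic_diffeo_on \<psi> U \<and>
        \<psi> ` (U \<inter> \<gamma>) = \<gamma> \<inter> \<psi> ` U \<and> \<psi> p = q \<and>
        translation (- q) \<circ> \<psi> \<circ> translation p \<in> G)"

end

theory Submission
  imports Defs "HOL-Complex_Analysis.Complex_Analysis"
begin

text \<open>
  A point with non-vertical tangent passes this property on to the whole curve, because shears
  preserve verticals; so \<open>\<gamma>\<close> is either vertical or the graph of a smooth function \<open>f\<close>, and in the
  second case homogeneity says that all germs of \<open>f\<close> are related by \<open>f \<circ> g = f + k\<close> with \<open>g\<close>, \<open>k\<close>
  analytic. It remains to see that such an \<open>f\<close> is analytic somewhere, hence everywhere.

  If \<open>g\<close> fixes a point and is not the identity, then it, or its inverse, attracts a one-sided
  neighbourhood of that point, and \<open>f = f(0) - (\<Sum>j. k \<circ> g\<^sup>j)\<close> is analytic there. Otherwise a germ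
  \<open>g\<close> of given orientation is determined by its value at \<open>0\<close>. Baire's and Montel's theorems then give
  symmetries \<open>g\<^sub>t\<close> with \<open>g\<^sub>t(0) = t\<close>, holomorphic on one fixed complex disc, with \<open>g\<^sub>t\<close> tending to
  the identity and \<open>k\<^sub>t\<close> to \<open>0\<close> as \<open>t\<close> tends to \<open>0\<close>. By uniqueness the iterates of \<open>g\<^sub>t\<close> belong to the
  same family; averaging over them shows that \<open>g\<^sub>t - id\<close> and \<open>k\<^sub>t\<close> are \<open>O(t)\<close> on a complex disc.
  A limit \<open>(X, Y)\<close> of \<open>((g\<^sub>t - id)/t, k\<^sub>t/t)\<close> satisfies \<open>f' X = Y\<close> and \<open>X(0) = 1\<close>, so \<open>f'\<close> is analytic.
\<close>

section \<open>Real-analytic functions of one variable\<close>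

text \<open>Homogeneity is a condition on single pairs of points: each pair has its own map, on a
  domain of unknown size, and nothing relates the maps of neighbouring pairs. Moreover
  \<open>f\<close> has values only at real points, so no estimate on a complex disc can be read off
  from \<open>f\<close>. For this reason the pair \<open>(g, k)\<close> is carried along as two
  holomorphic functions, tied to \<open>f\<close> on the real axis alone.

  Of the smoothness of the curve only \<open>C^1\<close> enters, and it acts twice. A Lipschitz
  bound makes \<open>k = f o g - f\<close> vanish at least to the order of \<open>g - id\<close>, so
  that the sum over an orbit converges even if the multiplier is 1; and differentiability turns the
  limit of difference quotients into an equation for \<open>f'\<close>.

  The argument is by contradiction on a compact interval \<open>K\<close>. If \<open>f\<close> is
  analytic at no point of \<open>K\<close>, symmetries are as rigid as translations, and this
  rigidity stands in for a group structure, which is absent because domains shrink under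
  composition.

  Analyticity is restated as \<open>hol_ext\<close> so that Montel's theorem, the identity theorem
  and Cauchy's estimates apply.\<close>

definition hol_ext :: "(real \<Rightarrow> real) \<Rightarrow> real \<Rightarrow> bool" where
  "hol_ext f c \<longleftrightarrow> (\<exists>r>0. \<exists>F. F holomorphic_on ball (complex_of_real c) r \<and>
     (\<forall>x. \<bar>x - c\<bar> < r \<longrightarrow> F (of_real x) = of_real (f x)))"

text \<open>\<open>Basis\<close> on \<open>real\<close> is \<open>{1}\<close>, so an extensional
  multi-index amounts to one exponent.\<close>

lemma has_sum_multiindex_real:
  fixes a :: "(real \<Rightarrow> nat) \<Rightarrow> 'b::euclidean_space"
  shows "((\<lambda>\<alpha>. (\<Prod>b\<in>Basis. (y \<bullet> b) ^ \<alpha> b) *\<^sub>R a \<alpha>) has_sum s) (Basis \<rightarrow>\<^sub>E UNIV) \<longleftrightarrow>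
         ((\<lambda>n. y ^ n *\<^sub>R a (\<lambda>b\<in>{1}. n)) has_sum s) UNIV"
proof -
  have "bij_betw (\<lambda>n. (\<lambda>b\<in>{1::real}. n)) (UNIV :: nat set) (Basis \<rightarrow>\<^sub>E UNIV)"
    by (rule bij_betwI[where g = "\<lambda>\<alpha>. \<alpha> 1"]) (auto simp: PiE_def extensional_def fun_eq_iff)
  from has_sum_reindex_bij_betw[OF this, of "\<lambda>\<alpha>. (\<Prod>b\<in>Basis. (y \<bullet> b) ^ \<alpha> b) *\<^sub>R a \<alpha>" s]
  show ?thesis by simp
qed

text \<open>Abel's lemma: the real series converges at \<open>c + s\<close> for every
  \<open>s < r\<close>, hence with complex arguments in the whole disc of the same radius.\<close>

lemma real_analytic_on_imp_hol_ext:
  fixes f :: "real \<Rightarrow> real"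
  assumes "real_analytic_on f S" "c \<in> S"
  shows "hol_ext f c"
proof -
  obtain a :: "(real \<Rightarrow> nat) \<Rightarrow> real" and r where r: "r > 0"
    and a: "\<And>x. x \<in> ball c r \<Longrightarrow>
      ((\<lambda>\<alpha>. (\<Prod>b\<in>Basis. ((x - c) \<bullet> b) ^ \<alpha> b) *\<^sub>R a \<alpha>) has_sum f x) (Basis \<rightarrow>\<^sub>E UNIV)"
    using assms unfolding real_analytic_on_def by blast
  define A where "A n = a (\<lambda>b\<in>{1}. n)" for n
  have sums: "(\<lambda>n. A n * (x - c) ^ n) sums f x" if "\<bar>x - c\<bar> < r" for x
  proof -
    have "((\<lambda>n. (x - c) ^ n *\<^sub>R A n) has_sum f x) UNIV"
      using a[of x] that unfolding has_sum_multiindex_real A_def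
      by (auto simp: dist_real_def abs_minus_commute)
    from has_sum_imp_sums[OF this] show ?thesis by (simp add: mult.commute)
  qed
  define F where "F z = (\<Sum>n. complex_of_real (A n) * (z - of_real c) ^ n)" for z
  have "(\<lambda>n. complex_of_real (A n) * (z - of_real c) ^ n) sums F z"
    if z: "z \<in> ball (of_real c) r" for z
  proof -
    obtain s where s: "cmod (z - of_real c) < s" "s < r"
      using z dense by (metis dist_commute dist_norm mem_ball)
    then have "s > 0" by (meson norm_ge_zero order.strict_trans1)
    have "summable (\<lambda>n. complex_of_real (A n * s ^ n))"
      using sums[of "c + s"] s \<open>s > 0\<close> by (subst summable_of_real_iff) (auto simp: sums_iff)
    then have "summable (\<lambda>n. complex_of_real (A n) * of_real s ^ n)" by simp
    from powser_inside[OF this, of "z - of_real c"] s \<open>s > 0\<close> show ?thesis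
      unfolding F_def by (intro summable_sums) simp
  qed
  then have "F holomorphic_on ball (of_real c) r"
    by (rule power_series_holomorphic)
  moreover have "F (of_real x) = of_real (f x)" if "\<bar>x - c\<bar> < r" for x
  proof -
    have "(\<lambda>n. complex_of_real (A n * (x - c) ^ n)) sums of_real (f x)"
      using sums[OF that] by (simp only: sums_of_real_iff)
    then show ?thesis unfolding F_def by (simp add: sums_iff)
  qed
  ultimately show ?thesis unfolding hol_ext_def using r by blast
qed

text \<open>Since \<open>F\<close> agrees with the real function \<open>f\<close> on the axis, the
  real parts of its Taylor coefficients already form a series for \<open>f\<close>. Convergence at a
  point \<open>c + s\<close> further out gives the absolute convergence that \<open>has_sum\<close>
  demands.\<close>

lemma hol_ext_imp_real_analytic_on:
  fixes f :: "real \<Rightarrow> real"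
  assumes "\<And>c. c \<in> S \<Longrightarrow> hol_ext f c"
  shows "real_analytic_on f S"
  unfolding real_analytic_on_def
proof
  fix c assume "c \<in> S"
  then obtain r F where r: "r > 0" and F: "F holomorphic_on ball (complex_of_real c) r"
    and Ff: "\<And>x. \<bar>x - c\<bar> < r \<Longrightarrow> F (of_real x) = of_real (f x)"
    using assms unfolding hol_ext_def by blast
  define b where "b n = (deriv ^^ n) F (of_real c) / fact n" for n
  have b: "(\<lambda>n. b n * (w - of_real c) ^ n) sums F w" if "w \<in> ball (of_real c) r" for w
    unfolding b_def using holomorphic_power_series[OF F that] by simp
  have hs: "((\<lambda>n. (x - c) ^ n *\<^sub>R Re (b n)) has_sum f x) UNIV" if x: "x \<in> ball c r" for x
  proof -
    have xr: "\<bar>x - c\<bar> < r" using x by (simp add: dist_real_def abs_minus_commute)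
    obtain s where s: "\<bar>x - c\<bar> < s" "s < r" using xr dense by blast
    have eq: "Re (b n * (of_real y - of_real c) ^ n) = (y - c) ^ n *\<^sub>R Re (b n)" for n y
    proof -
      have "(complex_of_real y - of_real c) ^ n = of_real ((y - c) ^ n)" by simp
      then show ?thesis by (simp del: of_real_power of_real_diff)
    qed
    have sm: "(\<lambda>n. (y - c) ^ n *\<^sub>R Re (b n)) sums f y" if "\<bar>y - c\<bar> < r" for y
      using sums_Re[OF b[of "of_real y"]] that Ff[OF that] unfolding eq
      by (simp add: dist_real_def abs_minus_commute)
    have "summable (\<lambda>n. Re (b n) * s ^ n)"
      using sm[of "c + s"] s by (auto simp: sums_iff mult.commute)
    from powser_insidea[OF this, of "x - c"] s
    have "summable (\<lambda>n. norm ((x - c) ^ n *\<^sub>R Re (b n)))" by (simp add: mult.commute)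
    then show ?thesis using sm[OF xr] by (rule norm_summable_imp_has_sum)
  qed
  show "\<exists>a r. 0 < r \<and> (\<forall>x\<in>ball c r.
      ((\<lambda>\<alpha>. (\<Prod>b\<in>Basis. ((x - c) \<bullet> b) ^ \<alpha> b) *\<^sub>R a \<alpha>) has_sum f x) (Basis \<rightarrow>\<^sub>E UNIV))"
    using r hs unfolding has_sum_multiindex_real
    by (intro exI[of _ "\<lambda>\<alpha>. Re (b (\<alpha> 1))"] exI[of _ r]) simp
qed

lemma has_real_derivative_Re_of_real:
  assumes "(F has_field_derivative D) (at (complex_of_real x))"
  shows "((\<lambda>x. Re (F (of_real x))) has_real_derivative Re D) (at x)"
proof -
  have "((\<lambda>x. F (of_real x)) has_vector_derivative D) (at x)"
    using has_vector_derivative_real_field[OF assms] .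
  from bounded_linear.has_vector_derivative[OF bounded_linear_Re this]
  show ?thesis by (simp add: has_real_derivative_iff_has_vector_derivative)
qed

lemma hol_ext_C1:
  assumes "hol_ext f c"
  obtains r f' where "r > 0" "\<And>x. \<bar>x - c\<bar> < r \<Longrightarrow> (f has_real_derivative f' x) (at x)"
    "continuous_on {c - r<..<c + r} f'"
proof -
  obtain r F where r: "r > 0" and F: "F holomorphic_on ball (complex_of_real c) r"
    and Ff: "\<And>x. \<bar>x - c\<bar> < r \<Longrightarrow> F (of_real x) = of_real (f x)"
    using assms unfolding hol_ext_def by blast
  define f' where "f' x = Re (deriv F (of_real x))" for x
  have "(f has_real_derivative f' x) (at x)" if "\<bar>x - c\<bar> < r" for x
  proof -
    have "(F has_field_derivative deriv F (of_real x)) (at (of_real x))"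
      using that by (intro holomorphic_derivI[OF F]) (auto simp: dist_real_def)
    then have "((\<lambda>x. Re (F (of_real x))) has_real_derivative f' x) (at x)"
      unfolding f'_def by (rule has_real_derivative_Re_of_real)
    moreover have "\<forall>\<^sub>F y in nhds x. Re (F (of_real y)) = f y"
    proof -
      have "\<forall>\<^sub>F y in nhds x. y \<in> ball c r"
        using that by (intro eventually_nhds_in_open) (auto simp: dist_real_def)
      then show ?thesis
        by eventually_elim (simp add: Ff dist_real_def abs_minus_commute)
    qed
    ultimately show ?thesis by (subst (asm) DERIV_cong_ev[OF refl _ refl]) auto
  qed
  moreover have "continuous_on {c - r<..<c + r} f'"
    unfolding f'_def
    by (intro continuous_intros continuous_on_compose2[OF
          holomorphic_on_imp_continuous_on[OF holomorphic_deriv[OF F]]]) (auto simp: dist_real_def)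
  ultimately show ?thesis using r that by blast
qed

lemma hol_ext_isCont: "hol_ext f c \<Longrightarrow> isCont f c"
  by (metis DERIV_isCont abs_zero cancel_comm_monoid_add_class.diff_cancel hol_ext_C1)

lemma hol_ext_cong:
  assumes "hol_ext f c" "\<forall>\<^sub>F x in nhds c. f x = g x"
  shows "hol_ext g c"
proof -
  obtain r F where r: "r > 0" and F: "F holomorphic_on ball (complex_of_real c) r"
    and Ff: "\<And>x. \<bar>x - c\<bar> < r \<Longrightarrow> F (of_real x) = of_real (f x)"
    using assms unfolding hol_ext_def by blast
  obtain d where d: "d > 0" "\<And>x. \<bar>x - c\<bar> < d \<Longrightarrow> f x = g x"
    using assms(2) unfolding eventually_nhds_metric by (auto simp: dist_real_def)
  show ?thesis unfolding hol_ext_def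
    using r d F Ff
    by (intro exI[of _ "min r d"] conjI exI[of _ F] holomorphic_on_subset[OF F]) auto
qed

lemma hol_ext_compose:
  assumes "hol_ext g c" "hol_ext f (g c)"
  shows "hol_ext (\<lambda>x. f (g x)) c"
proof -
  obtain r G where r: "r > 0" and G: "G holomorphic_on ball (complex_of_real c) r"
    and Gg: "\<And>x. \<bar>x - c\<bar> < r \<Longrightarrow> G (of_real x) = of_real (g x)"
    using assms unfolding hol_ext_def by blast
  obtain s F where s: "s > 0" and F: "F holomorphic_on ball (complex_of_real (g c)) s"
    and Ff: "\<And>x. \<bar>x - g c\<bar> < s \<Longrightarrow> F (of_real x) = of_real (f x)"
    using assms unfolding hol_ext_def by blast
  have "continuous_on (ball (complex_of_real c) r) G"
    by (rule holomorphic_on_imp_continuous_on[OF G])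
  then have "isCont G (of_real c)"
    using r by (simp add: continuous_on_eq_continuous_at)
  then obtain d where d: "d > 0" "\<And>z. dist z (of_real c) < d \<Longrightarrow> dist (G z) (G (of_real c)) < s"
    using s unfolding continuous_at_eps_delta by blast
  have Gc: "G (of_real c) = of_real (g c)" using Gg[of c] r by simp
  have sub: "G ` ball (of_real c) (min r d) \<subseteq> ball (of_real (g c)) s"
    using d(2) unfolding Gc by (auto simp: dist_commute)
  have "(F \<circ> G) holomorphic_on ball (of_real c) (min r d)"
    by (intro holomorphic_on_compose holomorphic_on_subset[OF G] holomorphic_on_subset[OF F sub])
      auto
  moreover have "(F \<circ> G) (of_real x) = of_real (f (g x))" if "\<bar>x - c\<bar> < min r d" for x
  proof -
    have "complex_of_real (g x) \<in> ball (of_real (g c)) s"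
      using subsetD[OF sub imageI[of "of_real x"]] that Gg[of x]
      by (simp add: dist_real_def abs_minus_commute)
    then show ?thesis using Gg[of x] that Ff[of "g x"]
      by (auto simp: dist_real_def abs_minus_commute)
  qed
  ultimately show ?thesis unfolding hol_ext_def using r d(1)
    by (intro exI[of _ "min r d"] conjI exI[of _ "F \<circ> G"]) auto
qed

lemma hol_ext_diff:
  assumes "hol_ext f c" "hol_ext g c"
  shows "hol_ext (\<lambda>x. f x - g x) c"
proof -
  obtain r F where r: "r > 0" and F: "F holomorphic_on ball (complex_of_real c) r"
    and Ff: "\<And>x. \<bar>x - c\<bar> < r \<Longrightarrow> F (of_real x) = of_real (f x)"
    using assms unfolding hol_ext_def by blast
  obtain s G where s: "s > 0" and G: "G holomorphic_on ball (complex_of_real c) s"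
    and Gg: "\<And>x. \<bar>x - c\<bar> < s \<Longrightarrow> G (of_real x) = of_real (g x)"
    using assms unfolding hol_ext_def by blast
  have "(\<lambda>z. F z - G z) holomorphic_on ball (of_real c) (min r s)"
    by (intro holomorphic_intros holomorphic_on_subset[OF F] holomorphic_on_subset[OF G]) auto
  then show ?thesis unfolding hol_ext_def using r s Ff Gg
    by (intro exI[of _ "min r s"] conjI exI[of _ "\<lambda>z. F z - G z"]) auto
qed

lemma hol_ext_const: "hol_ext (\<lambda>_. a) c"
  unfolding hol_ext_def by (intro exI[of _ 1] conjI exI[of _ "\<lambda>_. of_real a"]) auto

lemma hol_ext_ident: "hol_ext (\<lambda>x. x) c"
  unfolding hol_ext_def by (intro exI[of _ 1] conjI exI[of _ "\<lambda>x. x"]) auto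

lemma hol_ext_uminus: "hol_ext f c \<Longrightarrow> hol_ext (\<lambda>x. - f x) c"
  using hol_ext_diff[OF hol_ext_const[of 0 c], of f] by simp

lemma hol_ext_add: "hol_ext f c \<Longrightarrow> hol_ext g c \<Longrightarrow> hol_ext (\<lambda>x. f x + g x) c"
  using hol_ext_diff[of f c "\<lambda>x. - g x"] hol_ext_uminus by simp

section \<open>Symmetries of a function modulo analytic functions\<close>

text \<open>
  The relation \<open>f \<circ> g = f + k\<close> near \<open>0\<close>: \<open>g\<close> and \<open>k\<close> live on a complex disc, but \<open>f\<close> is evaluated
  only at real points. Confining these to a closed set \<open>K\<close> makes the relation closed under
  locally uniform limits.
\<close>

definition symm :: "(real \<Rightarrow> real) \<Rightarrow> real set \<Rightarrow> real \<Rightarrow> (complex \<Rightarrow> complex) \<Rightarrow> (complex \<Rightarrow> complex) \<Rightarrow> bool"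
  where "symm f K r g k \<longleftrightarrow> g holomorphic_on ball 0 r \<and> k holomorphic_on ball 0 r \<and>
    (\<forall>x. \<bar>x\<bar> < r \<longrightarrow> x \<in> K \<and>
      (\<exists>y\<in>K. g (of_real x) = of_real y \<and> k (of_real x) = of_real (f y - f x)))"

lemma symmD:
  assumes "symm f K r g k"
  shows "g holomorphic_on ball 0 r" "k holomorphic_on ball 0 r"
    "\<And>x. \<bar>x\<bar> < r \<Longrightarrow> x \<in> K"
    "\<And>x. \<bar>x\<bar> < r \<Longrightarrow> g (of_real x) = of_real (Re (g (of_real x)))"
    "\<And>x. \<bar>x\<bar> < r \<Longrightarrow> Re (g (of_real x)) \<in> K"
    "\<And>x. \<bar>x\<bar> < r \<Longrightarrow> k (of_real x) = of_real (f (Re (g (of_real x))) - f x)"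
proof -
  have *: "x \<in> K \<and> (\<exists>y\<in>K. g (of_real x) = of_real y \<and> k (of_real x) = of_real (f y - f x))"
    if "\<bar>x\<bar> < r" for x
    using assms that unfolding symm_def by blast
  show "g holomorphic_on ball 0 r" "k holomorphic_on ball 0 r"
    using assms unfolding symm_def by auto
  fix x assume "\<bar>x\<bar> < r"
  with * obtain y where y: "x \<in> K" "y \<in> K" "g (of_real x) = of_real y"
    "k (of_real x) = of_real (f y - f x)" by blast
  then show "x \<in> K" "g (of_real x) = of_real (Re (g (of_real x)))" "Re (g (of_real x)) \<in> K"
    "k (of_real x) = of_real (f (Re (g (of_real x))) - f x)" by simp_all
qed

lemma symm_mono: "symm f K r g k \<Longrightarrow> s \<le> r \<Longrightarrow> symm f K s g k"
  unfolding symm_def by (auto intro: holomorphic_on_subset)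

text \<open>Telescoping \<open>k = f \<circ> g - f\<close> along an orbit that tends to \<open>0\<close>.\<close>

lemma hol_ext_of_iterates:
  fixes f :: "real \<Rightarrow> real"
  assumes P: "open P" and g: "g ` P \<subseteq> P" "g holomorphic_on P" and k: "k holomorphic_on P"
    and M: "\<And>z j. z \<in> P \<Longrightarrow> cmod (k ((g ^^ j) z)) \<le> M j" "summable M"
    and real: "\<And>x. of_real x \<in> P \<Longrightarrow> \<exists>y. g (of_real x) = of_real y \<and> k (of_real x) = of_real (f y - f x)"
    and lim: "\<And>z. z \<in> P \<Longrightarrow> (\<lambda>j. (g ^^ j) z) \<longlonglongrightarrow> 0"
    and cont: "isCont f 0" and x0: "of_real x0 \<in> P"
  shows "hol_ext f x0"
proof -
  have itP: "(g ^^ j) z \<in> P" if "z \<in> P" for j z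
    using that g(1) by (induction j) auto
  have ith: "(g ^^ j) holomorphic_on P" for j
  proof (induction j)
    case (Suc j)
    have "(g \<circ> (g ^^ j)) holomorphic_on P"
      using itP by (intro holomorphic_on_compose Suc holomorphic_on_subset[OF g(2)]) auto
    then show ?case by (simp add: o_def)
  qed (simp add: id_def)
  define S where "S n z = (\<Sum>j<n. k ((g ^^ j) z))" for n z
  define T where "T z = (\<Sum>j. k ((g ^^ j) z))" for z
  have ul: "uniform_limit P S T sequentially"
    unfolding S_def T_def by (rule Weierstrass_m_test[OF M])
  have Sh: "S n holomorphic_on P" for n
  proof -
    have "(\<lambda>z. k ((g ^^ j) z)) holomorphic_on P" for j
      using itP by (intro holomorphic_on_compose[OF ith, unfolded o_def] holomorphic_on_subset[OF k]) auto
    then show ?thesis unfolding S_def by (intro holomorphic_intros)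
  qed
  have Th: "T holomorphic_on P"
  proof (rule holomorphic_uniform_sequence[OF P Sh])
    fix x assume "x \<in> P"
    then obtain d where "d > 0" "cball x d \<subseteq> P" using P open_contains_cball by blast
    then show "\<exists>d>0. cball x d \<subseteq> P \<and> uniform_limit (cball x d) S T sequentially"
      using uniform_limit_on_subset[OF ul] by blast
  qed
  \<comment> \<open>In the parabolic application \<open>0\<close> is only a boundary point of
    \<open>P\<close>; \<open>f 0\<close> enters as the limit of \<open>f\<close> along a real
    orbit.\<close>
  have Tf: "of_real (f 0) - T (of_real x) = of_real (f x)" if x: "of_real x \<in> P" for x
  proof -
    define it where "it j = Re ((g ^^ j) (of_real x))" for j
    have it: "(g ^^ j) (of_real x) = of_real (it j)" for j
    proof (induction j)
      case (Suc j)
      have "of_real (it j) \<in> P" using itP[OF x, of j] Suc by simp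
      from real[OF this] obtain y where "g (of_real (it j)) = of_real y" by blast
      then show ?case unfolding it_def[of "Suc j"] using Suc by simp
    qed (simp add: it_def)
    have kk: "k ((g ^^ j) (of_real x)) = of_real (f (it (Suc j)) - f (it j))" for j
    proof -
      have "of_real (it j) \<in> P" using itP[OF x, of j] it by simp
      from real[OF this] obtain y where y: "g (of_real (it j)) = of_real y"
        "k (of_real (it j)) = of_real (f y - f (it j))" by blast
      have "y = it (Suc j)" using y(1) it[of j] unfolding it_def[of "Suc j"] by simp
      then show ?thesis using y(2) it[of j] by simp
    qed
    have "S n (of_real x) = of_real (f (it n) - f x)" for n
    proof -
      have "S n (of_real x) = (\<Sum>j<n. of_real (f (it (Suc j))) - of_real (f (it j)))"
        unfolding S_def kk by simp
      also have "\<dots> = of_real (f (it n)) - of_real (f (it 0))"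
        by (rule sum_lessThan_telescope)
      finally show ?thesis by (simp add: it_def)
    qed
    moreover have "(\<lambda>n. S n (of_real x)) \<longlonglongrightarrow> T (of_real x)"
      using tendsto_uniform_limitI[OF ul x] .
    moreover have "(\<lambda>n. of_real (f (it n) - f x)) \<longlonglongrightarrow> complex_of_real (f 0 - f x)"
    proof -
      have "it \<longlonglongrightarrow> 0" unfolding it_def using tendsto_Re[OF lim[OF x]] by simp
      then have "(\<lambda>n. f (it n)) \<longlonglongrightarrow> f 0" using cont isCont_tendsto_compose by blast
      then show ?thesis by (intro tendsto_intros)
    qed
    ultimately have "T (of_real x) = of_real (f 0 - f x)"
      using LIMSEQ_unique by simp
    then show ?thesis by simp
  qed
  obtain d where d: "d > 0" "ball (complex_of_real x0) d \<subseteq> P"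
    using P x0 open_contains_ball by blast
  have "(\<lambda>z. of_real (f 0) - T z) holomorphic_on ball (of_real x0) d"
    using d(2) by (intro holomorphic_intros holomorphic_on_subset[OF Th])
  moreover have "of_real (f 0) - T (of_real x) = of_real (f x)" if "\<bar>x - x0\<bar> < d" for x
    using that d by (intro Tf) (auto simp: dist_real_def abs_minus_commute subset_eq)
  ultimately show ?thesis unfolding hol_ext_def using d(1) by blast
qed

section \<open>Analyticity near an attracting fixed point\<close>

text \<open>Bounds on \<open>k\<close> come from \<open>f\<close>, hence from real points. One side
  of the axis determines the order of vanishing: in \<open>k z = z ^ m * w z\<close> with
  \<open>w 0 \<noteq> 0\<close>, an order \<open>m < n\<close> would make \<open>w\<close> tend to 0
  along the positive reals.\<close>

lemma holomorphic_order_bound: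
  assumes hol: "k holomorphic_on ball 0 r" "r > 0" and k0: "k 0 = 0"
    and bd: "\<forall>\<^sub>F x in at_right 0. cmod (k (of_real x)) \<le> C * x ^ n"
  shows "\<exists>C'. \<forall>\<^sub>F z in nhds 0. cmod (k z) \<le> C' * cmod z ^ n"
proof (cases "k constant_on ball 0 r")
  case True
  then have "k z = 0" if "z \<in> ball 0 r" for z
    using that k0 hol(2) unfolding constant_on_def by (metis centre_in_ball)
  moreover have "\<forall>\<^sub>F z in nhds 0. z \<in> ball 0 r"
    using hol(2) by (intro eventually_nhds_in_open) auto
  ultimately show ?thesis
    by (intro exI[of _ 0]) (auto elim: eventually_mono)
next
  case False
  obtain w s and m :: nat where m: "0 < m" "0 < s" "ball (0::complex) s \<subseteq> ball 0 r" "w holomorphic_on ball 0 s"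
    "\<And>z. z \<in> ball 0 s \<Longrightarrow> k z = (z - 0) ^ m * w z" "\<And>z. z \<in> ball 0 s \<Longrightarrow> w z \<noteq> 0"
  proof (rule holomorphic_factor_zero_nonconstant[OF hol(1) open_ball connected_ball _ k0 False])
    show "0 \<in> ball (0::complex) r" using hol(2) by simp
  qed (rule that)
  have contw: "isCont w 0"
    using holomorphic_on_imp_continuous_on[OF m(4)] m(2) by (simp add: continuous_on_eq_continuous_at)
  have "n \<le> m"
  proof (rule ccontr)
    assume "\<not> n \<le> m"
    then have nm: "n - m > 0" "n = m + (n - m)" by auto
    have lim1: "((\<lambda>x. cmod (w (of_real x))) \<longlongrightarrow> cmod (w 0)) (at_right 0)"
    proof -
      have "((\<lambda>x. complex_of_real x) \<longlongrightarrow> of_real 0) (at_right 0)" by (intro tendsto_intros)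
      then show ?thesis using contw isCont_tendsto_compose
        by (intro tendsto_norm) auto
    qed
    have lim2: "((\<lambda>x. C * x ^ (n - m)) \<longlongrightarrow> C * 0 ^ (n - m)) (at_right (0::real))"
      by (intro tendsto_intros)
    have "\<forall>\<^sub>F x in at_right 0. x \<in> {0<..<s}"
      using m(2) by (intro eventually_at_right_real)
    with bd have "\<forall>\<^sub>F x in at_right 0. cmod (w (of_real x)) \<le> C * x ^ (n - m)"
    proof eventually_elim
      case (elim x)
      then have "cmod (k (of_real x)) = x ^ m * cmod (w (of_real x))"
        using m(5)[of "of_real x"] by (simp add: norm_mult norm_power)
      with elim have "x ^ m * cmod (w (of_real x)) \<le> C * x ^ n" by simp
      also have "C * x ^ n = x ^ m * (C * x ^ (n - m))"
        by (subst nm(2)) (simp add: power_add mult_ac)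
      finally show ?case using elim by simp
    qed
    then have "cmod (w 0) \<le> C * 0 ^ (n - m)"
      by (intro tendsto_le[OF _ lim2 lim1]) auto
    then show False using m(2) m(6)[of 0] nm by (simp add: power_0_left)
  qed
  have "((\<lambda>z. cmod (w z)) \<longlongrightarrow> cmod (w 0)) (nhds 0)"
    using contw by (intro tendsto_norm) (simp add: isCont_def tendsto_at_iff_tendsto_nhds)
  then have "\<forall>\<^sub>F z in nhds 0. cmod (w z) < cmod (w 0) + 1"
    by (rule order_tendstoD) simp
  \<comment> \<open>Inside the unit disc \<open>cmod z ^ m\<close> is at most
    \<open>cmod z ^ n\<close>, because \<open>n \<le> m\<close>.\<close>
  moreover have "\<forall>\<^sub>F z in nhds 0. z \<in> ball 0 (min s 1)"
    using m(2) by (intro eventually_nhds_in_open) auto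
  ultimately have "\<forall>\<^sub>F z in nhds 0. cmod (k z) \<le> (cmod (w 0) + 1) * cmod z ^ n"
  proof eventually_elim
    case (elim z)
    have "cmod (k z) = cmod z ^ m * cmod (w z)"
      using m(5)[of z] elim by (simp add: norm_mult norm_power)
    also have "\<dots> \<le> cmod z ^ n * (cmod (w 0) + 1)"
      using elim \<open>n \<le> m\<close> by (intro mult_mono power_decreasing) auto
    finally show ?case by (simp add: mult.commute)
  qed
  then show ?thesis by blast
qed

text \<open>A small disc is invariant, orbits in it decay like \<open>q ^ j\<close>, and the linear
  bound on \<open>k\<close> gives the telescoping series a geometric majorant. The point found is
  \<open>0\<close> itself.\<close>

lemma contracting_imp_hol_ext:
  fixes f :: "real \<Rightarrow> real"
  assumes sy: "symm f K r g k" "r > 0" and lam: "0 < q" "q < 1" and C: "C \<ge> 0"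
    and g: "\<forall>\<^sub>F z in nhds 0. cmod (g z) \<le> q * cmod z"
    and k: "\<forall>\<^sub>F z in nhds 0. cmod (k z) \<le> C * cmod z"
    and cont: "isCont f 0"
  shows "\<exists>x\<in>K. hol_ext f x"
proof -
  have "\<forall>\<^sub>F z in nhds 0. z \<in> ball 0 r \<and> cmod (g z) \<le> q * cmod z \<and> cmod (k z) \<le> C * cmod z"
    using sy(2) g k by (intro eventually_conj eventually_nhds_in_open) auto
  then obtain s where s: "s > 0"
    "\<And>z. z \<in> ball 0 s \<Longrightarrow> z \<in> ball 0 r \<and> cmod (g z) \<le> q * cmod z \<and> cmod (k z) \<le> C * cmod z"
    unfolding eventually_nhds_metric by (auto simp: dist_commute)
  have gP: "g ` ball 0 s \<subseteq> ball 0 s"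
  proof clarsimp
    fix z assume z: "cmod z < s"
    then have "cmod (g z) \<le> q * cmod z" using s(2)[of z] by simp
    also have "\<dots> \<le> 1 * cmod z" using lam by (intro mult_right_mono) auto
    finally show "cmod (g z) < s" using z by simp
  qed
  have it: "(g ^^ j) z \<in> ball 0 s \<and> cmod ((g ^^ j) z) \<le> q ^ j * cmod z" if "z \<in> ball 0 s" for z j
  proof (induction j)
    case (Suc j)
    then have "cmod (g ((g ^^ j) z)) \<le> q * cmod ((g ^^ j) z)" using s(2) by blast
    also have "\<dots> \<le> q * (q ^ j * cmod z)" using Suc lam by (intro mult_left_mono) auto
    moreover have "g ((g ^^ j) z) \<in> ball 0 s" using Suc gP by blast
    ultimately show ?case by (simp add: mult_ac)
  qed (use that in auto)
  have "hol_ext f 0"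
  proof (rule hol_ext_of_iterates[where P = "ball 0 s" and g = g and k = k and M = "\<lambda>j. C * s * q ^ j"])
    show "g holomorphic_on ball 0 s" "k holomorphic_on ball 0 s"
      using symmD(1,2)[OF sy(1)] s(2) by (auto intro: holomorphic_on_subset)
    fix z :: complex assume z: "z \<in> ball 0 s"
    show "cmod (k ((g ^^ j) z)) \<le> C * s * q ^ j" for j
    proof -
      have "cmod (k ((g ^^ j) z)) \<le> C * cmod ((g ^^ j) z)" using s(2) it[OF z] by blast
      also have "\<dots> \<le> C * (q ^ j * s)"
        using it[OF z, of j] C lam z by (intro mult_left_mono order_trans[OF conjunct2[OF it[OF z]]]) auto
      finally show ?thesis by (simp add: mult_ac)
    qed
    have "(\<lambda>j. q ^ j * cmod z) \<longlonglongrightarrow> 0 * cmod z"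
      using lam by (intro tendsto_intros) auto
    then have l0: "(\<lambda>j. q ^ j * cmod z) \<longlonglongrightarrow> 0" by simp
    have bd: "\<forall>j. cmod ((g ^^ j) z) \<le> q ^ j * cmod z" using it[OF z] by blast
    show "(\<lambda>j. (g ^^ j) z) \<longlonglongrightarrow> 0"
      by (rule Lim_null_comparison[OF always_eventually[OF bd] l0])
  next
    show "summable (\<lambda>j. C * s * q ^ j)" using lam by (intro summable_mult summable_geometric) auto
    show "\<exists>y. g (of_real x) = of_real y \<and> k (of_real x) = of_real (f y - f x)"
      if "complex_of_real x \<in> ball 0 s" for x
      using s(2)[OF that] symmD(4,6)[OF sy(1), of x] by (intro exI[of _ "Re (g (of_real x))"]) auto
  qed (use cont gP s(1) in auto)
  moreover have "0 \<in> K" using symmD(3)[OF sy(1), of 0] sy(2) by simp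
  ultimately show ?thesis by blast
qed

text \<open>
  A map \<open>z + c z\<^sup>d\<^sup>+\<^sup>1 + \<dots>\<close> is a translation to leading order in the coordinate \<open>1/z\<^sup>d\<close>. So its orbits
  in the petals \<open>Re (1/z\<^sup>d) > R\<close> satisfy \<open>|z\<^sub>j|\<^sup>d = O(1/j)\<close>, and \<open>k = O(z\<^sup>d\<^sup>+\<^sup>1)\<close> is summable along them.
\<close>

lemma parabolic_imp_hol_ext:
  fixes f :: "real \<Rightarrow> real"
  assumes sy: "symm f K r g k" "r > 0" and d: "d > 0" and C: "C \<ge> 0" and a: "a > 0"
    and g: "\<forall>\<^sub>F z in at 0. g z \<noteq> 0 \<and> Re (1 / g z ^ d) \<ge> Re (1 / z ^ d) + a"
    and k: "\<forall>\<^sub>F z in nhds 0. cmod (k z) \<le> C * cmod z ^ Suc d"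
    and cont: "isCont f 0"
  shows "\<exists>x\<in>K. hol_ext f x"
proof -
  have "\<forall>\<^sub>F z in at 0. z \<in> ball 0 r - {0} \<and> (g z \<noteq> 0 \<and> Re (1 / g z ^ d) \<ge> Re (1 / z ^ d) + a)
      \<and> cmod (k z) \<le> C * cmod z ^ Suc d"
  proof (intro eventually_conj)
    show "\<forall>\<^sub>F z in at 0. z \<in> ball (0::complex) r - {0}"
      using sy(2) by (intro eventually_at_in_open) auto
    show "\<forall>\<^sub>F z in at 0. cmod (k z) \<le> C * cmod z ^ Suc d"
      using k unfolding eventually_nhds_conv_at by blast
  qed (use g in \<open>auto elim: eventually_mono\<close>)
  then obtain s where s: "s > 0"
    "\<And>z. z \<in> ball 0 s - {0} \<Longrightarrow> z \<in> ball 0 r \<and> g z \<noteq> 0 \<and> Re (1 / g z ^ d) \<ge> Re (1 / z ^ d) + a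
        \<and> cmod (k z) \<le> C * cmod z ^ Suc d"
    unfolding eventually_at by (auto simp: dist_commute)
  \<comment> \<open>The bound \<open>1 / s ^ d\<close> puts the petal inside the disc where the
    estimates hold; the bound \<open>a\<close> gives \<open>R + j * a \<ge> a * Suc j\<close>, so
    that the rate \<open>b j\<close> below is finite at \<open>j = 0\<close> too.\<close>
  define R where "R = max a (1 / s ^ d)"
  have R: "R > 0" "R \<ge> a" "R \<ge> 1 / s ^ d" using a unfolding R_def by auto
  define P where "P = {z::complex. z \<noteq> 0 \<and> Re (1 / z ^ d) > R}"
  have small: "cmod z ^ d < 1 / b" if "z \<noteq> 0" "Re (1 / z ^ d) > b" "b > 0" for z b
  proof -
    have "b < cmod (1 / z ^ d)" using that complex_Re_le_cmod[of "1 / z ^ d"] by linarith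
    then show ?thesis using that by (simp add: norm_divide norm_power field_simps)
  qed
  have Ps: "P \<subseteq> ball 0 s - {0}"
  proof
    fix z assume z: "z \<in> P"
    then have "cmod z ^ d < 1 / R" using small[of z R] R unfolding P_def by auto
    also have "\<dots> \<le> s ^ d" using R s(1) by (simp add: field_simps)
    finally have "cmod z < s" using s(1) by (meson less_imp_le power_less_imp_less_base)
    then show "z \<in> ball 0 s - {0}" using z unfolding P_def by auto
  qed
  have sP: "z \<in> ball 0 r" "g z \<noteq> 0" "Re (1 / g z ^ d) \<ge> Re (1 / z ^ d) + a"
    "cmod (k z) \<le> C * cmod z ^ Suc d" if "z \<in> P" for z
    using s(2)[OF subsetD[OF Ps that]] by simp_all
  have gP: "g ` P \<subseteq> P"
  proof
    fix w assume "w \<in> g ` P"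
    then obtain z where z: "z \<in> P" "w = g z" by blast
    then have "g z \<noteq> 0" "Re (1 / g z ^ d) \<ge> Re (1 / z ^ d) + a" using sP[OF z(1)] by simp_all
    then show "w \<in> P" using z a unfolding P_def by (simp del: one_divide_eq_0_iff)
  qed
  have P_open: "open P"
  proof -
    have "continuous_on (- {0}) (\<lambda>z::complex. Re (1 / z ^ d))"
      by (intro continuous_intros) auto
    then have "open (- {0} \<inter> (\<lambda>z::complex. Re (1 / z ^ d)) -` {R<..})"
      by (rule continuous_open_preimage) auto
    moreover have "- {0} \<inter> (\<lambda>z::complex. Re (1 / z ^ d)) -` {R<..} = P"
      unfolding P_def by auto
    ultimately show ?thesis by simp
  qed
  have it: "(g ^^ j) z \<in> P \<and> Re (1 / (g ^^ j) z ^ d) > R + j * a" if "z \<in> P" for z j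
  proof (induction j)
    case 0
    then show ?case using that unfolding P_def by auto
  next
    case (Suc j)
    then have "Re (1 / g ((g ^^ j) z) ^ d) \<ge> Re (1 / ((g ^^ j) z) ^ d) + a" using sP by blast
    moreover have "g ((g ^^ j) z) \<in> P" using Suc gP by blast
    ultimately show ?case using Suc by (simp add: algebra_simps del: Re_divide)
  qed
  \<comment> \<open>The orbit decays only like a power of \<open>1 / j\<close>, but
    \<open>b j ^ Suc d\<close> carries the exponent \<open>1 + 1 / d\<close>, which exceeds 1 and
    makes the majorant summable.\<close>
  define b where "b j = (1 / (a * real (Suc j))) powr (1 / d)" for j
  have itb: "cmod ((g ^^ j) z) \<le> b j" if "z \<in> P" for z j
  proof -
    let ?z = "(g ^^ j) z"
    have "R + j * a \<ge> a * Suc j" using R by (simp add: algebra_simps)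
    then have "Re (1 / ?z ^ d) > a * Suc j" using it[OF that, of j] by linarith
    then have "cmod ?z ^ d < 1 / (a * Suc j)"
      using it[OF that, of j] a unfolding P_def by (intro small) auto
    then have "(cmod ?z ^ d) powr (1 / d) \<le> b j" unfolding b_def by (intro powr_mono2) auto
    moreover have "(cmod ?z ^ d) powr (1 / d) = cmod ?z"
      using it[OF that, of j] d unfolding P_def
      by (simp add: powr_realpow[symmetric] powr_powr)
    ultimately show ?thesis by simp
  qed
  have b_pow: "b j ^ Suc d = (1 / a) powr (Suc d / d) * real (Suc j) powr (- (Suc d / d))" for j
  proof -
    have "b j ^ Suc d = (1 / (a * real (Suc j))) powr (Suc d / d)"
      unfolding b_def using a by (subst powr_power) auto
    also have "1 / (a * real (Suc j)) = (1 / a) * (1 / real (Suc j))" by simp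
    also have "\<dots> powr (Suc d / d) = (1 / a) powr (Suc d / d) * (1 / real (Suc j)) powr (Suc d / d)"
      by (rule powr_mult)
    also have "(1 / real (Suc j)) powr (Suc d / d) = real (Suc j) powr (- (Suc d / d))"
      by (simp add: powr_divide powr_minus field_simps)
    finally show ?thesis .
  qed
  have b0: "b \<longlonglongrightarrow> 0"
  proof -
    have "b = (\<lambda>j. (1 / a) powr (1 / d) * real (Suc j) powr (- (1 / d)))"
    proof
      fix j
      have "1 / (a * real (Suc j)) = (1 / a) * (1 / real (Suc j))" by simp
      then have "b j = (1 / a) powr (1 / d) * (1 / real (Suc j)) powr (1 / d)"
        unfolding b_def using a by (simp only: powr_mult)
      then show "b j = (1 / a) powr (1 / d) * real (Suc j) powr (- (1 / d))"
        by (simp add: powr_divide powr_minus field_simps)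
    qed
    moreover have "(\<lambda>j. real (Suc j) powr (- (1 / d))) \<longlonglongrightarrow> 0"
    proof -
      have "filterlim (\<lambda>j. real (Suc j)) at_top sequentially"
        using filterlim_real_sequentially filterlim_compose[OF _ filterlim_Suc] by blast
      then show ?thesis using d by (intro tendsto_neg_powr) auto
    qed
    ultimately show ?thesis using tendsto_mult_right_zero by auto
  qed
  have he: "hol_ext f x" if "of_real x \<in> P" for x
  proof (rule hol_ext_of_iterates[where P = P and g = g and k = k and M = "\<lambda>j. C * b j ^ Suc d"])
    show "g holomorphic_on P" "k holomorphic_on P"
      using symmD(1,2)[OF sy(1)] sP(1) by (meson holomorphic_on_subset subsetI)+
    fix z :: complex assume z: "z \<in> P"
    show "cmod (k ((g ^^ j) z)) \<le> C * b j ^ Suc d" for j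
    proof -
      have "cmod (k ((g ^^ j) z)) \<le> C * cmod ((g ^^ j) z) ^ Suc d" using sP(4) it[OF z] by blast
      also have "\<dots> \<le> C * b j ^ Suc d"
        using power_mono[OF itb[OF z, of j] norm_ge_zero] C by (rule mult_left_mono)
      finally show ?thesis .
    qed
    show "(\<lambda>j. (g ^^ j) z) \<longlonglongrightarrow> 0"
      by (rule Lim_null_comparison[OF always_eventually b0]) (use itb[OF z] in blast)
  next
    have "summable (\<lambda>j. real j powr (- (Suc d / d)))"
      using d by (subst summable_real_powr_iff) (auto simp: field_simps)
    then have "summable (\<lambda>j. real (Suc j) powr (- (Suc d / d)))"
      by (subst (asm) summable_Suc_iff[symmetric])
    then show "summable (\<lambda>j. C * b j ^ Suc d)"
      unfolding b_pow by (intro summable_mult)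
    show "\<exists>y. g (of_real x) = of_real y \<and> k (of_real x) = of_real (f y - f x)"
      if "complex_of_real x \<in> P" for x
    proof -
      have "of_real x \<in> ball (0::complex) r" using that sP(1) by blast
      then have "\<bar>x\<bar> < r" by simp
      then show ?thesis using symmD(4,6)[OF sy(1), of x] by (intro exI[of _ "Re (g (of_real x))"]) auto
    qed
  qed (use that cont gP P_open in auto)
  \<comment> \<open>A real point of the petal: \<open>1 / x ^ d = (R + 1) ^ d\<close>, which is at
    least \<open>R + 1\<close>.\<close>
  define x where "x = 1 / (R + 1)"
  have "(R + 1) ^ 1 \<le> (R + 1) ^ d" using R d by (intro power_increasing) auto
  moreover have "1 / complex_of_real x ^ d = of_real ((R + 1) ^ d)"
    unfolding x_def by (simp add: power_one_over)
  ultimately have "Re (1 / complex_of_real x ^ d) > R" by (simp only: Re_complex_of_real) simp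
  moreover have "x \<noteq> 0" unfolding x_def using R by simp
  ultimately have xP: "of_real x \<in> P" unfolding P_def by simp
  then have "of_real x \<in> ball (0::complex) r" using sP(1) by blast
  then have "x \<in> K" using symmD(3)[OF sy(1), of x] by simp
  then show ?thesis using he[OF xP] by blast
qed

text \<open>Both points are free, instead of one being \<open>0\<close>: the bound is applied to
  \<open>x\<close> and \<open>g x\<close>, whose distance is of higher order than \<open>x\<close>
  when the multiplier is 1.\<close>

definition lipschitz_at0 :: "(real \<Rightarrow> real) \<Rightarrow> bool" where
  "lipschitz_at0 f \<longleftrightarrow> (\<exists>L s. s > 0 \<and> L \<ge> 0 \<and> (\<forall>x y. \<bar>x\<bar> < s \<longrightarrow> \<bar>y\<bar> < s \<longrightarrow> \<bar>f x - f y\<bar> \<le> L * \<bar>x - y\<bar>))"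

lemma lipschitz_at0_isCont: "lipschitz_at0 f \<Longrightarrow> isCont f 0"
proof -
  assume "lipschitz_at0 f"
  then obtain L s where L: "s > 0" "L \<ge> 0"
    "\<And>x y. \<bar>x\<bar> < s \<Longrightarrow> \<bar>y\<bar> < s \<Longrightarrow> \<bar>f x - f y\<bar> \<le> L * \<bar>x - y\<bar>"
    unfolding lipschitz_at0_def by blast
  have "((\<lambda>x. L * \<bar>x\<bar>) \<longlongrightarrow> L * \<bar>0\<bar>) (at 0)" by (intro tendsto_intros)
  then have l: "((\<lambda>x. L * \<bar>x\<bar>) \<longlongrightarrow> 0) (at 0)" by simp
  have "\<forall>\<^sub>F x in at 0. x \<in> ball 0 s - {0::real}" using L(1) by (intro eventually_at_in_open) auto
  then have "\<forall>\<^sub>F x in at 0. norm (f x - f 0) \<le> L * \<bar>x\<bar>"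
    by eventually_elim (use L(1) L(3)[of _ 0] in auto)
  then have "((\<lambda>x. f x - f 0) \<longlongrightarrow> 0) (at 0)" by (rule Lim_null_comparison[OF _ l])
  then show "isCont f 0" by (simp add: isCont_def LIM_zero_cancel)
qed

lemma tendsto_of_real_at_right:
  assumes "isCont w (0::complex)"
  shows "((\<lambda>x. w (of_real x)) \<longlongrightarrow> w 0) (at_right 0)"
proof -
  have "((\<lambda>x. complex_of_real x) \<longlongrightarrow> of_real 0) (at_right 0)" by (intro tendsto_intros)
  then show ?thesis using assms isCont_tendsto_compose by fastforce
qed

text \<open>Write \<open>g z = z + z ^ n * w z\<close> with \<open>w 0 \<noteq> 0\<close>.
  Attraction from the right forces \<open>w 0\<close> to be real and negative. For
  \<open>n = 1\<close> the multiplier \<open>1 + w 0\<close> lies strictly between 0 and 1,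
  positivity being the hypothesis on \<open>deriv g 0\<close>; for \<open>n > 1\<close> it equals 1
  and the positive reals point into an attracting petal with \<open>d = n - 1\<close>.\<close>

lemma attracting_imp_hol_ext:
  fixes f :: "real \<Rightarrow> real"
  assumes sy: "symm f K r g k" "r > 0" and g0: "g 0 = 0" and D: "Re (deriv g 0) > 0"
    and lip: "lipschitz_at0 f"
    and neg: "\<forall>\<^sub>F x in at_right 0. Re (g (of_real x)) < x"
  shows "\<exists>x\<in>K. hol_ext f x"
proof -
  note contf = lipschitz_at0_isCont[OF lip]
  define u where "u z = g z - z" for z
  have uh: "u holomorphic_on ball 0 r"
    unfolding u_def using symmD(1)[OF sy(1)] by (intro holomorphic_intros)
  have ev_r: "\<forall>\<^sub>F x in at_right 0. x \<in> {0<..<r}"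
    using sy(2) by (intro eventually_at_right_real)
  have u0: "u 0 = 0" using g0 by (simp add: u_def)
  have "\<not> u constant_on ball 0 r"
  proof
    assume "u constant_on ball 0 r"
    then have z: "u z = 0" if "z \<in> ball 0 r" for z
      using that u0 sy(2) unfolding constant_on_def by (metis centre_in_ball)
    have "\<forall>\<^sub>F x in at_right (0::real). False"
      using neg ev_r by eventually_elim (use z u_def in force)
    then show False by simp
  qed
  then obtain w s and n :: nat where n: "0 < n" "0 < s" "ball (0::complex) s \<subseteq> ball 0 r"
    "w holomorphic_on ball 0 s"
    "\<And>z. z \<in> ball 0 s \<Longrightarrow> u z = (z - 0) ^ n * w z" "\<And>z. z \<in> ball 0 s \<Longrightarrow> w z \<noteq> 0"
    using holomorphic_factor_zero_nonconstant[OF uh open_ball connected_ball _ u0] sy(2) centre_in_ball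
    by metis
  have contw: "isCont w 0"
    using holomorphic_on_imp_continuous_on[OF n(4)] n(2) by (simp add: continuous_on_eq_continuous_at)
  have gz: "g z = z + z ^ n * w z" if "cmod z < s" for z
    using n(5)[of z] that unfolding u_def by (simp add: algebra_simps)
  have limw: "((\<lambda>x. w (of_real x)) \<longlongrightarrow> w 0) (at_right 0)"
    by (rule tendsto_of_real_at_right[OF contw])
  have ev_s: "\<forall>\<^sub>F x in at_right 0. x \<in> {0<..<s}"
    using n(2) by (intro eventually_at_right_real)
  \<comment> \<open>On the positive reals \<open>w x\<close> is \<open>(g x - x) / x ^ n\<close>, a
    real number that is not positive.\<close>
  have wreal: "\<forall>\<^sub>F x in at_right 0. Re (w (of_real x)) \<le> 0 \<and> Im (w (of_real x)) = 0"
    using neg ev_r ev_s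
  proof eventually_elim
    case (elim x)
    have "of_real x ^ n * w (of_real x) = g (of_real x) - of_real x"
      using gz[of "of_real x"] elim by simp
    also have "\<dots> = of_real (Re (g (of_real x)) - x)"
      using symmD(4)[OF sy(1), of x] elim by simp
    finally have "w (of_real x) = of_real ((Re (g (of_real x)) - x) / x ^ n)"
      using elim by (simp add: field_simps)
    then show ?case using elim by (simp add: divide_le_0_iff)
  qed
  have "Re (w 0) \<le> 0"
    using wreal by (intro tendsto_upperbound[OF tendsto_Re[OF limw]]) (auto elim: eventually_mono)
  moreover have "Im (w 0) = 0"
  proof -
    have "((\<lambda>x. Im (w (of_real x))) \<longlongrightarrow> 0) (at_right 0)"
      by (rule tendsto_eventually) (use wreal in \<open>auto elim: eventually_mono\<close>)
    then show ?thesis using tendsto_Im[OF limw] tendsto_unique by (metis trivial_limit_at_right_real)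
  qed
  moreover have "w 0 \<noteq> 0" using n(2) n(6)[of 0] by simp
  ultimately have w0: "w 0 = of_real (Re (w 0))" "Re (w 0) < 0"
    by (auto simp: complex_eq_iff)
  obtain L t where L: "t > 0" "L \<ge> 0"
    "\<And>x y. \<bar>x\<bar> < t \<Longrightarrow> \<bar>y\<bar> < t \<Longrightarrow> \<bar>f x - f y\<bar> \<le> L * \<bar>x - y\<bar>"
    using lip unfolding lipschitz_at0_def by blast
  \<comment> \<open>The Lipschitz bound gives \<open>L\<close> times the distance of
    \<open>g x\<close> and \<open>x\<close>, which is of order \<open>x ^ n\<close>, at real points;
    \<open>holomorphic_order_bound\<close> carries this to a complex neighbourhood.\<close>
  have "\<exists>C. \<forall>\<^sub>F z in nhds 0. cmod (k z) \<le> C * cmod z ^ n"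
  proof (rule holomorphic_order_bound[OF symmD(2)[OF sy(1)] sy(2)])
    show "k 0 = 0" using symmD(6)[OF sy(1), of 0] sy(2) g0 by simp
    have cg: "isCont g 0" using holomorphic_on_imp_continuous_on[OF symmD(1)[OF sy(1)]] sy(2)
      by (simp add: continuous_on_eq_continuous_at)
    have "\<forall>\<^sub>F x in at_right 0. norm (g (of_real x)) < t"
      using tendsto_norm[OF tendsto_of_real_at_right[OF cg]] g0 L(1) by (intro order_tendstoD) auto
    moreover have "\<forall>\<^sub>F x in at_right 0. cmod (w (of_real x)) < cmod (w 0) + 1"
      using tendsto_norm[OF limw] by (rule order_tendstoD) simp
    moreover have "\<forall>\<^sub>F x in at_right 0. x \<in> {0<..<t}"
      using L(1) by (intro eventually_at_right_real)
    ultimately show "\<forall>\<^sub>F x in at_right 0. cmod (k (of_real x)) \<le> (L * (cmod (w 0) + 1)) * x ^ n"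
      using ev_r ev_s
    proof eventually_elim
      case (elim x)
      have "cmod (k (of_real x)) = \<bar>f (Re (g (of_real x))) - f x\<bar>"
        using symmD(6)[OF sy(1), of x] elim by (simp del: of_real_diff)
      also have "\<dots> \<le> L * \<bar>Re (g (of_real x)) - x\<bar>"
        using elim order_le_less_trans[OF abs_Re_le_cmod] by (intro L(3)) auto
      also have "\<dots> \<le> L * cmod (g (of_real x) - of_real x)"
        using abs_Re_le_cmod[of "g (of_real x) - of_real x"] L(2) by (intro mult_left_mono) auto
      also have "cmod (g (of_real x) - of_real x) = x ^ n * cmod (w (of_real x))"
        using gz[of "of_real x"] elim by (simp add: norm_mult norm_power)
      also have "L * (x ^ n * cmod (w (of_real x))) \<le> L * (x ^ n * (cmod (w 0) + 1))"
        using elim L(2) by (intro mult_left_mono) auto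
      finally show ?case by (simp add: mult_ac)
    qed
  qed
  then obtain C0 where C0: "\<forall>\<^sub>F z in nhds 0. cmod (k z) \<le> C0 * cmod z ^ n" by blast
  define C where "C = max C0 0"
  have C: "C \<ge> 0" "\<forall>\<^sub>F z in nhds 0. cmod (k z) \<le> C * cmod z ^ n"
  proof -
    show "\<forall>\<^sub>F z in nhds 0. cmod (k z) \<le> C * cmod z ^ n" using C0
    proof eventually_elim
      case (elim z)
      have "C0 * cmod z ^ n \<le> C * cmod z ^ n" unfolding C_def by (intro mult_right_mono) auto
      then show ?case using elim by linarith
    qed
  qed (simp add: C_def)
  have ev_ball: "\<forall>\<^sub>F z in nhds 0. z \<in> ball (0::complex) s"
    using n(2) by (intro eventually_nhds_in_open) auto
  have limw': "(w \<longlongrightarrow> w 0) (nhds 0)"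
    using contw by (simp add: isCont_def tendsto_at_iff_tendsto_nhds)
  show ?thesis
  proof (cases "n = 1")
    case True
    have "(w has_field_derivative deriv w 0) (at 0)"
      using n(2) by (intro holomorphic_derivI[OF n(4)]) auto
    then have "((\<lambda>z. z + z * w z) has_field_derivative 1 + w 0) (at 0)"
      by (auto intro!: derivative_eq_intros)
    moreover have "\<forall>\<^sub>F z in nhds 0. z + z * w z = g z"
      using ev_ball by eventually_elim (use gz True in auto)
    ultimately have "(g has_field_derivative 1 + w 0) (at 0)"
      by (subst (asm) DERIV_cong_ev[OF refl _ refl]) auto
    then have "deriv g 0 = 1 + w 0" by (rule DERIV_imp_deriv)
    then have "Re (w 0) > -1" using D by simp
    moreover have "cmod (1 + w 0) = \<bar>1 + Re (w 0)\<bar>"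
      by (subst w0(1)) (metis norm_of_real of_real_1 of_real_add)
    ultimately have l1: "cmod (1 + w 0) < 1" using w0(2) by auto
    \<comment> \<open>The midpoint between the modulus of the multiplier and 1 leaves room for
      \<open>w z\<close> to differ from \<open>w 0\<close>.\<close>
    define q where "q = (1 + cmod (1 + w 0)) / 2"
    have q: "0 < q" "q < 1" "cmod (1 + w 0) < q"
      using l1 norm_ge_zero[of "1 + w 0"] unfolding q_def by (auto simp: field_simps simp del: norm_ge_zero)
    have "((\<lambda>z. cmod (1 + w z)) \<longlongrightarrow> cmod (1 + w 0)) (nhds 0)"
      using limw' by (intro tendsto_intros)
    then have "\<forall>\<^sub>F z in nhds 0. cmod (1 + w z) < q" by (rule order_tendstoD) fact
    then have "\<forall>\<^sub>F z in nhds 0. cmod (g z) \<le> q * cmod z" using ev_ball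
    proof eventually_elim
      case (elim z)
      have "g z = (1 + w z) * z" using gz[of z] elim True by (simp add: algebra_simps)
      then show ?case using elim by (simp add: norm_mult mult_right_mono)
    qed
    then show ?thesis
      using contracting_imp_hol_ext[OF sy q(1,2) C(1) _ _ contf] C(2) True by simp
  next
    case False
    define d where "d = n - 1"
    have d: "d > 0" "n = Suc d" using False n(1) unfolding d_def by auto
    \<comment> \<open>With \<open>v z = z ^ d * w z\<close> one has
      \<open>g z = z * (1 + v z)\<close>, and \<open>1 / g z ^ d - 1 / z ^ d\<close> tends to
      \<open>- d * w 0\<close>. The translation length \<open>a\<close> is half of that
      limit.\<close>
    define a where "a = real d * (- Re (w 0)) / 2"
    have a: "a > 0" using w0(2) d mult_pos_neg[of "real d" "Re (w 0)"] unfolding a_def by auto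
    define v where "v z = z ^ d * w z" for z
    have limv: "(v \<longlongrightarrow> 0) (at 0)"
    proof -
      have "(v \<longlongrightarrow> 0 ^ d * w 0) (at 0)"
        unfolding v_def using contw by (intro tendsto_intros) (simp add: isCont_def)
      then show ?thesis using d(1) by (simp add: power_0_left)
    qed
    have ev_at: "\<forall>\<^sub>F z in at 0. z \<in> ball (0::complex) s - {0}"
      using n(2) by (intro eventually_at_in_open) auto
    have limv': "filterlim v (at 0) (at 0)"
      unfolding filterlim_at
      using limv ev_at by (auto simp: v_def n(6) elim!: eventually_mono)
    have "((\<lambda>v::complex. 1 / (1 + v) ^ d) has_field_derivative - of_nat d) (at 0)"
      using d(1) by (auto intro!: derivative_eq_intros)
    then have "((\<lambda>v::complex. (1 / (1 + v) ^ d - 1) / v) \<longlongrightarrow> - of_nat d) (at 0)"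
      unfolding has_field_derivative_iff by simp
    then have "((\<lambda>z. (1 / (1 + v z) ^ d - 1) / v z) \<longlongrightarrow> - of_nat d) (at 0)"
      using filterlim_compose limv' by blast
    then have "((\<lambda>z. (1 / (1 + v z) ^ d - 1) / v z * w z) \<longlongrightarrow> - of_nat d * w 0) (at 0)"
      using contw by (intro tendsto_intros) (auto simp: isCont_def)
    then have "((\<lambda>z. Re ((1 / (1 + v z) ^ d - 1) / v z * w z)) \<longlongrightarrow> Re (- of_nat d * w 0)) (at 0)"
      by (rule tendsto_Re)
    moreover have "Re (- of_nat d * w 0) > a" using a unfolding a_def by (simp add: field_simps)
    ultimately have "\<forall>\<^sub>F z in at 0. Re ((1 / (1 + v z) ^ d - 1) / v z * w z) > a"
      by (rule order_tendstoD)
    moreover have "\<forall>\<^sub>F z in at 0. cmod (v z) < 1"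
      using tendsto_norm[OF limv] by (rule order_tendstoD) simp
    ultimately have "\<forall>\<^sub>F z in at 0. g z \<noteq> 0 \<and> Re (1 / g z ^ d) \<ge> Re (1 / z ^ d) + a"
      using ev_at
    proof eventually_elim
      case (elim z)
      have gv: "g z = z * (1 + v z)"
        using gz[of z] elim d(2) unfolding v_def by (simp add: algebra_simps)
      have zw: "z \<noteq> 0" "w z \<noteq> 0" using elim n(6)[of z] by auto
      have "v z \<noteq> - 1" using elim by auto
      then have ne: "z \<noteq> 0" "w z \<noteq> 0" "1 + v z \<noteq> 0" using zw by (auto simp: add_eq_0_iff)
      have "(1 / (1 + v z) ^ d - 1) / v z * w z = (1 / (1 + v z) ^ d - 1) / z ^ d"
        unfolding v_def using ne by simp
      also have "\<dots> = 1 / g z ^ d - 1 / z ^ d"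
        unfolding gv using ne by (simp add: power_mult_distrib diff_divide_distrib mult.commute)
      finally have "Re (1 / g z ^ d - 1 / z ^ d) > a" using elim by simp
      then show ?case using gv ne by simp
    qed
    then show ?thesis
      using parabolic_imp_hol_ext[OF sy d(1) C(1) a _ _ contf] C(2) d(2) by simp
  qed
qed

section \<open>Inverses, quotients and uniqueness of symmetries\<close>

lemma eq_0_of_real_line:
  assumes F: "F holomorphic_on ball 0 r" and z: "\<And>x. \<bar>x\<bar> < r \<Longrightarrow> F (of_real x) = 0"
    and w: "w \<in> ball 0 r"
  shows "F w = 0"
proof (rule analytic_continuation[OF F open_ball connected_ball _ _ _ _ w,
      where U = "of_real ` {-r<..<r}" and \<xi> = 0])
  have r: "r > 0" using w by (auto intro: le_less_trans[OF norm_ge_zero])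
  show "(0::complex) \<in> ball 0 r" using r by simp
  show "complex_of_real ` {-r<..<r} \<subseteq> ball 0 r" by auto
  show "(0::complex) islimpt of_real ` {-r<..<r}"
    unfolding islimpt_approachable
  proof (intro allI impI)
    fix e :: real assume e: "e > 0"
    define x where "x = min e r / 2"
    have "x > 0" "x < r" "x < e" using e r unfolding x_def by auto
    then show "\<exists>x'\<in>complex_of_real ` {-r<..<r}. x' \<noteq> 0 \<and> dist x' 0 < e"
      by (intro bexI[of _ "of_real x"]) auto
  qed
  show "\<And>z. z \<in> complex_of_real ` {- r<..<r} \<Longrightarrow> F z = 0" using z by auto
qed

text \<open>The complex inverse function theorem does not say that real values have real preimages,
  which is the last clause. Invariance of domain for the restriction \<open>h\<close> of
  \<open>G\<close> to the axis shows that real points near \<open>G 0\<close> are values at real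
  points; injectivity of \<open>G\<close> then identifies the preimages.\<close>

lemma holomorphic_real_local_inverse:
  assumes G: "G holomorphic_on ball 0 r" "r > 0" and D: "deriv G 0 \<noteq> 0"
    and real: "\<And>x. \<bar>x\<bar> < r \<Longrightarrow> G (of_real x) = of_real (Re (G (of_real x)))"
  obtains s e N where "0 < s" "s \<le> r" "0 < e" "N holomorphic_on ball (G 0) e"
    "N ` ball (G 0) e \<subseteq> ball 0 s" "\<And>w. w \<in> ball (G 0) e \<Longrightarrow> G (N w) = w"
    "\<And>z. z \<in> ball 0 s \<Longrightarrow> N (G z) = z" "deriv N (G 0) = 1 / deriv G 0"
    "\<And>y. of_real y \<in> ball (G 0) e \<Longrightarrow> N (of_real y) = of_real (Re (N (of_real y)))"
proof -
  obtain s where s: "s > 0" "ball 0 s \<subseteq> ball (0::complex) r" "inj_on G (ball 0 s)"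
    using has_complex_derivative_locally_injective[OF G(1) _ open_ball D] G(2) centre_in_ball by metis
  have sr: "s \<le> r" using s(1,2) G(2) by (simp add: ball_subset_ball_iff)
  have Gs: "G holomorphic_on ball 0 s" using holomorphic_on_subset[OF G(1) s(2)] .
  obtain N where N: "N holomorphic_on G ` ball 0 s"
    "\<And>z. z \<in> ball 0 s \<Longrightarrow> deriv G z * deriv N (G z) = 1" "\<And>z. z \<in> ball 0 s \<Longrightarrow> N (G z) = z"
    using holomorphic_has_inverse[OF Gs open_ball s(3)] by metis
  have "open (G ` ball 0 s)" by (rule open_mapping_thm3[OF Gs open_ball s(3)])
  moreover have "G 0 \<in> G ` ball 0 s" using s(1) by simp
  ultimately obtain e1 where e1: "e1 > 0" "ball (G 0) e1 \<subseteq> G ` ball 0 s"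
    by (rule openE)
  define h where "h x = Re (G (of_real x))" for x
  have Gh: "G (of_real x) = of_real (h x)" if "\<bar>x\<bar> < s" for x
    using real[of x] that sr unfolding h_def by simp
  have "open (h ` {-s<..<s})"
  proof (rule invariance_of_domain)
    show "continuous_on {-s<..<s} h"
      unfolding h_def
      by (intro continuous_intros continuous_on_compose2[OF holomorphic_on_imp_continuous_on[OF Gs]]) auto
    show "inj_on h {-s<..<s}"
    proof (rule inj_onI)
      fix x y assume xy: "x \<in> {-s<..<s}" "y \<in> {-s<..<s}" "h x = h y"
      then have "G (of_real x) = G (of_real y)" using Gh[of x] Gh[of y] by auto
      then have "complex_of_real x = of_real y"
        by (rule inj_onD[OF s(3)]) (use xy in auto)
      then show "x = y" by simp
    qed
  qed auto
  moreover have "h 0 \<in> h ` {-s<..<s}" using s(1) by simp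
  ultimately obtain e2 where e2: "e2 > 0" "ball (h 0) e2 \<subseteq> h ` {-s<..<s}"
    by (rule openE)
  define e where "e = min e1 e2"
  have sub: "ball (G 0) e \<subseteq> G ` ball 0 s" using e1 unfolding e_def by auto
  show ?thesis
  proof (rule that[of s e N])
    show "N holomorphic_on ball (G 0) e" by (rule holomorphic_on_subset[OF N(1) sub])
    show "N ` ball (G 0) e \<subseteq> ball 0 s"
    proof
      fix v assume "v \<in> N ` ball (G 0) e"
      then obtain w where w: "w \<in> ball (G 0) e" "v = N w" by blast
      then obtain z where "z \<in> ball 0 s" "w = G z" using sub by blast
      then show "v \<in> ball 0 s" using w(2) N(3) by simp
    qed
    show "G (N w) = w" if "w \<in> ball (G 0) e" for w
      using subsetD[OF sub that] N(3) by auto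
    show "deriv N (G 0) = 1 / deriv G 0"
      using N(2)[of 0] s(1) D by (simp add: field_simps)
    show "N (of_real y) = of_real (Re (N (of_real y)))" if "of_real y \<in> ball (G 0) e" for y
    proof -
      have "G 0 = of_real (h 0)" using Gh[of 0] s(1) by simp
      then have "y \<in> ball (h 0) e2" using that unfolding e_def by auto
      then obtain x where x: "x \<in> {-s<..<s}" "y = h x" using e2 by blast
      then have "N (of_real y) = of_real x" using Gh[of x] N(3)[of "of_real x"] by auto
      then show ?thesis by simp
    qed
  qed (use s sr e1 e2 N in \<open>auto simp: e_def\<close>)
qed

text \<open>The symmetry is \<open>G1\<close> inverse after \<open>G2\<close>. A real
  \<open>x\<close> goes to \<open>y = G2 x = G1 x'\<close>, so the two increments
  \<open>f y - f x\<close> and \<open>f y - f x'\<close> share the value \<open>f y\<close>, and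
  their difference is \<open>f x' - f x\<close>.\<close>

lemma symm_quotient:
  assumes G1: "symm f K r G1 K1" and G2: "symm f K r2 G2 K2" and "s \<le> r"
    and N: "N holomorphic_on ball c e" "N ` ball c e \<subseteq> ball 0 s" "\<And>w. w \<in> ball c e \<Longrightarrow> G1 (N w) = w"
    "\<And>y. of_real y \<in> ball c e \<Longrightarrow> N (of_real y) = of_real (Re (N (of_real y)))"
    and sub: "G2 ` ball 0 r2 \<subseteq> ball c e"
  shows "symm f K r2 (\<lambda>z. N (G2 z)) (\<lambda>z. K2 z - K1 (N (G2 z)))"
proof -
  have 1: "(\<lambda>z. N (G2 z)) holomorphic_on ball 0 r2"
    using holomorphic_on_compose_gen[OF symmD(1)[OF G2] N(1) sub] by (simp add: o_def)
  moreover have "(\<lambda>z. N (G2 z)) ` ball 0 r2 \<subseteq> ball 0 r" using N(2) sub \<open>s \<le> r\<close> by fastforce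
  then have "(\<lambda>z. K1 (N (G2 z))) holomorphic_on ball 0 r2"
    using holomorphic_on_compose_gen[OF 1 symmD(2)[OF G1]] by (simp add: o_def)
  then have 2: "(\<lambda>z. K2 z - K1 (N (G2 z))) holomorphic_on ball 0 r2"
    using symmD(2)[OF G2] by (intro holomorphic_intros)
  have 3: "x \<in> K \<and> (\<exists>y\<in>K. N (G2 (of_real x)) = of_real y \<and>
      K2 (of_real x) - K1 (N (G2 (of_real x))) = of_real (f y - f x))" if x: "\<bar>x\<bar> < r2" for x
  proof -
    define y where "y = Re (G2 (of_real x))"
    have y: "G2 (of_real x) = of_real y" "K2 (of_real x) = of_real (f y - f x)"
      using symmD(4,6)[OF G2 x] unfolding y_def by auto
    have yb: "of_real y \<in> ball c e"
      using subsetD[OF sub imageI[of "of_real x"]] x y(1) by simp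
    define x' where "x' = Re (N (of_real y))"
    have x': "N (of_real y) = of_real x'" using N(4)[OF yb] unfolding x'_def by simp
    then have "of_real x' \<in> ball (0::complex) s" using N(2) yb by (metis image_subset_iff)
    then have x'r: "\<bar>x'\<bar> < r" using \<open>s \<le> r\<close> by simp
    have "G1 (of_real x') = of_real y" using N(3)[OF yb] x' by simp
    then have "K1 (of_real x') = of_real (f y - f x')" using symmD(6)[OF G1 x'r] by simp
    then show ?thesis using symmD(3)[OF G2 x] symmD(3)[OF G1 x'r] y x' by auto
  qed
  show ?thesis unfolding symm_def using 1 2 3 by blast
qed

lemma symm_isCont:
  assumes "symm f K r g k" "r > 0"
  shows "isCont g 0" "isCont k 0"
  using holomorphic_on_imp_continuous_on[OF symmD(1)[OF assms(1)]]
    holomorphic_on_imp_continuous_on[OF symmD(2)[OF assms(1)]] assms(2)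
  by (simp_all add: continuous_on_eq_continuous_at)

text \<open>Real zeros of \<open>g - id\<close> being isolated, \<open>g\<close> or its inverse is attracting to the right of \<open>0\<close>.\<close>

lemma symm_fixing_0_eq_id:
  assumes sy: "symm f K r g k" "r > 0" and g0: "g 0 = 0" and D: "Re (deriv g 0) > 0"
    and lip: "lipschitz_at0 f" and non: "\<not> (\<exists>x\<in>K. hol_ext f x)" and z: "z \<in> ball 0 r"
  shows "g z = z"
proof (rule ccontr)
  assume neq: "g z \<noteq> z"
  define u where "u z = g z - z" for z
  have uh: "u holomorphic_on ball 0 r"
    unfolding u_def using symmD(1)[OF sy(1)] by (intro holomorphic_intros)
  obtain \<rho> where \<rho>: "0 < \<rho>" "ball (0::complex) \<rho> \<subseteq> ball 0 r" "\<And>z. z \<in> ball 0 \<rho> - {0} \<Longrightarrow> u z \<noteq> 0"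
    using isolated_zeros[OF uh open_ball connected_ball, of 0 z] sy(2) g0 z neq
    unfolding u_def by auto
  have \<rho>r: "\<rho> \<le> r" using \<rho>(1,2) sy(2) by (simp add: ball_subset_ball_iff)
  define h where "h x = Re (u (of_real x))" for x
  have hne: "h x \<noteq> 0" if "x \<in> {0<..<\<rho>}" for x
  proof -
    have "u (of_real x) = of_real (h x)"
      unfolding h_def u_def using symmD(4)[OF sy(1), of x] that \<rho>r by (simp add: complex_eq_iff)
    then show ?thesis using \<rho>(3)[of "of_real x"] that by auto
  qed
  have conth: "continuous_on {0<..<\<rho>} h"
    unfolding h_def using \<rho>r
    by (intro continuous_intros continuous_on_compose2[OF holomorphic_on_imp_continuous_on[OF uh]]) auto
  have "connected (h ` {0<..<\<rho>})" by (intro connected_continuous_image conth) auto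
  moreover have "0 \<notin> h ` {0<..<\<rho>}" using hne by auto
  ultimately have sgn: "(\<forall>x\<in>{0<..<\<rho>}. h x < 0) \<or> (\<forall>x\<in>{0<..<\<rho>}. h x > 0)"
    unfolding connected_iff_interval by (meson image_eqI linorder_not_le order_less_imp_le)
  have ev: "\<forall>\<^sub>F x in at_right 0. x \<in> {0<..<\<rho>}"
    using \<rho>(1) by (intro eventually_at_right_real)
  show False
  proof (cases "\<forall>x\<in>{0<..<\<rho>}. h x < 0")
    case True
    have "\<forall>\<^sub>F x in at_right 0. Re (g (of_real x)) < x"
      using ev by eventually_elim (use True in \<open>auto simp: h_def u_def\<close>)
    then show False using attracting_imp_hol_ext[OF sy g0 D lip] non by blast
  next
    case False
    then have pos: "x < Re (g (of_real x))" if "x \<in> {0<..<\<rho>}" for x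
      using sgn that by (auto simp: h_def u_def)
    have "deriv g 0 \<noteq> 0" using D by auto
    then obtain s e N where N: "0 < s" "s \<le> r" "0 < e" "N holomorphic_on ball (g 0) e"
      "N ` ball (g 0) e \<subseteq> ball 0 s" "\<And>w. w \<in> ball (g 0) e \<Longrightarrow> g (N w) = w"
      "\<And>z. z \<in> ball 0 s \<Longrightarrow> N (g z) = z" "deriv N (g 0) = 1 / deriv g 0"
      "\<And>y. of_real y \<in> ball (g 0) e \<Longrightarrow> N (of_real y) = of_real (Re (N (of_real y)))"
      using holomorphic_real_local_inverse[OF symmD(1)[OF sy(1)] sy(2) _ symmD(4)[OF sy(1)]] by metis
    define r2 where "r2 = min r e"
    have r2: "r2 > 0" "r2 \<le> r" "r2 \<le> e" using sy(2) N(3) unfolding r2_def by auto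
    \<comment> \<open>The identity is a symmetry; its quotient by \<open>g\<close> exhibits the
      inverse of \<open>g\<close> as a symmetry.\<close>
    have "symm f K r2 (\<lambda>z. z) (\<lambda>z. 0)"
      unfolding symm_def using symmD(3)[OF sy(1)] r2 by auto
    from symm_quotient[OF sy(1) this N(2,4,5,6,9)] subset_ball[OF r2(3)] g0
    have sN: "symm f K r2 N (\<lambda>z. 0 - k (N z))" by auto
    have N0: "N 0 = 0" using N(7)[of 0] N(1) g0 by simp
    have "Re (deriv N 0) > 0" using N(8) g0 D by (simp add: Re_divide zero_less_divide_iff sum_power2_gt_zero_iff)
    moreover have "\<forall>\<^sub>F y in at_right 0. Re (N (of_real y)) < y"
    proof -
      have "\<forall>\<^sub>F y in at_right 0. norm (N (of_real y)) < \<rho>"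
        using tendsto_norm[OF tendsto_of_real_at_right[OF symm_isCont(1)[OF sN r2(1)]]] N0 \<rho>(1)
        by (intro order_tendstoD) auto
      moreover have "\<forall>\<^sub>F y in at_right 0. y \<in> {0<..<e}"
        using N(3) by (intro eventually_at_right_real)
      ultimately show ?thesis
      proof eventually_elim
        case (elim y)
        define x where "x = Re (N (of_real y))"
        have yb: "of_real y \<in> ball (g 0) e" using elim g0 by simp
        have x: "N (of_real y) = of_real x" "g (of_real x) = of_real y"
          using N(9)[OF yb] N(6)[OF yb] unfolding x_def by auto
        have "x < y"
        proof (rule ccontr)
          assume "\<not> x < y"
          then have "x \<in> {0<..<\<rho>}" using elim x(1) by auto
          from pos[OF this] x(2) show False using \<open>\<not> x < y\<close> by simp
        qed
        then show ?case using x(1) by simp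
      qed
    qed
    ultimately show False using attracting_imp_hol_ext[OF sN r2(1) N0 _ lip] non by blast
  qed
qed

text \<open>\<open>G1\<close> inverse after \<open>G2\<close> fixes \<open>0\<close> and has
  derivative \<open>deriv G2 0 / deriv G1 0\<close> there. Positivity of this ratio is essential: an
  even \<open>f\<close> has the reflection as a second symmetry fixing \<open>0\<close>. The
  equality found near \<open>0\<close> spreads by analytic continuation, and \<open>K1\<close>,
  \<open>K2\<close> agree because on the axis they are determined by \<open>f\<close> and the common
  map.\<close>

lemma symm_unique:
  assumes s1: "symm f K r G1 K1" and s2: "symm f K r G2 K2" and r: "r > 0" and eq: "G1 0 = G2 0"
    and D: "deriv G1 0 \<noteq> 0" "Re (deriv G2 0 / deriv G1 0) > 0"
    and lip: "lipschitz_at0 f" and non: "\<not> (\<exists>x\<in>K. hol_ext f x)" and z: "z \<in> ball 0 r"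
  shows "G1 z = G2 z" "K1 z = K2 z"
proof -
  obtain s e N where N: "0 < s" "s \<le> r" "0 < e" "N holomorphic_on ball (G1 0) e"
    "N ` ball (G1 0) e \<subseteq> ball 0 s" "\<And>w. w \<in> ball (G1 0) e \<Longrightarrow> G1 (N w) = w"
    "\<And>z. z \<in> ball 0 s \<Longrightarrow> N (G1 z) = z" "deriv N (G1 0) = 1 / deriv G1 0"
    "\<And>y. of_real y \<in> ball (G1 0) e \<Longrightarrow> N (of_real y) = of_real (Re (N (of_real y)))"
    using holomorphic_real_local_inverse[OF symmD(1)[OF s1] r D(1) symmD(4)[OF s1]] by metis
  obtain d where d: "d > 0" "\<And>z. dist z 0 < d \<Longrightarrow> dist (G2 z) (G2 0) < e"
    using symm_isCont(1)[OF s2 r] N(3) unfolding continuous_at_eps_delta by blast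
  define r2 where "r2 = min r d"
  have r2: "r2 > 0" "r2 \<le> r" "r2 \<le> d" using r d(1) unfolding r2_def by auto
  have sub: "G2 ` ball 0 r2 \<subseteq> ball (G1 0) e" using d(2) r2 eq by (auto simp: dist_commute)
  have sy: "symm f K r2 (\<lambda>z. N (G2 z)) (\<lambda>z. K2 z - K1 (N (G2 z)))"
    by (rule symm_quotient[OF s1 symm_mono[OF s2 r2(2)] N(2,4,5,6,9) sub])
  have N0: "N (G2 0) = 0" using N(7)[of 0] N(1) eq by simp
  have "deriv (\<lambda>z. N (G2 z)) 0 = deriv N (G2 0) * deriv G2 0"
  proof -
    have "(G2 has_field_derivative deriv G2 0) (at 0)"
      using r by (intro holomorphic_derivI[OF symmD(1)[OF s2]]) auto
    moreover have "(N has_field_derivative deriv N (G2 0)) (at (G2 0))"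
      using N(3) eq by (intro holomorphic_derivI[OF N(4)]) auto
    ultimately show ?thesis by (intro DERIV_imp_deriv DERIV_chain2)
  qed
  also have "\<dots> = deriv G2 0 / deriv G1 0" using N(8) eq by simp
  finally have Dg: "Re (deriv (\<lambda>z. N (G2 z)) 0) > 0" using D(2) by simp
  have near: "G1 z = G2 z" if "z \<in> ball 0 r2" for z
  proof -
    have "N (G2 z) = z" using symm_fixing_0_eq_id[OF sy r2(1) N0 Dg lip non that] .
    moreover have "G1 (N (G2 z)) = G2 z" using N(6)[of "G2 z"] sub that by blast
    ultimately show ?thesis by simp
  qed
  have Geq: "G1 z = G2 z" if z: "z \<in> ball 0 r" for z
    by (rule analytic_continuation_open[OF open_ball open_ball _ connected_ball _ symmD(1)[OF s1] symmD(1)[OF s2] near z, of 0 r2])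
      (use r2 in auto)
  show "G1 z = G2 z" using Geq[OF z] .
  have h: "(\<lambda>z. K1 z - K2 z) holomorphic_on ball 0 r"
    using symmD(2)[OF s1] symmD(2)[OF s2] by (intro holomorphic_intros)
  have "K1 z - K2 z = 0"
  proof (rule eq_0_of_real_line[OF h _ z])
    fix x assume "\<bar>x\<bar> < r"
    then show "K1 (of_real x) - K2 (of_real x) = 0"
      using symmD(6)[OF s1, of x] symmD(6)[OF s2, of x] Geq[of "of_real x"] by simp
  qed
  then show "K1 z = K2 z" by simp
qed

lemma symm_Im_deriv:
  assumes "symm f K r g k" "r > 0"
  shows "Im (deriv g 0) = 0"
proof -
  have "(g has_field_derivative deriv g 0) (at (of_real 0))"
    unfolding of_real_0 using assms(2) by (intro holomorphic_derivI[OF symmD(1)[OF assms(1)]]) auto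
  then have "((\<lambda>x. - \<i> * g x) has_field_derivative - \<i> * deriv g 0) (at (of_real 0))"
    by (rule DERIV_cmult)
  from has_real_derivative_Re_of_real[OF this]
  have "((\<lambda>x. Im (g (of_real x))) has_real_derivative Im (deriv g 0)) (at 0)" by simp
  moreover have "\<forall>\<^sub>F x in nhds 0. Im (g (of_real x)) = 0"
  proof -
    have "\<forall>\<^sub>F x in nhds 0. x \<in> ball (0::real) r"
      using assms(2) by (intro eventually_nhds_in_open) auto
    then show ?thesis
      by eventually_elim (metis Im_complex_of_real assms(1) symmD(4) dist_norm diff_0 mem_ball
          norm_minus_cancel real_norm_def)
  qed
  ultimately have "((\<lambda>x::real. 0) has_real_derivative Im (deriv g 0)) (at 0)"
    by (subst (asm) DERIV_cong_ev[OF refl _ refl]) auto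
  then show ?thesis using DERIV_unique[OF _ DERIV_const] by blast
qed

lemma uniform_limit_subseq:
  assumes "uniform_limit C (F :: nat \<Rightarrow> _) g sequentially" "strict_mono \<rho>"
  shows "uniform_limit C (F \<circ> \<rho>) g sequentially"
  using filterlim_compose[OF assms(1) filterlim_subseq[OF assms(2)]] by (simp add: o_def)

section \<open>A continuous family of symmetries\<close>

definition loc_uniform_limit :: "real \<Rightarrow> (nat \<Rightarrow> complex \<Rightarrow> complex) \<Rightarrow> (complex \<Rightarrow> complex) \<Rightarrow> bool" where
  "loc_uniform_limit r F g \<longleftrightarrow>
     (\<forall>C. compact C \<longrightarrow> C \<subseteq> ball 0 r \<longrightarrow> uniform_limit C F g sequentially)"

lemma loc_uniform_limitD:
  "loc_uniform_limit r F g \<Longrightarrow> compact C \<Longrightarrow> C \<subseteq> ball 0 r \<Longrightarrow> uniform_limit C F g sequentially"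
  unfolding loc_uniform_limit_def by blast

lemma Montel_ball:
  fixes F :: "nat \<Rightarrow> complex \<Rightarrow> complex"
  assumes "\<And>n. F n holomorphic_on ball 0 r" "\<And>n z. z \<in> ball 0 r \<Longrightarrow> cmod (F n z) \<le> B"
  obtains g \<rho> where "g holomorphic_on ball 0 r" "strict_mono (\<rho> :: nat \<Rightarrow> nat)"
    "loc_uniform_limit r (F \<circ> \<rho>) g"
proof (rule Montel[of "ball 0 r" "range F" F])
  fix C :: "complex set" assume "compact C" "C \<subseteq> ball 0 r"
  then show "\<exists>B. \<forall>h\<in>range F. \<forall>z\<in>C. cmod (h z) \<le> B" using assms(2) by blast
next
  fix g \<rho> assume g: "g holomorphic_on ball 0 r" "strict_mono (\<rho> :: nat \<Rightarrow> nat)"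
    "\<And>C. compact C \<Longrightarrow> C \<subseteq> ball 0 r \<Longrightarrow> uniform_limit C (F \<circ> \<rho>) g sequentially"
  then show thesis by (intro that[of g \<rho>]) (auto simp: loc_uniform_limit_def)
qed (use assms(1) in auto)

lemma Montel_ball2:
  fixes F H :: "nat \<Rightarrow> complex \<Rightarrow> complex"
  assumes "\<And>n. F n holomorphic_on ball 0 r" "\<And>n z. z \<in> ball 0 r \<Longrightarrow> cmod (F n z) \<le> B"
    and "\<And>n. H n holomorphic_on ball 0 r" "\<And>n z. z \<in> ball 0 r \<Longrightarrow> cmod (H n z) \<le> B"
  obtains g h \<rho> where "g holomorphic_on ball 0 r" "h holomorphic_on ball 0 r" "strict_mono (\<rho> :: nat \<Rightarrow> nat)"
    "loc_uniform_limit r (F \<circ> \<rho>) g"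
    "loc_uniform_limit r (H \<circ> \<rho>) h"
proof -
  obtain g \<rho>1 where g: "g holomorphic_on ball 0 r" "strict_mono (\<rho>1 :: nat \<Rightarrow> nat)"
    "loc_uniform_limit r (F \<circ> \<rho>1) g"
    using Montel_ball[of F, OF assms(1,2)] by metis
  obtain h \<rho>2 where h: "h holomorphic_on ball 0 r" "strict_mono (\<rho>2 :: nat \<Rightarrow> nat)"
    "loc_uniform_limit r (H \<circ> \<rho>1 \<circ> \<rho>2) h"
    using Montel_ball[of "H \<circ> \<rho>1" r B] assms(3,4) unfolding o_def by metis
  show ?thesis
  proof (rule that[of g h "\<rho>1 \<circ> \<rho>2"])
    show "loc_uniform_limit r (F \<circ> (\<rho>1 \<circ> \<rho>2)) g"
      using uniform_limit_subseq[OF loc_uniform_limitD[OF g(3)] h(2)]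
      by (simp add: o_def loc_uniform_limit_def)
    show "loc_uniform_limit r (H \<circ> (\<rho>1 \<circ> \<rho>2)) h"
      using h(3) by (simp add: o_def)
  qed (use g h in \<open>auto intro: strict_mono_o\<close>)
qed

lemma uniform_limit_ball_imp_pointwise:
  fixes F :: "nat \<Rightarrow> complex \<Rightarrow> complex"
  assumes "loc_uniform_limit r (F) g" "z \<in> ball 0 r"
  shows "(\<lambda>n. F n z) \<longlonglongrightarrow> g z"
  using tendsto_uniform_limitI[OF loc_uniform_limitD[OF assms(1), of "{z}"]] assms(2) by simp

text \<open>Continuity of \<open>f\<close> and closedness of \<open>K\<close> carry the relation at
  real points to the limit. Convergence of the derivatives is recorded because it preserves lower
  bounds, hence local invertibility and orientation.\<close>

lemma symm_limit:
  fixes G H :: "nat \<Rightarrow> complex \<Rightarrow> complex"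
  assumes cont: "continuous_on K f" "closed K" and r: "r > 0"
    and sy: "\<And>n. symm f K r (G n) (H n)"
    and B: "\<And>n z. z \<in> ball 0 r \<Longrightarrow> cmod (G n z) \<le> B" "\<And>n z. z \<in> ball 0 r \<Longrightarrow> cmod (H n z) \<le> B"
  obtains g h \<rho> where "symm f K r g h" "strict_mono (\<rho> :: nat \<Rightarrow> nat)"
    "loc_uniform_limit r (G \<circ> \<rho>) g"
    "loc_uniform_limit r (H \<circ> \<rho>) h"
    "\<forall>z\<in>ball 0 r. cmod (g z) \<le> B \<and> cmod (h z) \<le> B"
    "(\<lambda>n. deriv (G (\<rho> n)) 0) \<longlonglongrightarrow> deriv g 0"
proof -
  obtain g h \<rho> where l: "g holomorphic_on ball 0 r" "h holomorphic_on ball 0 r" "strict_mono (\<rho> :: nat \<Rightarrow> nat)"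
    "loc_uniform_limit r (G \<circ> \<rho>) g"
    "loc_uniform_limit r (H \<circ> \<rho>) h"
    using Montel_ball2[of G r B H] symmD(1,2)[OF sy] B by metis
  have pg: "(\<lambda>n. G (\<rho> n) z) \<longlonglongrightarrow> g z" and ph: "(\<lambda>n. H (\<rho> n) z) \<longlonglongrightarrow> h z" if "z \<in> ball 0 r" for z
    using uniform_limit_ball_imp_pointwise[OF l(4) that] uniform_limit_ball_imp_pointwise[OF l(5) that]
    by simp_all
  have rl: "x \<in> K \<and> (\<exists>y\<in>K. g (of_real x) = of_real y \<and> h (of_real x) = of_real (f y - f x))"
    if x: "\<bar>x\<bar> < r" for x
  proof -
    have xb: "complex_of_real x \<in> ball 0 r" using x by simp
    define y where "y n = Re (G (\<rho> n) (of_real x))" for n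
    have y: "y n \<in> K" "G (\<rho> n) (of_real x) = of_real (y n)" "H (\<rho> n) (of_real x) = of_real (f (y n) - f x)" for n
      using symmD(4-6)[OF sy x, of "\<rho> n"] unfolding y_def by auto
    define y0 where "y0 = Re (g (of_real x))"
    have yl: "y \<longlonglongrightarrow> y0" unfolding y_def y0_def by (intro tendsto_Re pg xb)
    have y0: "y0 \<in> K" using closed_sequentially[OF cont(2) y(1) yl] .
    have "(\<lambda>n. f (y n)) \<longlonglongrightarrow> f y0"
      using continuous_on_tendsto_compose[OF cont(1) yl y0] y(1) by simp
    then have "(\<lambda>n. complex_of_real (f (y n) - f x)) \<longlonglongrightarrow> of_real (f y0 - f x)"
      by (intro tendsto_intros)
    then have "h (of_real x) = of_real (f y0 - f x)"
      using ph[OF xb] LIMSEQ_unique unfolding y(3) by blast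
    moreover have "g (of_real x) = of_real y0"
      using pg[OF xb] LIMSEQ_unique[OF _ tendsto_of_real[OF yl]] unfolding y(2) by blast
    ultimately show ?thesis using symmD(3)[OF sy x] y0 by auto
  qed
  have "uniform_limit (cball 0 (r/2)) (G \<circ> \<rho>) g sequentially"
    using r by (intro loc_uniform_limitD[OF l(4)]) auto
  then have "uniform_limit (ball 0 (r/2)) (G \<circ> \<rho>) g sequentially"
    by (rule uniform_limit_on_subset) auto
  then have "(\<lambda>n. (deriv ^^ 1) ((G \<circ> \<rho>) n) 0) \<longlonglongrightarrow> (deriv ^^ 1) g 0"
  proof (rule higher_deriv_complex_uniform_limit)
    show "\<forall>\<^sub>F n in sequentially. (G \<circ> \<rho>) n holomorphic_on ball 0 (r/2)"
      unfolding o_def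
      by (intro always_eventually allI holomorphic_on_subset[OF symmD(1)[OF sy]]) (use r in auto)
  qed (use r in auto)
  then have dl: "(\<lambda>n. deriv (G (\<rho> n)) 0) \<longlonglongrightarrow> deriv g 0" by simp
  show ?thesis
  proof (rule that[of g h \<rho>])
    show "symm f K r g h" unfolding symm_def using l(1,2) rl by blast
    have "cmod (g z) \<le> B" if "z \<in> ball 0 r" for z
      by (rule LIMSEQ_le_const2[OF tendsto_norm[OF pg[OF that]]]) (use B(1) that in auto)
    moreover have "cmod (h z) \<le> B" if "z \<in> ball 0 r" for z
      by (rule LIMSEQ_le_const2[OF tendsto_norm[OF ph[OF that]]]) (use B(2) that in auto)
    ultimately show "\<forall>z\<in>ball 0 r. cmod (g z) \<le> B \<and> cmod (h z) \<le> B" by blast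
  qed (use l dl in auto)
qed

text \<open>The sign \<open>\<sigma>\<close> records the orientation of \<open>g\<close>, on which uniqueness depends.\<close>

definition symm_points :: "(real \<Rightarrow> real) \<Rightarrow> real set \<Rightarrow> real \<Rightarrow> nat \<Rightarrow> real set" where
  "symm_points f K \<sigma> n = {q. \<exists>g k. symm f K (1 / Suc n) g k \<and> g 0 = of_real q \<and>
     (\<forall>z\<in>ball 0 (1 / Suc n). cmod (g z) \<le> Suc n \<and> cmod (k z) \<le> Suc n) \<and>
     \<sigma> * Re (deriv g 0) \<ge> 1 / Suc n}"

text \<open>Apart from the symmetry relation itself, the clauses are equations and weak inequalities
  with \<open>n\<close> fixed; so witnesses along a sequence have, by Montel's theorem, a limit that
  is a witness for the limit point.\<close>

lemma closed_symm_points: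
  assumes cont: "continuous_on K f" "closed K"
  shows "closed (symm_points f K \<sigma> n)"
  unfolding closed_sequential_limits
proof (intro allI impI, elim conjE)
  fix q l assume q: "\<forall>i. q i \<in> symm_points f K \<sigma> n" "q \<longlonglongrightarrow> l"
  define r where "r = 1 / real (Suc n)"
  have r: "r > 0" unfolding r_def by simp
  have "\<forall>i. \<exists>g k. symm f K r g k \<and> g 0 = of_real (q i) \<and>
     (\<forall>z\<in>ball 0 r. cmod (g z) \<le> Suc n \<and> cmod (k z) \<le> Suc n) \<and> \<sigma> * Re (deriv g 0) \<ge> 1 / Suc n"
    using q(1) unfolding symm_points_def r_def by blast
  then obtain G H where GH: "\<And>i. symm f K r (G i) (H i)" "\<And>i. G i 0 = of_real (q i)"
     "\<And>i z. z\<in>ball 0 r \<Longrightarrow> cmod (G i z) \<le> Suc n"  "\<And>i z. z\<in>ball 0 r \<Longrightarrow> cmod (H i z) \<le> Suc n"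
     "\<And>i. \<sigma> * Re (deriv (G i) 0) \<ge> 1 / Suc n"
    by metis
  obtain g h \<rho> where l: "symm f K r g h" "strict_mono (\<rho> :: nat \<Rightarrow> nat)"
    "loc_uniform_limit r (G \<circ> \<rho>) g"
    "loc_uniform_limit r (H \<circ> \<rho>) h"
    "\<forall>z\<in>ball 0 r. cmod (g z) \<le> Suc n \<and> cmod (h z) \<le> Suc n"
    "(\<lambda>n. deriv (G (\<rho> n)) 0) \<longlonglongrightarrow> deriv g 0"
    using symm_limit[where G = G and H = H, OF cont r GH(1,3,4)] by metis
  have "(\<lambda>i. G (\<rho> i) 0) \<longlonglongrightarrow> g 0"
    using uniform_limit_ball_imp_pointwise[OF l(3), of 0] r by simp
  moreover have "(\<lambda>i. q (\<rho> i)) \<longlonglongrightarrow> l"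
    using LIMSEQ_subseq_LIMSEQ[OF q(2) l(2)] by (simp add: o_def)
  then have "(\<lambda>i. complex_of_real (q (\<rho> i))) \<longlonglongrightarrow> of_real l" by (rule tendsto_of_real)
  ultimately have "g 0 = of_real l" unfolding GH(2) using LIMSEQ_unique by blast
  moreover have "\<sigma> * Re (deriv g 0) \<ge> 1 / Suc n"
    by (rule LIMSEQ_le_const[OF tendsto_mult[OF tendsto_const tendsto_Re[OF l(6)]]]) (use GH(5) in blast)
  ultimately show "l \<in> symm_points f K \<sigma> n"
    unfolding symm_points_def using l(1,5) unfolding r_def by blast
qed

text \<open>On the closed disc of half the radius \<open>g\<close> and \<open>k\<close> are bounded
  by compactness; \<open>n\<close> exceeds both bounds, \<open>2 / r\<close> and the inverse of the
  modulus of \<open>D\<close>. As \<open>g\<close> is real on the axis, \<open>deriv g 0\<close> is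
  real, so \<open>D\<close> is non-zero and its sign serves as \<open>\<sigma>\<close>.\<close>

lemma symm_points_cover:
  assumes sy: "symm f K r g k" "r > 0" and g: "g 0 = of_real q" "deriv g 0 \<noteq> 0"
  shows "\<exists>\<sigma>\<in>{1,-1}. \<exists>n. q \<in> symm_points f K \<sigma> n"
proof -
  define D where "D = Re (deriv g 0)"
  have D: "D \<noteq> 0" using g(2) symm_Im_deriv[OF sy] unfolding D_def by (simp add: complex_eq_iff)
  have cb: "cball 0 (r/2) \<subseteq> ball (0::complex) r" using sy(2) by auto
  have "bounded (g ` cball 0 (r/2))" "bounded (k ` cball 0 (r/2))"
    by (intro compact_imp_bounded compact_continuous_image holomorphic_on_imp_continuous_on
        holomorphic_on_subset[OF symmD(1)[OF sy(1)] cb] holomorphic_on_subset[OF symmD(2)[OF sy(1)] cb]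
        compact_cball)+
  then obtain B1 B2 where B: "\<And>z. z \<in> cball 0 (r/2) \<Longrightarrow> cmod (g z) \<le> B1"
    "\<And>z. z \<in> cball 0 (r/2) \<Longrightarrow> cmod (k z) \<le> B2"
    unfolding bounded_iff by blast
  obtain n :: nat where n: "n > max (max B1 B2) (max (2 / r) (1 / \<bar>D\<bar>))" using reals_Archimedean2 by blast
  have n': "B1 \<le> Suc n" "B2 \<le> Suc n" "1 / Suc n \<le> r / 2" "1 / Suc n \<le> \<bar>D\<bar>"
  proof -
    have "2 / r \<le> Suc n" "1 / \<bar>D\<bar> \<le> Suc n" using n by auto
    then show "1 / Suc n \<le> r / 2" "1 / Suc n \<le> \<bar>D\<bar>"
      using sy(2) D by (simp_all add: field_simps del: of_nat_Suc)
  qed (use n in auto)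
  have "q \<in> symm_points f K (sgn D) n"
    unfolding symm_points_def
  proof (intro CollectI exI conjI ballI)
    show "symm f K (1 / Suc n) g k" using n'(3) sy(2) by (intro symm_mono[OF sy(1)]) auto
    show "1 / Suc n \<le> sgn D * Re (deriv g 0)" using n'(4) D unfolding D_def[symmetric]
      by (simp add: sgn_if abs_if split: if_splits)
    fix z :: complex assume "z \<in> ball 0 (1 / Suc n)"
    then have "z \<in> cball 0 (r / 2)" using n'(3) by auto
    then show "cmod (g z) \<le> Suc n" "cmod (k z) \<le> Suc n" using B n'(1,2) by fastforce+
  qed (rule g(1))
  moreover have "sgn D \<in> {1,-1}" using D by (auto simp: sgn_if)
  ultimately show ?thesis by blast
qed

text \<open>Each \<open>q\<close> comes with its own radius and bounds; Baire's theorem makes them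
  uniform on an interval. It is used on complements: were all of them dense in \<open>S\<close>, so
  would be their intersection, which is empty as the closed sets cover \<open>S\<close>.\<close>

lemma symm_points_interior:
  assumes cont: "continuous_on K f" "closed K" and a: "a > 0"
    and all: "\<And>q. q \<in> {-a..a} \<Longrightarrow> \<exists>r g k. r > 0 \<and> symm f K r g k \<and> g 0 = of_real q \<and> deriv g 0 \<noteq> 0"
  shows "\<exists>\<sigma>\<in>{1,-1}. \<exists>n q e. e > 0 \<and> ball q e \<subseteq> symm_points f K \<sigma> n"
proof -
  define S where "S = {-a..a}"
  define \<G> where "\<G> = (\<lambda>(\<sigma>, n). S - symm_points f K \<sigma> n) ` ({1,-1} \<times> UNIV)"
  have "\<exists>T\<in>\<G>. \<not> S \<subseteq> closure T"
  proof (rule ccontr)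
    assume neg: "\<not> ?thesis"
    have "S \<subseteq> closure (\<Inter>\<G>)"
    proof (rule Baire)
      show "closed S" unfolding S_def by simp
      show "countable \<G>" unfolding \<G>_def by (intro countable_image countable_SIGMA) auto
      fix T assume T: "T \<in> \<G>"
      then obtain \<sigma> n where "T = S - symm_points f K \<sigma> n" unfolding \<G>_def by auto
      then have "openin (top_of_set S) T"
        using closed_symm_points[OF cont, of \<sigma> n]
        by (metis Diff_eq open_Compl openin_open_Int)
      then show "openin (top_of_set S) T \<and> S \<subseteq> closure T" using neg T by blast
    qed
    moreover have "\<Inter>\<G> = {}"
    proof -
      have "q \<notin> \<Inter>\<G>" for q
      proof
        assume q: "q \<in> \<Inter>\<G>"
        have mem: "S - symm_points f K \<sigma> n \<in> \<G>" if "\<sigma> \<in> {1,-1}" for \<sigma> n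
          using that unfolding \<G>_def by auto
        have "q \<in> S" using q mem[of 1 0] by auto
        then have "q \<in> {-a..a}" unfolding S_def .
        from all[OF this] obtain r g k where
          rgk: "symm f K r g k" "r > 0" "g 0 = of_real q" "deriv g 0 \<noteq> 0" by metis
        obtain \<sigma> n where sn: "\<sigma> \<in> {1,-1}" "q \<in> symm_points f K \<sigma> n"
          using symm_points_cover[OF rgk] by blast
        show False using InterD[OF q mem[OF sn(1), of n]] sn(2) by simp
      qed
      then show ?thesis by blast
    qed
    ultimately have "S \<subseteq> {}" by simp
    then show False using a unfolding S_def by auto
  qed
  then obtain \<sigma> n x where x: "\<sigma> \<in> {1,-1::real}" "x \<in> S" "x \<notin> closure (S - symm_points f K \<sigma> n)"
    unfolding \<G>_def by auto
  obtain d where d: "d > 0" "\<And>y. y \<in> S \<Longrightarrow> dist y x < d \<Longrightarrow> y \<in> symm_points f K \<sigma> n"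
    using x(3) unfolding closure_approachable by (meson DiffI)
  \<comment> \<open>The point \<open>x\<close> given by Baire's theorem may be an end of
    \<open>S\<close>; a nearby \<open>q\<close> in the open interval replaces it.\<close>
  have "x \<in> closure {-a<..<a}" using x(2) a unfolding S_def by simp
  then obtain q where q: "q \<in> {-a<..<a}" "dist q x < d" using d(1) unfolding closure_approachable by blast
  have "open ({-a<..<a} \<inter> ball x d)" by auto
  moreover have "q \<in> {-a<..<a} \<inter> ball x d" using q by (auto simp: dist_commute)
  ultimately obtain e where e: "e > 0" "ball q e \<subseteq> {-a<..<a} \<inter> ball x d" by (rule openE)
  have "ball q e \<subseteq> symm_points f K \<sigma> n"
  proof
    fix y assume "y \<in> ball q e"
    then have "y \<in> {-a<..<a} \<inter> ball x d" using e by blast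
    then show "y \<in> symm_points f K \<sigma> n" by (intro d(2)) (auto simp: S_def dist_commute)
  qed
  then show ?thesis using x(1) e(1) by blast
qed

text \<open>
  The family is \<open>N \<circ> \<Phi>\<^sub>q\<close>, where \<open>\<Phi>\<^sub>q\<close> maps \<open>0\<close> to \<open>q\<close> and \<open>N\<close> inverts \<open>\<Phi>\<^sub>q\<close> for one interior point \<open>q = q0\<close>;
  uniqueness turns the compactness of the set of all \<open>\<Phi>\<^sub>q\<close> into continuity in \<open>q\<close>.
\<close>

lemma near_identity_symms:
  assumes cont: "continuous_on K f" "closed K" and a: "a > 0"
    and all: "\<And>q. q \<in> {-a..a} \<Longrightarrow> \<exists>r g k. r > 0 \<and> symm f K r g k \<and> g 0 = of_real q \<and> deriv g 0 \<noteq> 0"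
    and lip: "lipschitz_at0 f" and non: "\<not> (\<exists>x\<in>K. hol_ext f x)"
  shows "\<exists>r>0. \<forall>\<delta>>0. \<exists>\<eta>>0. \<forall>t. \<bar>t\<bar> < \<eta> \<longrightarrow> (\<exists>g k. symm f K r g k \<and> g 0 = of_real t \<and>
           (\<forall>z\<in>ball 0 r. cmod (g z - z) \<le> \<delta> \<and> cmod (k z) \<le> \<delta>))"
proof -
  obtain \<sigma> n q0 e0 where E: "\<sigma> \<in> {1,-1::real}" "e0 > 0" "ball q0 e0 \<subseteq> symm_points f K \<sigma> n"
    using symm_points_interior[OF cont a all] by blast
  define r0 where "r0 = 1 / real (Suc n)"
  have r0: "r0 > 0" unfolding r0_def by simp
  have pts: "\<exists>g k. symm f K r0 g k \<and> g 0 = of_real q \<and>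
     (\<forall>z\<in>ball 0 r0. cmod (g z) \<le> Suc n \<and> cmod (k z) \<le> Suc n) \<and> \<sigma> * Re (deriv g 0) \<ge> r0"
    if "q \<in> ball q0 e0" for q
    using subsetD[OF E(3) that] unfolding symm_points_def r0_def by blast
  have "q0 \<in> ball q0 e0" using E(2) by simp
  from pts[OF this] obtain \<Phi>0 H0 where \<Phi>0: "symm f K r0 \<Phi>0 H0" "\<Phi>0 0 = of_real q0"
    "\<sigma> * Re (deriv \<Phi>0 0) \<ge> r0" by blast
  have D0: "deriv \<Phi>0 0 \<noteq> 0" using \<Phi>0(3) r0 by auto
  obtain s e N where N: "0 < s" "s \<le> r0" "0 < e" "N holomorphic_on ball (\<Phi>0 0) e"
    "N ` ball (\<Phi>0 0) e \<subseteq> ball 0 s" "\<And>w. w \<in> ball (\<Phi>0 0) e \<Longrightarrow> \<Phi>0 (N w) = w"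
    "\<And>z. z \<in> ball 0 s \<Longrightarrow> N (\<Phi>0 z) = z" "deriv N (\<Phi>0 0) = 1 / deriv \<Phi>0 0"
    "\<And>y. of_real y \<in> ball (\<Phi>0 0) e \<Longrightarrow> N (of_real y) = of_real (Re (N (of_real y)))"
    using holomorphic_real_local_inverse[OF symmD(1)[OF \<Phi>0(1)] r0 D0 symmD(4)[OF \<Phi>0(1)]] by metis
  \<comment> \<open>The bound \<open>e / 4\<close> leaves another \<open>e / 4\<close> for the error
    of an approximating map, so that its values stay in the closed disc of radius
    \<open>e / 2\<close>, where \<open>N\<close> is uniformly continuous. The bound
    \<open>e0\<close> keeps \<open>\<Phi>0 t\<close> among the points \<open>q\<close> at which a
    symmetry is available.\<close>
  obtain d0 where d0: "d0 > 0" "\<And>z. dist z 0 < d0 \<Longrightarrow> dist (\<Phi>0 z) (\<Phi>0 0) < min (e/4) e0"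
    using symm_isCont(1)[OF \<Phi>0(1) r0] N(3) E(2) unfolding continuous_at_eps_delta
    by (metis half_gt_zero min_less_iff_conj zero_less_divide_iff zero_less_numeral)
  define r where "r = min (s / 2) (d0 / 2)"
  have r: "r > 0" "r < s" "r < d0" "r \<le> s / 2" using N(1) d0(1) unfolding r_def by auto
  have rr0: "r < r0" using r N(2) by linarith
  have "\<exists>\<eta>>0. \<forall>t. \<bar>t\<bar> < \<eta> \<longrightarrow> (\<exists>g k. symm f K r g k \<and> g 0 = of_real t \<and>
           (\<forall>z\<in>ball 0 r. cmod (g z - z) \<le> \<delta> \<and> cmod (k z) \<le> \<delta>))" if \<delta>: "\<delta> > 0" for \<delta>
  proof (rule ccontr)
    assume neg: "\<not> ?thesis"
    define Q where "Q t \<longleftrightarrow> (\<exists>g k. symm f K r g k \<and> g 0 = of_real t \<and>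
           (\<forall>z\<in>ball 0 r. cmod (g z - z) \<le> \<delta> \<and> cmod (k z) \<le> \<delta>))" for t
    have "\<exists>t. \<bar>t\<bar> < r / Suc i \<and> \<not> Q t" for i
      using neg r(1) unfolding Q_def by (metis divide_pos_pos of_nat_0_less_iff zero_less_Suc)
    then obtain t where t: "\<And>i. \<bar>t i\<bar> < r / Suc i" "\<And>i. \<not> Q (t i)" by metis
    have tr: "\<bar>t i\<bar> < r" for i
    proof -
      have "r / Suc i \<le> r / 1" using r(1) by (intro divide_left_mono) auto
      then show ?thesis using t(1)[of i] by simp
    qed
    have "(\<lambda>i. r / Suc i) \<longlonglongrightarrow> 0" by (rule LIMSEQ_Suc[OF lim_const_over_n])
    then have t0: "t \<longlonglongrightarrow> 0"
      by (rule Lim_null_comparison[OF always_eventually, rotated]) (use t(1) in \<open>auto intro: less_imp_le\<close>)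
    \<comment> \<open>With this target \<open>N (G i 0) = N (\<Phi>0 (t i)) = t i\<close>, the value
      at \<open>0\<close> that is required.\<close>
    define q where "q i = Re (\<Phi>0 (of_real (t i)))" for i
    have q: "\<Phi>0 (of_real (t i)) = of_real (q i)" for i
      using symmD(4)[OF \<Phi>0(1), of "t i"] tr[of i] rr0 unfolding q_def by simp
    have qb: "q i \<in> ball q0 e0" for i
    proof -
      have "dist (complex_of_real (q i)) (of_real q0) < e0"
        using d0(2)[of "of_real (t i)"] tr[of i] r(3) unfolding q \<Phi>0(2) by (simp add: dist_commute)
      then show ?thesis by (simp add: dist_commute)
    qed
    have "\<forall>i. \<exists>g k. symm f K r0 g k \<and> g 0 = of_real (q i) \<and>
       (\<forall>z\<in>ball 0 r0. cmod (g z) \<le> Suc n \<and> cmod (k z) \<le> Suc n) \<and> \<sigma> * Re (deriv g 0) \<ge> r0"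
      using pts[OF qb] by blast
    then obtain G H where GH: "\<And>i. symm f K r0 (G i) (H i)" "\<And>i. G i 0 = of_real (q i)"
      "\<And>i z. z\<in>ball 0 r0 \<Longrightarrow> cmod (G i z) \<le> Suc n"  "\<And>i z. z\<in>ball 0 r0 \<Longrightarrow> cmod (H i z) \<le> Suc n"
      "\<And>i. \<sigma> * Re (deriv (G i) 0) \<ge> r0"
      by metis
    obtain g h \<rho> where l: "symm f K r0 g h" "strict_mono (\<rho> :: nat \<Rightarrow> nat)"
      "loc_uniform_limit r0 (G \<circ> \<rho>) g" "loc_uniform_limit r0 (H \<circ> \<rho>) h"
      "(\<lambda>n. deriv (G (\<rho> n)) 0) \<longlonglongrightarrow> deriv g 0"
      using symm_limit[where G = G and H = H, OF cont r0 GH(1,3,4)] by metis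
    have g0: "g 0 = \<Phi>0 0"
    proof -
      have "(\<lambda>i. G (\<rho> i) 0) \<longlonglongrightarrow> g 0"
        using uniform_limit_ball_imp_pointwise[OF l(3), of 0] r0 by simp
      moreover have "(\<lambda>i. \<Phi>0 (of_real (t (\<rho> i)))) \<longlonglongrightarrow> \<Phi>0 0"
      proof (rule isCont_tendsto_compose[OF symm_isCont(1)[OF \<Phi>0(1) r0]])
        have "(\<lambda>i. complex_of_real (t (\<rho> i))) \<longlonglongrightarrow> of_real 0"
          using LIMSEQ_subseq_LIMSEQ[OF t0 l(2)] by (intro tendsto_of_real) (simp add: o_def)
        then show "(\<lambda>i. complex_of_real (t (\<rho> i))) \<longlonglongrightarrow> 0" by simp
      qed
      ultimately show ?thesis unfolding GH(2) q by (rule LIMSEQ_unique)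
    qed
    have "\<sigma> * Re (deriv g 0) \<ge> r0"
      by (rule LIMSEQ_le_const[OF tendsto_mult[OF tendsto_const tendsto_Re[OF l(5)]]]) (use GH(5) in blast)
    then have "Re (deriv g 0) * Re (deriv \<Phi>0 0) > 0"
      using \<Phi>0(3) r0 E(1) by (auto intro: mult_pos_pos mult_neg_neg)
    moreover have "deriv g 0 / deriv \<Phi>0 0 = of_real (Re (deriv g 0) / Re (deriv \<Phi>0 0))"
      using symm_Im_deriv[OF \<Phi>0(1) r0] symm_Im_deriv[OF l(1) r0]
      by (metis complex_is_Real_iff of_real_Re of_real_divide)
    ultimately have Dpos: "Re (deriv g 0 / deriv \<Phi>0 0) > 0"
      by (simp add: zero_less_divide_iff zero_less_mult_iff)
    \<comment> \<open>The limit has the same value at \<open>0\<close> as \<open>\<Phi>0\<close>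
      and, \<open>\<sigma>\<close> being fixed, the same orientation, so it is
      \<open>\<Phi>0\<close>. Thus the maps \<open>G (\<rho> i)\<close> approach
      \<open>\<Phi>0\<close> although they were chosen independently.\<close>
    have eq: "\<Phi>0 z = g z" "H0 z = h z" if "z \<in> ball 0 r0" for z
      using symm_unique[OF \<Phi>0(1) l(1) r0 g0[symmetric] D0 Dpos lip non that] by auto
    have cb34: "cball 0 (3 * r0 / 4) \<subseteq> ball (0::complex) r0" using r0 by auto
    have "uniformly_continuous_on (cball 0 (3 * r0 / 4)) H0"
      by (intro compact_uniformly_continuous holomorphic_on_imp_continuous_on
          holomorphic_on_subset[OF symmD(2)[OF \<Phi>0(1)] cb34] compact_cball)
    then obtain d2 where d2: "d2 > 0"
      "\<And>x y. x \<in> cball 0 (3*r0/4) \<Longrightarrow> y \<in> cball 0 (3*r0/4) \<Longrightarrow> dist x y < d2 \<Longrightarrow> dist (H0 x) (H0 y) < \<delta> / 2"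
      using half_gt_zero[OF \<delta>] unfolding uniformly_continuous_on_def by metis
    \<comment> \<open>This is the tolerance for \<open>N (F z)\<close> against \<open>z\<close>:
      \<open>d2\<close> serves the continuity of \<open>H0\<close>, and \<open>r0 / 4\<close> keeps
      \<open>N (F z)\<close> in the disc of radius \<open>3 * r0 / 4\<close>, since
      \<open>cmod z\<close> is at most \<open>r0 / 2\<close>.\<close>
    define d3 where "d3 = min (min d2 \<delta>) (r0 / 4)"
    have d3: "d3 > 0" "d3 \<le> d2" "d3 \<le> \<delta>" "d3 \<le> r0 / 4" using d2 \<delta> r0 unfolding d3_def by auto
    have cbe: "cball (\<Phi>0 0) (e/2) \<subseteq> ball (\<Phi>0 0) e" using N(3) by auto
    have "uniformly_continuous_on (cball (\<Phi>0 0) (e/2)) N"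
      by (intro compact_uniformly_continuous holomorphic_on_imp_continuous_on
          holomorphic_on_subset[OF N(4) cbe] compact_cball)
    then obtain d1 where d1: "d1 > 0"
      "\<And>x y. x \<in> cball (\<Phi>0 0) (e/2) \<Longrightarrow> y \<in> cball (\<Phi>0 0) (e/2) \<Longrightarrow> dist x y < d1 \<Longrightarrow> dist (N x) (N y) < d3"
      using d3(1) unfolding uniformly_continuous_on_def by metis
    have cr: "cball 0 r \<subseteq> ball (0::complex) r0" using rr0 by auto
    have "\<forall>\<^sub>F i in sequentially. \<forall>z\<in>cball 0 r. dist ((G \<circ> \<rho>) i z) (g z) < min d1 (e/4)"
      by (rule uniform_limitD[OF loc_uniform_limitD[OF l(3) compact_cball cr]]) (use d1(1) N(3) in auto)
    moreover have "\<forall>\<^sub>F i in sequentially. \<forall>z\<in>cball 0 r. dist ((H \<circ> \<rho>) i z) (h z) < \<delta> / 2"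
      by (rule uniform_limitD[OF loc_uniform_limitD[OF l(4) compact_cball cr]]) (use \<delta> in auto)
    ultimately have "\<forall>\<^sub>F i in sequentially. (\<forall>z\<in>cball 0 r. dist ((G \<circ> \<rho>) i z) (g z) < min d1 (e/4)) \<and>
        (\<forall>z\<in>cball 0 r. dist ((H \<circ> \<rho>) i z) (h z) < \<delta> / 2)"
      by (rule eventually_conj)
    then obtain i where i: "\<And>z. z \<in> cball 0 r \<Longrightarrow> dist (G (\<rho> i) z) (g z) < min d1 (e/4)"
      "\<And>z. z \<in> cball 0 r \<Longrightarrow> dist (H (\<rho> i) z) (h z) < \<delta> / 2"
      unfolding eventually_sequentially by fastforce
    define F where "F = G (\<rho> i)"
    have F_near: "dist (F z) (\<Phi>0 z) < d1" "dist (F z) (\<Phi>0 z) < e / 4" if "z \<in> cball 0 r" for z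
    proof -
      have "z \<in> ball 0 r0" using that cr by blast
      then show "dist (F z) (\<Phi>0 z) < d1" "dist (F z) (\<Phi>0 z) < e / 4"
        using i(1)[OF that] eq(1)[of z] unfolding F_def by auto
    qed
    have \<Phi>0_near: "dist (\<Phi>0 z) (\<Phi>0 0) < e / 4" if "z \<in> cball 0 r" for z
      using d0(2)[of z] that r(3) by (simp add: dist_commute)
    have F_in: "F z \<in> cball (\<Phi>0 0) (e/2)" "\<Phi>0 z \<in> cball (\<Phi>0 0) (e/2)" if "z \<in> cball 0 r" for z
    proof -
      have "dist (F z) (\<Phi>0 0) \<le> dist (F z) (\<Phi>0 z) + dist (\<Phi>0 z) (\<Phi>0 0)" by (rule dist_triangle)
      then have "dist (F z) (\<Phi>0 0) \<le> e / 2" "dist (\<Phi>0 z) (\<Phi>0 0) \<le> e / 2"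
        using F_near(2)[OF that] \<Phi>0_near[OF that] N(3) by linarith+
      then show "F z \<in> cball (\<Phi>0 0) (e/2)" "\<Phi>0 z \<in> cball (\<Phi>0 0) (e/2)" by (auto simp: dist_commute)
    qed
    have sF: "symm f K r F (H (\<rho> i))"
      unfolding F_def using symm_mono[OF GH(1)] rr0 by auto
    have Fsub: "F ` ball 0 r \<subseteq> ball (\<Phi>0 0) e"
    proof
      fix w assume "w \<in> F ` ball 0 r"
      then obtain z where "z \<in> ball 0 r" "w = F z" by blast
      then have "z \<in> cball 0 r" "w = F z" by auto
      then show "w \<in> ball (\<Phi>0 0) e" using F_in(1) cbe by blast
    qed
    have sy: "symm f K r (\<lambda>z. N (F z)) (\<lambda>z. H (\<rho> i) z - H0 (N (F z)))"
      by (rule symm_quotient[OF \<Phi>0(1) sF N(2,4,5,6,9) Fsub])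
    have "F 0 = \<Phi>0 (of_real (t (\<rho> i)))" unfolding F_def GH(2) q ..
    then have "N (F 0) = of_real (t (\<rho> i))" using N(7)[of "of_real (t (\<rho> i))"] tr[of "\<rho> i"] r(2) by simp
    moreover have "cmod (N (F z) - z) \<le> \<delta> \<and> cmod (H (\<rho> i) z - H0 (N (F z))) \<le> \<delta>" if z: "z \<in> ball 0 r" for z
    proof -
      have zc: "z \<in> cball 0 r" using z by simp
      have "N (\<Phi>0 z) = z" using N(7)[of z] z r(2) by simp
      then have 1: "dist (N (F z)) z < d3"
        using d1(2)[OF F_in[OF zc] F_near(1)[OF zc]] by simp
      have zr: "cmod z \<le> r0 / 2" using z r(4) N(2) by simp
      have "cmod (N (F z)) \<le> dist (N (F z)) z + cmod z"
        by (metis dist_0_norm dist_commute dist_triangle)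
      then have "N (F z) \<in> cball 0 (3*r0/4)" "z \<in> cball 0 (3*r0/4)"
        using 1 d3(4) zr r0 by auto
      then have "dist (H0 (N (F z))) (H0 z) < \<delta> / 2" using 1 d3(2) by (intro d2(2)) auto
      moreover have "dist (H (\<rho> i) z) (H0 z) < \<delta> / 2" using i(2)[OF zc] eq(2)[of z] zc cr by auto
      ultimately have "dist (H (\<rho> i) z) (H0 (N (F z))) < \<delta>"
        by (metis dist_commute dist_triangle_half_r)
      then show ?thesis using 1 d3(3) by (simp add: dist_norm)
    qed
    ultimately have "Q (t (\<rho> i))" unfolding Q_def using sy by blast
    then show False using t(2) by blast
  qed
  then show ?thesis using r(1) by blast
qed

section \<open>Displacement linear in the parameter\<close>

text \<open>Points of the disc of radius \<open>3 * r / 4\<close> have distance more than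
  \<open>r / 4\<close> from the boundary, so a closed disc of radius \<open>r / 8\<close> about them
  fits.\<close>

lemma Cauchy_deriv_bound:
  assumes u: "u holomorphic_on ball 0 r" "r > 0" and B: "\<And>z. z \<in> ball 0 r \<Longrightarrow> cmod (u z) \<le> B"
    and z: "z \<in> ball 0 (3 * r / 4)"
  shows "cmod (deriv u z) \<le> 8 * B / r"
proof -
  have sub: "cball z (r / 8) \<subseteq> ball 0 r"
  proof
    fix w assume "w \<in> cball z (r / 8)"
    moreover have "cmod w \<le> dist w z + cmod z" by (metis dist_0_norm dist_commute dist_triangle)
    ultimately show "w \<in> ball 0 r" using z u(2) by (simp add: dist_commute)
  qed
  have "cmod ((deriv ^^ 1) u z) \<le> fact 1 * B / (r / 8) ^ 1"
  proof (rule Cauchy_inequality)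
    show "u holomorphic_on ball z (r / 8)"
      by (rule holomorphic_on_subset[OF u(1)]) (use sub in auto)
    show "continuous_on (cball z (r / 8)) u"
      by (rule holomorphic_on_imp_continuous_on[OF holomorphic_on_subset[OF u(1) sub]])
    show "cmod (u x) \<le> B" if "cmod (z - x) = r / 8" for x
      by (rule B, rule subsetD[OF sub]) (use that in \<open>simp add: dist_norm\<close>)
  qed (use u(2) in auto)
  then show "cmod (deriv u z) \<le> 8 * B / r" by (simp add: mult.commute)
qed

lemma Cauchy_Lipschitz_bound:
  assumes u: "u holomorphic_on ball 0 r" "r > 0" and B: "\<And>z. z \<in> ball 0 r \<Longrightarrow> cmod (u z) \<le> B"
    and ab: "a \<in> ball 0 (3 * r / 4)" "b \<in> ball 0 (3 * r / 4)"
  shows "cmod (u a - u b) \<le> 8 * B / r * cmod (a - b)"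
proof (rule field_differentiable_bound[OF convex_ball _ _ ab])
  fix z assume z: "z \<in> ball (0::complex) (3 * r / 4)"
  show "(u has_field_derivative deriv u z) (at z within ball 0 (3 * r / 4))"
    using z u(2) by (intro has_field_derivative_at_within[OF holomorphic_derivI[OF u(1)]]) auto
  show "cmod (deriv u z) \<le> 8 * B / r" using Cauchy_deriv_bound[OF u B z] .
qed

text \<open>Closeness to the identity on a disc fixes the orientation at its centre, which is what
  \<open>symm_unique\<close> asks for.\<close>

lemma near_id_deriv_pos:
  assumes g: "g holomorphic_on ball 0 r" "r > 0" and B: "\<And>z. z \<in> ball 0 r \<Longrightarrow> cmod (g z - z) \<le> B"
    and "8 * B / r < 1"
  shows "Re (deriv g 0) > 0"
proof -
  define u where "u z = g z - z" for z
  have uh: "u holomorphic_on ball 0 r" unfolding u_def using g(1) by (intro holomorphic_intros)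
  have "cmod (deriv u 0) \<le> 8 * B / r"
    by (rule Cauchy_deriv_bound[OF uh g(2)]) (use B g(2) in \<open>auto simp: u_def\<close>)
  then have "cmod (deriv u 0) < 1" using assms(4) by simp
  moreover have "deriv u 0 = deriv g 0 - 1"
  proof -
    have "(g has_field_derivative deriv g 0) (at 0)"
      using g(2) by (intro holomorphic_derivI[OF g(1)]) auto
    then have "(u has_field_derivative deriv g 0 - 1) (at 0)"
      unfolding u_def by (auto intro!: derivative_eq_intros)
    then show ?thesis by (rule DERIV_imp_deriv)
  qed
  ultimately have "\<bar>Re (deriv g 0) - 1\<bar> < 1"
    using abs_Re_le_cmod[of "deriv g 0 - 1"] by simp
  then show ?thesis by simp
qed

lemma symm_comp:
  assumes 1: "symm f K r1 g1 k1" and 2: "symm f K r2 g2 k2" and sub: "g2 ` ball 0 r2 \<subseteq> ball 0 r1"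
  shows "symm f K r2 (\<lambda>z. g1 (g2 z)) (\<lambda>z. k2 z + k1 (g2 z))"
proof -
  have "(\<lambda>z. g1 (g2 z)) holomorphic_on ball 0 r2" "(\<lambda>z. k1 (g2 z)) holomorphic_on ball 0 r2"
    using holomorphic_on_compose_gen[OF symmD(1)[OF 2] symmD(1)[OF 1] sub]
      holomorphic_on_compose_gen[OF symmD(1)[OF 2] symmD(2)[OF 1] sub] by (simp_all add: o_def)
  moreover from this have "(\<lambda>z. k2 z + k1 (g2 z)) holomorphic_on ball 0 r2"
    using symmD(2)[OF 2] by (intro holomorphic_intros)
  moreover have "x \<in> K \<and> (\<exists>y\<in>K. g1 (g2 (of_real x)) = of_real y \<and>
      k2 (of_real x) + k1 (g2 (of_real x)) = of_real (f y - f x))" if x: "\<bar>x\<bar> < r2" for x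
  proof -
    define y where "y = Re (g2 (of_real x))"
    have y: "g2 (of_real x) = of_real y" "k2 (of_real x) = of_real (f y - f x)"
      using symmD(4,6)[OF 2 x] unfolding y_def by auto
    have "g2 (of_real x) \<in> ball 0 r1" using x by (intro subsetD[OF sub imageI]) simp
    then have yr: "\<bar>y\<bar> < r1" using y(1) by simp
    show ?thesis
      using symmD(3)[OF 2 x] symmD(4,5,6)[OF 1 yr] y
      by (intro conjI bexI[of _ "Re (g1 (of_real y))"]) auto
  qed
  ultimately show ?thesis unfolding symm_def by blast
qed

text \<open>
  With \<open>G\<^sub>j\<close> the iterates of \<open>g\<close> and \<open>A\<close> the mean of the first \<open>m\<close> of them, \<open>A \<circ> g - A = (G\<^sub>m - G\<^sub>0)/m\<close>.
  Since \<open>A\<close> is close to the identity, this bounds \<open>g - id\<close> by a multiple of \<open>1/m\<close>, and \<open>m\<close> can be taken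
  proportional to \<open>1/t\<close>. The bound for \<open>k\<close> comes from the mean \<open>b\<close> of the corresponding \<open>k\<^sub>j\<close>.
\<close>

lemma linear_symms:
  assumes lip: "lipschitz_at0 f" and non: "\<not> (\<exists>x\<in>K. hol_ext f x)" and r: "r > 0"
    and near: "\<And>\<delta>. \<delta> > 0 \<Longrightarrow> \<exists>\<eta>>0. \<forall>t. \<bar>t\<bar> < \<eta> \<longrightarrow> (\<exists>g k. symm f K r g k \<and> g 0 = of_real t \<and>
           (\<forall>z\<in>ball 0 r. cmod (g z - z) \<le> \<delta> \<and> cmod (k z) \<le> \<delta>))"
  shows "\<exists>C>0. \<exists>\<eta>>0. \<forall>t. 0 < t \<longrightarrow> t < \<eta> \<longrightarrow> (\<exists>g k. symm f K (r/2) g k \<and> g 0 = of_real t \<and>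
           (\<forall>z\<in>ball 0 (r/2). cmod (g z - z) \<le> C * t \<and> cmod (k z) \<le> C * t))"
proof -
  \<comment> \<open>Small enough for three purposes: maps send the disc of radius
    \<open>r / 2\<close> into that of radius \<open>3 * r / 4\<close>, composites of two still have
    positive derivative at \<open>0\<close>, and the Lipschitz constant
    \<open>8 * \<delta> / r\<close> is \<open>1 / 8\<close>.\<close>
  define \<delta> where "\<delta> = r / 64"
  have \<delta>: "\<delta> > 0" using r unfolding \<delta>_def by simp
  obtain \<eta>0 where \<eta>0: "\<eta>0 > 0" "\<forall>t. \<bar>t\<bar> < \<eta>0 \<longrightarrow> (\<exists>g k. symm f K r g k \<and> g 0 = of_real t \<and>
           (\<forall>z\<in>ball 0 r. cmod (g z - z) \<le> \<delta> \<and> cmod (k z) \<le> \<delta>))"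
    using near[OF \<delta>] by blast
  then obtain gg kk where gk: "\<And>t. \<bar>t\<bar> < \<eta>0 \<Longrightarrow> symm f K r (gg t) (kk t)"
    "\<And>t. \<bar>t\<bar> < \<eta>0 \<Longrightarrow> gg t 0 = of_real t"
    "\<And>t z. \<bar>t\<bar> < \<eta>0 \<Longrightarrow> z \<in> ball 0 r \<Longrightarrow> cmod (gg t z - z) \<le> \<delta>"
    "\<And>t z. \<bar>t\<bar> < \<eta>0 \<Longrightarrow> z \<in> ball 0 r \<Longrightarrow> cmod (kk t z) \<le> \<delta>"
    by metis
  have gmap: "gg t z \<in> ball 0 (3 * r / 4)" if "\<bar>t\<bar> < \<eta>0" "z \<in> ball 0 (r / 2)" for t z
  proof -
    have "cmod (gg t z) \<le> cmod (gg t z - z) + cmod z" using norm_triangle_ineq[of "gg t z - z" z] by simp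
    then show ?thesis using gk(3)[OF that(1), of z] that(2) r unfolding \<delta>_def by simp
  qed
  have half: "z \<in> ball 0 r" "z \<in> ball 0 (3 * r / 4)" if "z \<in> ball (0::complex) (r / 2)" for z
    using that r by auto
  have q34: "z \<in> ball 0 r" if "z \<in> ball (0::complex) (3 * r / 4)" for z
    using that r by auto
  \<comment> \<open>The composite and \<open>gg t'\<close> agree at \<open>0\<close> and both
    preserve orientation, so uniqueness identifies them together with their additive parts. Hence
    iterates never need domains smaller than the disc of radius \<open>r / 2\<close>.\<close>
  have step: "gg \<tau> (gg t z) = gg t' z \<and> kk t' z = kk t z + kk \<tau> (gg t z)"
    if t: "\<bar>t\<bar> < \<eta>0" "\<bar>\<tau>\<bar> < \<eta>0" "\<bar>t'\<bar> < \<eta>0" "\<bar>t\<bar> < r" "t' = Re (gg \<tau> (of_real t))"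
      and z: "z \<in> ball 0 (r / 2)" for t \<tau> t' z
  proof -
    define G where "G z = gg \<tau> (gg t z)" for z
    define H where "H z = kk t z + kk \<tau> (gg t z)" for z
    have s1: "symm f K (r / 2) G H"
      unfolding G_def H_def
    proof (rule symm_comp[OF gk(1)[OF t(2)]])
      show "symm f K (r / 2) (gg t) (kk t)" using symm_mono[OF gk(1)[OF t(1)]] r by simp
      show "gg t ` ball 0 (r / 2) \<subseteq> ball 0 r" using gmap[OF t(1)] q34 by blast
    qed
    have s2: "symm f K (r / 2) (gg t') (kk t')" using symm_mono[OF gk(1)[OF t(3)]] r by simp
    have r2: "r / 2 > 0" using r by simp
    have "G 0 = of_real t'" unfolding G_def gk(2)[OF t(1)] t(5) using symmD(4)[OF gk(1)[OF t(2)] t(4)] .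
    then have eq: "G 0 = gg t' 0" using gk(2)[OF t(3)] by simp
    have D1: "Re (deriv G 0) > 0"
    proof (rule near_id_deriv_pos[OF symmD(1)[OF s1] r2])
      fix z assume z: "z \<in> ball (0::complex) (r / 2)"
      have "cmod (G z - z) \<le> cmod (gg \<tau> (gg t z) - gg t z) + cmod (gg t z - z)"
        unfolding G_def using norm_triangle_ineq[of "gg \<tau> (gg t z) - gg t z" "gg t z - z"] by simp
      also have "\<dots> \<le> \<delta> + \<delta>"
        using gk(3)[OF t(2) q34[OF gmap[OF t(1) z]]] gk(3)[OF t(1) half(1)[OF z]] by (rule add_mono)
      finally show "cmod (G z - z) \<le> \<delta> + \<delta>" .
    next
      show "8 * (\<delta> + \<delta>) / (r / 2) < 1" using r unfolding \<delta>_def by simp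
    qed
    have D2: "Re (deriv (gg t') 0) > 0"
    proof (rule near_id_deriv_pos[OF symmD(1)[OF s2] r2])
      show "cmod (gg t' z - z) \<le> \<delta>" if "z \<in> ball 0 (r / 2)" for z
        using gk(3)[OF t(3) half(1)[OF that]] .
      show "8 * \<delta> / (r / 2) < 1" using r unfolding \<delta>_def by simp
    qed
    have "deriv (gg t') 0 / deriv G 0 = of_real (Re (deriv (gg t') 0) / Re (deriv G 0))"
      using symm_Im_deriv[OF s1 r2] symm_Im_deriv[OF s2 r2]
      by (metis complex_is_Real_iff of_real_Re of_real_divide)
    then have "Re (deriv (gg t') 0 / deriv G 0) > 0" using D1 D2 by simp
    moreover have "deriv G 0 \<noteq> 0" using D1 by auto
    ultimately show ?thesis
      using symm_unique[OF s1 s2 r2 eq _ _ lip non z] unfolding G_def H_def by auto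
  qed
  define \<eta>1 where "\<eta>1 = min \<eta>0 (r / 2)"
  have \<eta>1: "\<eta>1 > 0" "\<eta>1 \<le> \<eta>0" "\<eta>1 \<le> r / 2" using \<eta>0(1) r unfolding \<eta>1_def by auto
  \<comment> \<open>The bounds obtained are at most \<open>6 * \<delta> / m\<close>, and
    \<open>1 / m\<close> is at most \<open>8 * t / \<eta>1\<close>.\<close>
  define C where "C = 6 * \<delta> * 8 / \<eta>1"
  have C: "C > 0" unfolding C_def using \<delta> \<eta>1 by simp
  have main: "symm f K (r/2) (gg t) (kk t) \<and> gg t 0 = of_real t \<and>
      (\<forall>z\<in>ball 0 (r/2). cmod (gg t z - z) \<le> C * t \<and> cmod (kk t z) \<le> C * t)"
    if t: "0 < t" "t < \<eta>1 / 8" for t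
  proof -
    have ts: "\<bar>t\<bar> < \<eta>0" "\<bar>t\<bar> < r" "\<bar>t\<bar> < r / 2" using t \<eta>1 r by auto
    \<comment> \<open>Starting from \<open>tt 0 = t = gg t 0\<close>, the number \<open>tt j\<close>
      is the image of \<open>0\<close> under iterate number \<open>j + 1\<close> of
      \<open>gg t\<close>. So the means below begin with \<open>gg t\<close>, not with the
      identity.\<close>
    define tt where "tt = rec_nat t (\<lambda>_ \<tau>. Re (gg \<tau> (of_real t)))"
    have tt: "tt 0 = t" "tt (Suc j) = Re (gg (tt j) (of_real t))" for j
      unfolding tt_def by simp_all
    \<comment> \<open>The displacement of \<open>gg (tt j)\<close> is \<open>tt j\<close> at
      \<open>0\<close> and changes by at most \<open>t\<close> between \<open>0\<close> and
      \<open>t\<close>; hence each step adds at most \<open>2 * t\<close>.\<close>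
    have ttb: "\<bar>tt j\<bar> \<le> (2 * real j + 1) * t" if "(2 * real j + 1) * t < \<eta>1" for j
      using that
    proof (induction j)
      case 0
      then show ?case using t by (simp add: tt)
    next
      case (Suc j)
      have "(2 * real j + 1) * t \<le> (2 * real (Suc j) + 1) * t" using t by (intro mult_right_mono) auto
      then have IH: "\<bar>tt j\<bar> \<le> (2 * real j + 1) * t" "\<bar>tt j\<bar> < \<eta>0" using Suc \<eta>1(2) by linarith+
      define u where "u z = gg (tt j) z - z" for z
      have uh: "u holomorphic_on ball 0 r"
        unfolding u_def using symmD(1)[OF gk(1)[OF IH(2)]] by (intro holomorphic_intros)
      have "cmod (u (of_real t) - u 0) \<le> 8 * \<delta> / r * cmod (of_real t - 0)"
      proof (rule Cauchy_Lipschitz_bound[OF uh r])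
        show "cmod (u z) \<le> \<delta>" if "z \<in> ball 0 r" for z unfolding u_def using gk(3)[OF IH(2) that] .
      qed (use ts r in auto)
      also have "8 * \<delta> / r * cmod (of_real t - 0) \<le> t" using r t unfolding \<delta>_def by simp
      finally have 1: "cmod (u (of_real t) - u 0) \<le> t" .
      have "gg (tt j) (of_real t) = u (of_real t) - u 0 + of_real (t + tt j)"
        unfolding u_def gk(2)[OF IH(2)] by simp
      then have "tt (Suc j) = Re (u (of_real t) - u 0) + t + tt j" unfolding tt by simp
      then have "\<bar>tt (Suc j)\<bar> \<le> \<bar>Re (u (of_real t) - u 0)\<bar> + t + \<bar>tt j\<bar>" using t by linarith
      then show ?case using 1 abs_Re_le_cmod[of "u (of_real t) - u 0"] IH(1)
        by (simp add: algebra_simps)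
    qed
    \<comment> \<open>Up to this \<open>m\<close> the bound \<open>(2 * m + 1) * t\<close> stays
      below \<open>\<eta>1\<close>. As \<open>t < \<eta>1 / 8\<close>, the quotient is at least 2,
      and rounding down loses at most a factor 2.\<close>
    define m where "m = nat \<lfloor>\<eta>1 / (4 * t)\<rfloor>"
    have big: "\<eta>1 / (4 * t) \<ge> 2" using t by (simp add: field_simps)
    have m: "real m \<le> \<eta>1 / (4 * t)" "real m > \<eta>1 / (4 * t) - 1" unfolding m_def using big by linarith+
    have m1: "real m \<ge> \<eta>1 / (8 * t)"
    proof -
      have "\<eta>1 / (4 * t) = 2 * (\<eta>1 / (8 * t))" by simp
      then show ?thesis using m(2) big by linarith
    qed
    have mpos: "m > 0" "real m > 0" using m(2) big by linarith+
    have inv: "1 / real m \<le> 8 * t / \<eta>1"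
    proof -
      have "\<eta>1 \<le> 8 * t * real m" using m1 t(1) by (simp add: field_simps)
      then show ?thesis using mpos(2) \<eta>1(1) by (simp add: field_simps)
    qed
    have ttj: "\<bar>tt j\<bar> < \<eta>0" if "j \<le> m" for j
    proof -
      have "(2 * real j + 1) * t \<le> (2 * real m + 1) * t" using that t by (intro mult_right_mono) auto
      also have "\<dots> = 2 * (real m * t) + t" by (simp add: algebra_simps)
      also have "real m * t \<le> \<eta>1 / 4" using m(1) t by (simp add: field_simps)
      also have "2 * (\<eta>1 / 4) + t < \<eta>1" using t \<eta>1(1) by simp
      finally have "(2 * real j + 1) * t < \<eta>1" by simp
      then show ?thesis using ttb[of j] \<eta>1(2) by linarith
    qed
    note stp = step[OF ts(1) ttj ttj ts(2) tt(2)]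
    define A where "A z = (\<Sum>j<m. gg (tt j) z) / of_nat m" for z
    define b where "b z = (\<Sum>j<m. kk (tt j) z) / of_nat m" for z
    define u where "u z = A z - z" for z
    have gh: "gg (tt j) holomorphic_on ball 0 r" "kk (tt j) holomorphic_on ball 0 r" if "j < m" for j
      using symmD(1,2)[OF gk(1)[OF ttj[of j]]] that by auto
    have uh: "u holomorphic_on ball 0 r"
      unfolding u_def A_def using mpos gh by (intro holomorphic_intros) auto
    have bh: "b holomorphic_on ball 0 r"
      unfolding b_def using mpos gh by (intro holomorphic_intros) auto
    have avg: "cmod ((\<Sum>j<m. F j) / of_nat m) \<le> \<delta>" if "\<And>j. j < m \<Longrightarrow> cmod (F j) \<le> \<delta>" for F
    proof -
      have "cmod (\<Sum>j<m. F j) \<le> real m * \<delta>"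
        using sum_norm_bound[of "{..<m}" F \<delta>] that by simp
      then show ?thesis using mpos by (simp add: norm_divide field_simps)
    qed
    have ub: "cmod (u z) \<le> \<delta>" if "z \<in> ball 0 r" for z
    proof -
      have "u z = (\<Sum>j<m. gg (tt j) z - z) / of_nat m"
        unfolding u_def A_def using mpos by (simp add: sum_subtractf field_simps)
      then show ?thesis using avg[of "\<lambda>j. gg (tt j) z - z"] gk(3)[OF ttj that] by simp
    qed
    have bb: "cmod (b z) \<le> \<delta>" if "z \<in> ball 0 r" for z
      unfolding b_def using gk(4)[OF ttj that] by (intro avg) simp
    have key: "cmod (gg t z - z) \<le> C * t \<and> cmod (kk t z) \<le> C * t" if z: "z \<in> ball 0 (r/2)" for z
    proof -
      let ?g = "gg t z"
      note gz = gmap[OF ts(1) z]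
      have e8: "8 * \<delta> / r = 1 / 8" using r unfolding \<delta>_def by simp
      have "A ?g - A z = (\<Sum>j<m. gg (tt (Suc j)) z - gg (tt j) z) / of_nat m"
        unfolding A_def using stp[OF _ _ z] by (simp add: sum_subtractf diff_divide_distrib)
      also have "\<dots> = (gg (tt m) z - gg (tt 0) z) / of_nat m"
        by (simp only: sum_lessThan_telescope[of "\<lambda>j. gg (tt j) z" m])
      finally have Aeq: "A ?g - A z = (gg (tt m) z - ?g) / of_nat m" by (simp add: tt)
      have "cmod (gg (tt m) z - ?g) \<le> cmod (gg (tt m) z - z) + cmod (?g - z)"
        using norm_triangle_ineq4[of "gg (tt m) z - z" "?g - z"] by simp
      also have "\<dots> \<le> 2 * \<delta>"
        using gk(3)[OF ttj[of m] half(1)[OF z]] gk(3)[OF ts(1) half(1)[OF z]] by simp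
      finally have A1: "cmod (A ?g - A z) \<le> 2 * \<delta> / m"
        unfolding Aeq using mpos by (simp add: norm_divide divide_right_mono)
      \<comment> \<open>The Lipschitz constant is \<open>1 / 8\<close>, so this term is absorbed
        into the left side, and \<open>2 * \<delta> / m\<close> grows to no more than
        \<open>4 * \<delta> / m\<close>.\<close>
      have "cmod (u ?g - u z) \<le> 8 * \<delta> / r * cmod (?g - z)"
        by (rule Cauchy_Lipschitz_bound[OF uh r ub gz half(2)[OF z]])
      moreover have "?g - z = (A ?g - A z) - (u ?g - u z)" unfolding u_def by simp
      then have "cmod (?g - z) \<le> cmod (A ?g - A z) + cmod (u ?g - u z)"
        by (metis norm_triangle_ineq4)
      ultimately have "cmod (?g - z) \<le> 2 * \<delta> / m + 1 / 8 * cmod (?g - z)" using A1 unfolding e8 by linarith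
      moreover have dm: "\<delta> / m \<ge> 0" "2 * \<delta> / m = 2 * (\<delta> / m)" using \<delta> by simp_all
      ultimately have g1: "cmod (?g - z) \<le> 4 * (\<delta> / m)" by linarith
      \<comment> \<open>Summing the cocycle relation over \<open>j\<close> isolates \<open>m\<close>
        copies of \<open>kk t z\<close>. What remains is a telescoped term, at most
        \<open>2 * \<delta>\<close>, and the variation of the mean \<open>b\<close> between
        \<open>z\<close> and \<open>gg t z\<close>, controlled by the bound just found.\<close>
      have "(\<Sum>j<m. kk (tt (Suc j)) z - kk (tt j) z) = (\<Sum>j<m. kk t z + (kk (tt j) ?g - kk (tt j) z))"
        using stp[OF _ _ z] by (intro sum.cong) auto
      also have "\<dots> = of_nat m * kk t z + of_nat m * (b ?g - b z)"
        unfolding b_def using mpos by (simp add: sum.distrib sum_subtractf diff_divide_distrib[symmetric])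
      also have "(\<Sum>j<m. kk (tt (Suc j)) z - kk (tt j) z) = kk (tt m) z - kk t z"
        by (simp only: sum_lessThan_telescope[of "\<lambda>j. kk (tt j) z" m] tt(1))
      finally have "kk t z = (kk (tt m) z - kk t z) / of_nat m - (b ?g - b z)"
        using mpos by (simp add: field_simps)
      then have "cmod (kk t z) \<le> cmod ((kk (tt m) z - kk t z) / of_nat m) + cmod (b ?g - b z)"
        by (metis norm_triangle_ineq4)
      moreover have "cmod ((kk (tt m) z - kk t z) / of_nat m) \<le> 2 * \<delta> / m"
      proof -
        have "cmod (kk (tt m) z - kk t z) \<le> cmod (kk (tt m) z) + cmod (kk t z)" by (rule norm_triangle_ineq4)
        also have "\<dots> \<le> 2 * \<delta>"
          using gk(4)[OF ttj[of m] half(1)[OF z]] gk(4)[OF ts(1) half(1)[OF z]] by simp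
        finally show ?thesis using mpos by (simp add: norm_divide divide_right_mono)
      qed
      moreover have "cmod (b ?g - b z) \<le> 8 * \<delta> / r * cmod (?g - z)"
        by (rule Cauchy_Lipschitz_bound[OF bh r bb gz half(2)[OF z]])
      moreover have "1 / 8 * cmod (?g - z) \<le> cmod (?g - z)" by simp
      ultimately have k1: "cmod (kk t z) \<le> 6 * (\<delta> / m)" using g1 dm unfolding e8 by linarith
      have "6 * (\<delta> / m) = 6 * \<delta> * (1 / m)" by simp
      also have "\<dots> \<le> 6 * \<delta> * (8 * t / \<eta>1)" using inv \<delta> by (intro mult_left_mono) auto
      also have "\<dots> = C * t" unfolding C_def by simp
      finally have "6 * (\<delta> / m) \<le> C * t" .
      moreover have "4 * (\<delta> / m) \<le> 6 * (\<delta> / m)" using dm(1) by linarith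
      ultimately show ?thesis using g1 k1 by linarith
    qed
    then show ?thesis using symm_mono[OF gk(1)[OF ts(1)], of "r/2"] gk(2)[OF ts(1)] r by auto
  qed
  have "\<eta>1 / 8 > 0" using \<eta>1 by simp
  then show ?thesis using C main by blast
qed

section \<open>Transitive symmetries force analyticity\<close>

lemma C1_imp_lipschitz_at0:
  assumes f: "\<And>x. \<bar>x\<bar> \<le> a \<Longrightarrow> (f has_real_derivative f' x) (at x)"
    and cont: "continuous_on {-a..a} f'" and a: "a > 0"
  shows "lipschitz_at0 f"
proof -
  have "bounded (f' ` {-a..a})"
    by (intro compact_imp_bounded compact_continuous_image cont compact_Icc)
  then obtain L where L: "L > 0" "\<And>x. \<bar>x\<bar> \<le> a \<Longrightarrow> norm (f' x) \<le> L"
    unfolding bounded_pos by (auto simp: abs_le_iff)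
  have "\<bar>f x - f y\<bar> \<le> L * \<bar>x - y\<bar>" if "\<bar>x\<bar> < a" "\<bar>y\<bar> < a" for x y
  proof -
    have "norm (f x - f y) \<le> L * norm (x - y)"
    proof (rule field_differentiable_bound[of "{-a..a}"])
      show "(f has_field_derivative f' z) (at z within {-a..a})" if "z \<in> {-a..a}" for z
        by (rule has_field_derivative_at_within, rule f) (use that in auto)
      show "norm (f' z) \<le> L" if "z \<in> {-a..a}" for z
        by (rule L(2)) (use that in auto)
    qed (use that in auto)
    then show ?thesis by simp
  qed
  then show ?thesis unfolding lipschitz_at0_def using L(1) a by (intro exI[of _ L] exI[of _ a]) auto
qed

text \<open>Caratheodory's form of the derivative covers the case \<open>s n = 0\<close>, in which
  the increment of the argument vanishes.\<close>

lemma LIMSEQ_difference_quotient: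
  fixes f :: "real \<Rightarrow> real"
  assumes f: "(f has_real_derivative D) (at x)" and s: "s \<longlonglongrightarrow> l" and t: "t \<longlonglongrightarrow> 0" "\<And>n. t n \<noteq> 0"
  shows "(\<lambda>n. (f (x + t n * s n) - f x) / t n) \<longlonglongrightarrow> D * l"
proof -
  obtain q where q: "\<And>z. f z - f x = q z * (z - x)" "isCont q x" "q x = D"
    using f unfolding DERIV_caratheodory_within by (auto simp: isCont_def continuous_within)
  have "(\<lambda>n. x + t n * s n) \<longlonglongrightarrow> x + 0 * l" by (intro tendsto_intros s t)
  then have "(\<lambda>n. q (x + t n * s n)) \<longlonglongrightarrow> q x" using isCont_tendsto_compose[OF q(2)] by simp
  then have "(\<lambda>n. q (x + t n * s n) * s n) \<longlonglongrightarrow> D * l" unfolding q(3) by (intro tendsto_intros s)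
  moreover have "q (x + t n * s n) * s n = (f (x + t n * s n) - f x) / t n" for n
    unfolding q(1) using t(2)[of n] by simp
  ultimately show ?thesis by simp
qed

text \<open>Near \<open>0\<close> the quotient \<open>Y / X\<close> is holomorphic and has a
  primitive \<open>P\<close>; on the axis \<open>P\<close> and \<open>f\<close> have the same
  derivative, hence differ by a constant.\<close>

lemma derivative_quotient_imp_hol_ext:
  assumes X: "X holomorphic_on ball 0 r" and Y: "Y holomorphic_on ball 0 r" and r: "r > 0"
    and X0: "X 0 \<noteq> 0"
    and f: "\<And>x. \<bar>x\<bar> < r \<Longrightarrow> (f has_real_derivative f' x) (at x)"
    and eq: "\<And>x. \<bar>x\<bar> < r \<Longrightarrow> of_real (f' x) * X (of_real x) = Y (of_real x)"
  shows "hol_ext f 0"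
proof -
  have "isCont X 0" using holomorphic_on_imp_continuous_on[OF X] r
    by (simp add: continuous_on_eq_continuous_at)
  then obtain d where d: "d > 0" "\<And>z. dist 0 z < d \<Longrightarrow> X z \<noteq> 0"
    using continuous_at_avoid[of 0 X 0] X0 by blast
  define s where "s = min r d"
  have s: "s > 0" "s \<le> r" "s \<le> d" using r d unfolding s_def by auto
  have sub: "ball 0 s \<subseteq> ball (0::complex) r" using s by auto
  define Q where "Q z = Y z / X z" for z
  have Q: "Q holomorphic_on ball 0 s" unfolding Q_def
    by (intro holomorphic_intros holomorphic_on_subset[OF X sub] holomorphic_on_subset[OF Y sub] d(2))
      (use s in auto)
  obtain P where P: "\<And>z. z \<in> ball 0 s \<Longrightarrow> (P has_field_derivative Q z) (at z within ball 0 s)"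
    using holomorphic_convex_primitive'[OF convex_ball open_ball Q] by blast
  have P': "(P has_field_derivative Q z) (at z)" if "z \<in> ball 0 s" for z
    using P[OF that] that by (simp add: at_within_open[of _ "ball 0 s"])
  define h where "h = (\<lambda>x. P (of_real x) - complex_of_real (f x))"
  have h': "(h has_vector_derivative 0) (at x within {-s<..<s})" if x: "x \<in> {-s<..<s}" for x
  proof -
    have xr: "\<bar>x\<bar> < r" "\<bar>x\<bar> < s" using x s by auto
    have Qx: "Q (of_real x) = of_real (f' x)"
      using eq[OF xr(1)] d(2)[of "of_real x"] xr s(3) unfolding Q_def by (simp add: field_simps)
    have "((\<lambda>x. P (of_real x)) has_vector_derivative of_real (f' x)) (at x within {-s<..<s})"
      using has_vector_derivative_real_field[OF P'[of "of_real x"]] xr unfolding Qx by simp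
    moreover have "((\<lambda>x. complex_of_real (f x)) has_vector_derivative of_real (f' x)) (at x within {-s<..<s})"
      using f[OF xr(1)] by (intro has_vector_derivative_of_real has_vector_derivative_at_within)
        (simp add: has_real_derivative_iff_has_vector_derivative)
    ultimately have "(h has_vector_derivative (of_real (f' x) - of_real (f' x))) (at x within {-s<..<s})"
      unfolding h_def by (rule has_vector_derivative_diff)
    then show ?thesis by simp
  qed
  obtain c where c: "\<And>x. x \<in> {-s<..<s} \<Longrightarrow> h x = c"
    using has_vector_derivative_zero_constant[OF _ h'] by (metis convex_real_interval(8))
  have "P holomorphic_on ball 0 s" unfolding holomorphic_on_open[OF open_ball] using P' by blast
  then have "(\<lambda>z. P z - c) holomorphic_on ball 0 s" by (intro holomorphic_intros)
  moreover have "P (of_real x) - c = of_real (f x)" if "\<bar>x - 0\<bar> < s" for x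
    using c[of x] that unfolding h_def by (simp add: abs_less_iff algebra_simps)
  ultimately show ?thesis unfolding hol_ext_def using s(1) of_real_0 by metis
qed

text \<open>The limit \<open>X0\<close> plays the part of an infinitesimal generator, obtained
  without a one-parameter group.\<close>

theorem hol_ext_of_transitive_at0:
  assumes f: "\<And>x. \<bar>x\<bar> \<le> b \<Longrightarrow> (f has_real_derivative f' x) (at x)"
    and cont: "continuous_on {-b..b} f'" and b: "b > 0" and a: "a > 0"
    and all: "\<And>q. q \<in> {-a..a} \<Longrightarrow>
      \<exists>r g k. r > 0 \<and> symm f {-b..b} r g k \<and> g 0 = of_real q \<and> deriv g 0 \<noteq> 0"
  shows "\<exists>x\<in>{-b..b}. hol_ext f x"
proof (rule ccontr)
  assume non: "\<not> ?thesis"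
  note lip = C1_imp_lipschitz_at0[OF f cont b]
  have contf: "continuous_on {-b..b} f"
    by (intro continuous_at_imp_continuous_on ballI DERIV_isCont[OF f]) auto
  obtain r where r: "r > 0" and near: "\<And>\<delta>. \<delta> > 0 \<Longrightarrow> \<exists>\<eta>>0. \<forall>t. \<bar>t\<bar> < \<eta> \<longrightarrow>
      (\<exists>g k. symm f {-b..b} r g k \<and> g 0 = of_real t \<and>
           (\<forall>z\<in>ball 0 r. cmod (g z - z) \<le> \<delta> \<and> cmod (k z) \<le> \<delta>))"
    using near_identity_symms[OF contf closed_atLeastAtMost a all lip non] by blast
  obtain C \<eta> where C: "C > 0" "\<eta> > 0" "\<forall>t. 0 < t \<longrightarrow> t < \<eta> \<longrightarrow>
      (\<exists>g k. symm f {-b..b} (r/2) g k \<and> g 0 = of_real t \<and>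
           (\<forall>z\<in>ball 0 (r/2). cmod (g z - z) \<le> C * t \<and> cmod (k z) \<le> C * t))"
    using linear_symms[OF lip non r near] by blast
  define R where "R = r / 2"
  have R: "R > 0" using r unfolding R_def by simp
  \<comment> \<open>The summand 2 keeps \<open>t n\<close> strictly below \<open>\<eta>\<close> from
    \<open>n = 0\<close> on.\<close>
  define t where "t n = \<eta> / (real n + 2)" for n
  have t: "0 < t n" "t n < \<eta>" for n
  proof -
    show "0 < t n" using C(2) unfolding t_def by simp
    have "\<eta> / (real n + 2) < \<eta> / 1" using C(2) by (intro divide_strict_left_mono) auto
    then show "t n < \<eta>" unfolding t_def by simp
  qed
  have t0: "t \<longlonglongrightarrow> 0"
    unfolding t_def using LIMSEQ_ignore_initial_segment[OF lim_const_over_n[of \<eta>], of 2] by (simp add: add.commute)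
  have "\<forall>n. \<exists>g k. symm f {-b..b} R g k \<and> g 0 = of_real (t n) \<and>
           (\<forall>z\<in>ball 0 R. cmod (g z - z) \<le> C * t n \<and> cmod (k z) \<le> C * t n)"
    using C(3) t unfolding R_def by blast
  then obtain G H where GH: "\<And>n. symm f {-b..b} R (G n) (H n)" "\<And>n. G n 0 = of_real (t n)"
    "\<And>n z. z \<in> ball 0 R \<Longrightarrow> cmod (G n z - z) \<le> C * t n" "\<And>n z. z \<in> ball 0 R \<Longrightarrow> cmod (H n z) \<le> C * t n"
    by metis
  define X where "X n z = (G n z - z) / of_real (t n)" for n z
  define Y where "Y n z = H n z / of_real (t n)" for n z
  have XY: "X n holomorphic_on ball 0 R" "Y n holomorphic_on ball 0 R" for n
    unfolding X_def Y_def using symmD(1,2)[OF GH(1)] t(1)[of n] by (auto intro!: holomorphic_intros)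
  have XYb: "cmod (X n z) \<le> C" "cmod (Y n z) \<le> C" if "z \<in> ball 0 R" for n z
    using GH(3,4)[OF that, of n] t(1)[of n] unfolding X_def Y_def by (simp_all add: norm_divide field_simps)
  obtain X0 Y0 \<rho> where l: "X0 holomorphic_on ball 0 R" "Y0 holomorphic_on ball 0 R"
    "strict_mono (\<rho> :: nat \<Rightarrow> nat)" "loc_uniform_limit R (X \<circ> \<rho>) X0" "loc_uniform_limit R (Y \<circ> \<rho>) Y0"
    using Montel_ball2[of X R C Y] XY XYb by metis
  have pX: "(\<lambda>n. X (\<rho> n) z) \<longlonglongrightarrow> X0 z" and pY: "(\<lambda>n. Y (\<rho> n) z) \<longlonglongrightarrow> Y0 z" if "z \<in> ball 0 R" for z
    using uniform_limit_ball_imp_pointwise[OF l(4) that] uniform_limit_ball_imp_pointwise[OF l(5) that]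
    by simp_all
  \<comment> \<open>The normalisation \<open>G n 0 = t n\<close> survives in the limit and is what
    permits division by \<open>X0\<close> near \<open>0\<close>.\<close>
  have "X n 0 = 1" for n unfolding X_def GH(2) using t(1)[of n] by simp
  then have "X0 0 = 1" using pX[of 0] R LIMSEQ_unique[OF tendsto_const] by fastforce
  then have X00: "X0 0 \<noteq> 0" by simp
  have xa: "\<bar>x\<bar> \<le> b" if "\<bar>x\<bar> < R" for x using symmD(3)[OF GH(1) that] by auto
  have "hol_ext f 0"
  proof (rule derivative_quotient_imp_hol_ext[OF l(1,2) R X00])
    fix x assume x: "\<bar>x\<bar> < R"
    show fx: "(f has_real_derivative f' x) (at x)" using f[OF xa[OF x]] .
    have xb: "complex_of_real x \<in> ball 0 R" using x by simp
    define s where "s n = Re (X (\<rho> n) (of_real x))" for n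
    have sx: "X (\<rho> n) (of_real x) = of_real (s n)"
      and sy: "Y (\<rho> n) (of_real x) = of_real ((f (x + t (\<rho> n) * s n) - f x) / t (\<rho> n))" for n
    proof -
      define y where "y = Re (G (\<rho> n) (of_real x))"
      have y: "G (\<rho> n) (of_real x) = of_real y" "H (\<rho> n) (of_real x) = of_real (f y - f x)"
        using symmD(4,6)[OF GH(1) x, of "\<rho> n"] unfolding y_def by auto
      have X: "X (\<rho> n) (of_real x) = of_real ((y - x) / t (\<rho> n))" unfolding X_def y(1) by simp
      then have s: "s n = (y - x) / t (\<rho> n)" unfolding s_def by simp
      show "X (\<rho> n) (of_real x) = of_real (s n)" using X s by simp
      have "x + t (\<rho> n) * s n = y" unfolding s using t(1)[of "\<rho> n"] by simp
      then show "Y (\<rho> n) (of_real x) = of_real ((f (x + t (\<rho> n) * s n) - f x) / t (\<rho> n))"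
        unfolding Y_def y(2) by simp
    qed
    have sl: "s \<longlonglongrightarrow> Re (X0 (of_real x))" unfolding s_def by (intro tendsto_Re pX xb)
    have Xr: "X0 (of_real x) = of_real (Re (X0 (of_real x)))"
      using pX[OF xb] LIMSEQ_unique[OF _ tendsto_of_real[OF sl]] unfolding sx by blast
    have "(\<lambda>n. t (\<rho> n)) \<longlonglongrightarrow> 0" using LIMSEQ_subseq_LIMSEQ[OF t0 l(3)] by (simp add: o_def)
    moreover have "t (\<rho> n) \<noteq> 0" for n using t(1)[of "\<rho> n"] by simp
    ultimately have "(\<lambda>n. (f (x + t (\<rho> n) * s n) - f x) / t (\<rho> n)) \<longlonglongrightarrow> f' x * Re (X0 (of_real x))"
      by (intro LIMSEQ_difference_quotient[OF fx sl])
    then have "(\<lambda>n. Y (\<rho> n) (of_real x)) \<longlonglongrightarrow> of_real (f' x * Re (X0 (of_real x)))"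
      unfolding sy by (rule tendsto_of_real)
    then have "Y0 (of_real x) = of_real (f' x * Re (X0 (of_real x)))"
      using pY[OF xb] LIMSEQ_unique by blast
    then show "of_real (f' x) * X0 (of_real x) = Y0 (of_real x)" by (subst Xr) simp
  qed
  moreover have "0 \<in> {-b..b}" using b by simp
  ultimately show False using non by blast
qed

section \<open>From one analytic point to all points\<close>

lemma hol_ext_shift: "hol_ext f (x + a) \<Longrightarrow> hol_ext (\<lambda>x. f (x + a)) x"
  using hol_ext_compose[OF hol_ext_add[OF hol_ext_ident hol_ext_const]] by blast

text \<open>Recentring at \<open>p\<close> turns \<open>\<phi>\<close> into \<open>g\<close>. The
  room \<open>b - \<bar>q\<bar>\<close> and continuity of \<open>\<phi>\<close> keep the image of a
  small interval inside \<open>{-b..b}\<close>, as \<open>symm\<close> requires.\<close>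

lemma symm_of_hol_ext:
  assumes \<phi>: "hol_ext \<phi> p" and h: "hol_ext h p" and "\<phi> p = p + q" and D: "(\<phi> has_real_derivative D) (at p)" "D \<noteq> 0"
    and eq: "\<forall>\<^sub>F x in nhds p. f (\<phi> x) = f x + h x" and q: "\<bar>q\<bar> < b"
  shows "\<exists>r g k. r > 0 \<and> symm (\<lambda>x. f (p + x)) {-b..b} r g k \<and> g 0 = of_real q \<and> deriv g 0 \<noteq> 0"
proof -
  obtain r1 \<Phi> where r1: "r1 > 0" "\<Phi> holomorphic_on ball (complex_of_real p) r1"
    "\<And>x. \<bar>x - p\<bar> < r1 \<Longrightarrow> \<Phi> (of_real x) = of_real (\<phi> x)"
    using \<phi> unfolding hol_ext_def by blast
  obtain r2 H where r2: "r2 > 0" "H holomorphic_on ball (complex_of_real p) r2"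
    "\<And>x. \<bar>x - p\<bar> < r2 \<Longrightarrow> H (of_real x) = of_real (h x)"
    using h unfolding hol_ext_def by blast
  obtain r3 where r3: "r3 > 0" "\<And>x. \<bar>x - p\<bar> < r3 \<Longrightarrow> f (\<phi> x) = f x + h x"
    using eq unfolding eventually_nhds_metric by (auto simp: dist_real_def)
  have "b - \<bar>q\<bar> > 0" using q by simp
  then obtain r4 where r4: "r4 > 0" "\<And>x. \<bar>x - p\<bar> < r4 \<Longrightarrow> \<bar>\<phi> x - \<phi> p\<bar> < b - \<bar>q\<bar>"
    using hol_ext_isCont[OF \<phi>] unfolding continuous_at_eps_delta dist_real_def by blast
  define r where "r = min (min r1 r2) (min (min r3 r4) b)"
  have r: "r > 0" "r \<le> r1" "r \<le> r2" "r \<le> r3" "r \<le> r4" "r \<le> b"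
    unfolding r_def using r1(1) r2(1) r3(1) r4(1) q by auto
  define g where "g z = \<Phi> (of_real p + z) - of_real p" for z
  define k where "k z = H (of_real p + z)" for z
  have sub: "(\<lambda>z. of_real p + z) ` ball 0 r \<subseteq> ball (complex_of_real p) r1"
    "(\<lambda>z. of_real p + z) ` ball 0 r \<subseteq> ball (complex_of_real p) r2"
    using r by (auto simp: dist_norm)
  have sh: "(\<lambda>z. complex_of_real p + z) holomorphic_on ball 0 r" by (intro holomorphic_intros)
  have g: "g holomorphic_on ball 0 r"
    unfolding g_def using holomorphic_on_compose_gen[OF sh r1(2) sub(1)]
    by (intro holomorphic_intros) (simp add: o_def)
  have k: "k holomorphic_on ball 0 r"
    using holomorphic_on_compose_gen[OF sh r2(2) sub(2)] unfolding k_def by (simp add: o_def)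
  have rl: "x \<in> {-b..b} \<and> (\<exists>y\<in>{-b..b}. g (of_real x) = of_real y \<and>
      k (of_real x) = of_real (f (p + y) - f (p + x)))" if x: "\<bar>x\<bar> < r" for x
  proof -
    define y where "y = \<phi> (p + x) - p"
    have "g (of_real x) = of_real y"
      using r1(3)[of "p + x"] x r(2) unfolding g_def y_def by simp
    moreover have "k (of_real x) = of_real (f (p + y) - f (p + x))"
      using r2(3)[of "p + x"] r3(2)[of "p + x"] x r(3,4) unfolding k_def y_def by simp
    moreover have "\<bar>y - q\<bar> < b - \<bar>q\<bar>"
      using r4(2)[of "p + x"] x r(5) assms(3) unfolding y_def by (simp add: algebra_simps)
    then have "y \<in> {-b..b}" by auto
    ultimately show ?thesis using x r(6) by (auto simp: abs_less_iff intro!: bexI[of _ y])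
  qed
  have "(\<Phi> has_field_derivative deriv \<Phi> (of_real p)) (at (of_real p))"
    using r1(1) by (intro holomorphic_derivI[OF r1(2)]) auto
  then have \<Phi>': "(\<Phi> has_field_derivative deriv \<Phi> (of_real p)) (at (of_real p + 0))" by simp
  have "((\<lambda>z. \<Phi> (of_real p + z)) has_field_derivative deriv \<Phi> (of_real p)) (at 0)"
    using \<Phi>' DERIV_shift[of \<Phi> "deriv \<Phi> (of_real p)" 0 "of_real p"] by (simp add: add.commute)
  then have "(g has_field_derivative deriv \<Phi> (of_real p)) (at 0)"
    unfolding g_def by (auto intro!: derivative_eq_intros)
  then have dg: "deriv g 0 = deriv \<Phi> (of_real p)" by (rule DERIV_imp_deriv)
  have "((\<lambda>x. Re (\<Phi> (of_real x))) has_real_derivative Re (deriv \<Phi> (of_real p))) (at p)"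
    using \<Phi>' by (intro has_real_derivative_Re_of_real) simp
  moreover have "\<forall>\<^sub>F x in nhds p. Re (\<Phi> (of_real x)) = \<phi> x"
  proof -
    have "\<forall>\<^sub>F x in nhds p. x \<in> ball p r1" using r1(1) by (intro eventually_nhds_in_open) auto
    then show ?thesis by eventually_elim (simp add: r1(3) dist_real_def abs_minus_commute)
  qed
  ultimately have "(\<phi> has_real_derivative Re (deriv \<Phi> (of_real p))) (at p)"
    by (subst (asm) DERIV_cong_ev[OF refl _ refl]) auto
  then have "Re (deriv \<Phi> (of_real p)) = D" using D(1) DERIV_unique by blast
  then have "deriv g 0 \<noteq> 0" using D(2) dg by auto
  moreover have "g 0 = of_real q" using r1(3)[of p] r1(1) assms(3) unfolding g_def by simp
  moreover have "symm (\<lambda>x. f (p + x)) {-b..b} r g k" unfolding symm_def using g k rl by blast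
  ultimately show ?thesis using r(1) by blast
qed

theorem hol_ext_of_transitive:
  assumes I: "open I"
    and f: "\<And>x. x \<in> I \<Longrightarrow> (f has_real_derivative f' x) (at x)" "continuous_on I f'"
    and trans: "\<And>p q. p \<in> I \<Longrightarrow> q \<in> I \<Longrightarrow> \<exists>\<phi> h D. hol_ext \<phi> p \<and> hol_ext h p \<and> \<phi> p = q \<and>
      (\<phi> has_real_derivative D) (at p) \<and> D \<noteq> 0 \<and> (\<forall>\<^sub>F x in nhds p. f (\<phi> x) = f x + h x)"
    and p: "p \<in> I"
  shows "hol_ext f p"
proof -
  obtain b where b: "b > 0" "cball p b \<subseteq> I" using I p open_contains_cball by blast
  have bI: "p + x \<in> I" if "\<bar>x\<bar> \<le> b" for x using b(2) that by (auto simp: dist_real_def subset_eq)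
  have "\<exists>x\<in>{-b..b}. hol_ext (\<lambda>x. f (p + x)) x"
  \<comment> \<open>Half of \<open>b\<close> keeps the targets \<open>q\<close> strictly inside
    \<open>{-b..b}\<close>.\<close>
  proof (rule hol_ext_of_transitive_at0[where a = "b / 2" and f' = "\<lambda>x. f' (p + x)"])
    show "((\<lambda>x. f (p + x)) has_real_derivative f' (p + x)) (at x)" if "\<bar>x\<bar> \<le> b" for x
      using f(1)[OF bI[OF that]] DERIV_shift[of f "f' (p + x)" x p] by (simp add: add.commute)
    show "continuous_on {-b..b} (\<lambda>x. f' (p + x))"
      by (rule continuous_on_compose2[OF f(2)])
        (intro continuous_intros, rule image_subsetI, rule bI, auto)
    fix q assume q: "q \<in> {-(b/2)..b/2}"
    then have "p + q \<in> I" using b(1) by (intro bI) auto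
    from trans[OF p this] obtain \<phi> h D where t: "hol_ext \<phi> p" "hol_ext h p" "\<phi> p = p + q"
      "(\<phi> has_real_derivative D) (at p)" "D \<noteq> 0" "\<forall>\<^sub>F x in nhds p. f (\<phi> x) = f x + h x"
      by (elim exE conjE)
    show "\<exists>r g k. r > 0 \<and> symm (\<lambda>x. f (p + x)) {-b..b} r g k \<and> g 0 = of_real q \<and> deriv g 0 \<noteq> 0"
      by (rule symm_of_hol_ext[OF t]) (use q b(1) in auto)
  qed (use b(1) in auto)
  then obtain x where "x \<in> {-b..b}" and hx: "hol_ext (\<lambda>x. f (p + x)) x" by blast
  then have x: "\<bar>x\<bar> \<le> b" by auto
  have fx: "hol_ext f (p + x)"
    using hol_ext_shift[of "\<lambda>x. f (p + x)" "p + x" "- p"] hx by simp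
  \<comment> \<open>A symmetry from \<open>p\<close> to the analytic point \<open>p + x\<close>
    brings analyticity back to \<open>p\<close>, since \<open>f\<close> equals
    \<open>f (\<phi> x) - h x\<close> there.\<close>
  obtain \<phi> h where t: "hol_ext \<phi> p" "hol_ext h p" "\<phi> p = p + x" "\<forall>\<^sub>F x in nhds p. f (\<phi> x) = f x + h x"
    using trans[OF p bI[OF x]] by blast
  have "hol_ext (\<lambda>x. f (\<phi> x)) p" by (rule hol_ext_compose[OF t(1)]) (simp add: t(3) fx)
  then have "hol_ext (\<lambda>x. f (\<phi> x) - h x) p" using t(2) by (rule hol_ext_diff)
  then show ?thesis by (rule hol_ext_cong) (use t(4) in \<open>auto elim: eventually_mono\<close>)
qed

section \<open>Vertical segments and analytic graphs are homogeneous\<close>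

text \<open>A series in the coordinate along \<open>e\<close> is a multivariate series supported on
  the multi-indices that vanish off \<open>e\<close>. Sums of such functions suffice to write down a
  shear.\<close>

lemma real_analytic_on_scaleR_inner:
  fixes e :: "'a::euclidean_space" and w :: "'b::euclidean_space"
  assumes e: "e \<in> Basis" and u: "\<And>c. c \<in> S \<Longrightarrow> hol_ext u (c \<bullet> e)"
  shows "real_analytic_on (\<lambda>z. u (z \<bullet> e) *\<^sub>R w) S"
  unfolding real_analytic_on_def
proof
  fix c assume c: "c \<in> S"
  have "real_analytic_on u {c \<bullet> e}" by (rule hol_ext_imp_real_analytic_on) (use u[OF c] in auto)
  then obtain a0 :: "(real \<Rightarrow> nat) \<Rightarrow> real" and r where r: "r > 0" and a0: "\<And>x. x \<in> ball (c \<bullet> e) r \<Longrightarrow>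
      ((\<lambda>\<alpha>. (\<Prod>b\<in>Basis. ((x - c \<bullet> e) \<bullet> b) ^ \<alpha> b) *\<^sub>R a0 \<alpha>) has_sum u x) (Basis \<rightarrow>\<^sub>E UNIV)"
    unfolding real_analytic_on_def by blast
  define A where "A n = a0 (\<lambda>b\<in>{1}. n)" for n
  define \<alpha>e where "\<alpha>e n = (\<lambda>b\<in>Basis. if b = e then n else 0)" for n :: nat
  define T where "T = {\<alpha> \<in> (Basis :: 'a set) \<rightarrow>\<^sub>E (UNIV :: nat set). \<forall>b\<in>Basis - {e}. \<alpha> b = 0}"
  define a where "a \<alpha> = (if \<alpha> \<in> T then A (\<alpha> e) *\<^sub>R w else 0)" for \<alpha>
  have bij: "bij_betw \<alpha>e UNIV T"
  proof (rule bij_betwI[where g = "\<lambda>\<alpha>. \<alpha> e"])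
    show "\<alpha>e (\<alpha> e) = \<alpha>" if "\<alpha> \<in> T" for \<alpha>
    proof
      fix b show "\<alpha>e (\<alpha> e) b = \<alpha> b"
        using that e unfolding \<alpha>e_def T_def by (cases "b \<in> Basis") (auto simp: PiE_def extensional_def)
    qed
  qed (use e in \<open>auto simp: \<alpha>e_def T_def\<close>)
  have "((\<lambda>\<alpha>. (\<Prod>b\<in>Basis. ((z - c) \<bullet> b) ^ \<alpha> b) *\<^sub>R a \<alpha>) has_sum u (z \<bullet> e) *\<^sub>R w) (Basis \<rightarrow>\<^sub>E UNIV)"
    if z: "z \<in> ball c r" for z
  proof -
    have "\<bar>(c - z) \<bullet> e\<bar> < r"
      using Basis_le_norm[OF e, of "c - z"] z by (simp add: dist_norm)
    then have "z \<bullet> e \<in> ball (c \<bullet> e) r" by (simp add: dist_real_def inner_diff_left)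
    from a0[OF this] have "((\<lambda>n. (z \<bullet> e - c \<bullet> e) ^ n *\<^sub>R A n) has_sum u (z \<bullet> e)) UNIV"
      unfolding has_sum_multiindex_real A_def .
    from has_sum_bounded_linear[OF bounded_linear_scaleR_left[of w] this]
    have "((\<lambda>n. ((z - c) \<bullet> e) ^ n *\<^sub>R (A n *\<^sub>R w)) has_sum u (z \<bullet> e) *\<^sub>R w) UNIV"
      by (simp add: o_def inner_diff_left)
    moreover have "(\<Prod>b\<in>Basis. ((z - c) \<bullet> b) ^ \<alpha>e n b) *\<^sub>R a (\<alpha>e n) = ((z - c) \<bullet> e) ^ n *\<^sub>R (A n *\<^sub>R w)" for n
    proof -
      have "(\<Prod>b\<in>Basis. ((z - c) \<bullet> b) ^ \<alpha>e n b) = ((z - c) \<bullet> e) ^ n * (\<Prod>b\<in>Basis - {e}. ((z - c) \<bullet> b) ^ \<alpha>e n b)"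
        using e by (subst prod.remove[of _ e]) (auto simp: \<alpha>e_def)
      also have "(\<Prod>b\<in>Basis - {e}. ((z - c) \<bullet> b) ^ \<alpha>e n b) = 1"
        by (intro prod.neutral) (auto simp: \<alpha>e_def)
      finally show ?thesis
        using bij_betwE[OF bij] e unfolding a_def by (auto simp: \<alpha>e_def)
    qed
    ultimately have "((\<lambda>n. (\<Prod>b\<in>Basis. ((z - c) \<bullet> b) ^ \<alpha>e n b) *\<^sub>R a (\<alpha>e n)) has_sum u (z \<bullet> e) *\<^sub>R w) UNIV"
      by simp
    then have "((\<lambda>\<alpha>. (\<Prod>b\<in>Basis. ((z - c) \<bullet> b) ^ \<alpha> b) *\<^sub>R a \<alpha>) has_sum u (z \<bullet> e) *\<^sub>R w) T"
      using has_sum_reindex_bij_betw[OF bij, of "\<lambda>\<alpha>. (\<Prod>b\<in>Basis. ((z - c) \<bullet> b) ^ \<alpha> b) *\<^sub>R a \<alpha>"] by simp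
    then show ?thesis
      by (subst has_sum_cong_neutral[of T _ _ "\<lambda>\<alpha>. (\<Prod>b\<in>Basis. ((z - c) \<bullet> b) ^ \<alpha> b) *\<^sub>R a \<alpha>"])
        (auto simp: a_def T_def)
  qed
  then show "\<exists>a r. 0 < r \<and> (\<forall>z\<in>ball c r. ((\<lambda>\<alpha>. (\<Prod>b\<in>Basis. ((z - c) \<bullet> b) ^ \<alpha> b) *\<^sub>R a \<alpha>)
      has_sum u (z \<bullet> e) *\<^sub>R w) (Basis \<rightarrow>\<^sub>E UNIV))"
    using r by blast
qed

lemma real_analytic_onE:
  assumes "real_analytic_on f S" "c \<in> S"
  obtains a r where "r > 0" "\<And>x. x \<in> ball c r \<Longrightarrow>
    ((\<lambda>\<alpha>. (\<Prod>b\<in>Basis. ((x - c) \<bullet> b) ^ \<alpha> b) *\<^sub>R a \<alpha>) has_sum f x) (Basis \<rightarrow>\<^sub>E UNIV)"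
proof -
  have "\<exists>a r. r > 0 \<and> (\<forall>x\<in>ball c r.
    ((\<lambda>\<alpha>. (\<Prod>b\<in>Basis. ((x - c) \<bullet> b) ^ \<alpha> b) *\<^sub>R a \<alpha>) has_sum f x) (Basis \<rightarrow>\<^sub>E UNIV))"
    using assms unfolding real_analytic_on_def by blast
  then obtain a r where ar: "r > 0" "\<forall>x\<in>ball c r.
    ((\<lambda>\<alpha>. (\<Prod>b\<in>Basis. ((x - c) \<bullet> b) ^ \<alpha> b) *\<^sub>R a \<alpha>) has_sum f x) (Basis \<rightarrow>\<^sub>E UNIV)"
    by (elim exE conjE)
  show ?thesis by (rule that[OF ar(1) bspec[OF ar(2)]])
qed

lemma real_analytic_on_add:
  assumes "real_analytic_on f S" "real_analytic_on g S"
  shows "real_analytic_on (\<lambda>x. f x + g x) S"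
  unfolding real_analytic_on_def
proof
  fix c assume c: "c \<in> S"
  obtain a r where a: "r > 0" "\<And>x. x \<in> ball c r \<Longrightarrow>
      ((\<lambda>\<alpha>. (\<Prod>b\<in>Basis. ((x - c) \<bullet> b) ^ \<alpha> b) *\<^sub>R a \<alpha>) has_sum f x) (Basis \<rightarrow>\<^sub>E UNIV)"
    using assms(1) c by (rule real_analytic_onE) (rule that)
  obtain b s where b: "s > 0" "\<And>x. x \<in> ball c s \<Longrightarrow>
      ((\<lambda>\<alpha>. (\<Prod>b\<in>Basis. ((x - c) \<bullet> b) ^ \<alpha> b) *\<^sub>R b \<alpha>) has_sum g x) (Basis \<rightarrow>\<^sub>E UNIV)"
    using assms(2) c by (rule real_analytic_onE) (rule that)
  have "((\<lambda>\<alpha>. (\<Prod>b\<in>Basis. ((x - c) \<bullet> b) ^ \<alpha> b) *\<^sub>R (a \<alpha> + b \<alpha>)) has_sum (f x + g x)) (Basis \<rightarrow>\<^sub>E UNIV)"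
    if "x \<in> ball c (min r s)" for x
    unfolding scaleR_add_right by (intro has_sum_add a(2) b(2)) (use that in auto)
  then show "\<exists>a r. 0 < r \<and> (\<forall>x\<in>ball c r. ((\<lambda>\<alpha>. (\<Prod>b\<in>Basis. ((x - c) \<bullet> b) ^ \<alpha> b) *\<^sub>R a \<alpha>)
      has_sum (f x + g x)) (Basis \<rightarrow>\<^sub>E UNIV))"
    using a(1) b(1) by (intro exI[of _ "\<lambda>\<alpha>. a \<alpha> + b \<alpha>"] exI[of _ "min r s"]) simp
qed

lemma real_analytic_on_cong_open:
  assumes f: "real_analytic_on f S" and S: "open S" and eq: "\<And>x. x \<in> S \<Longrightarrow> f x = g x"
  shows "real_analytic_on g S"
  unfolding real_analytic_on_def
proof
  fix c assume c: "c \<in> S"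
  obtain a r where a: "r > 0" "\<And>x. x \<in> ball c r \<Longrightarrow>
      ((\<lambda>\<alpha>. (\<Prod>b\<in>Basis. ((x - c) \<bullet> b) ^ \<alpha> b) *\<^sub>R a \<alpha>) has_sum f x) (Basis \<rightarrow>\<^sub>E UNIV)"
    using f c by (rule real_analytic_onE) (rule that)
  obtain s where s: "s > 0" "ball c s \<subseteq> S" using S c by (rule openE)
  have "((\<lambda>\<alpha>. (\<Prod>b\<in>Basis. ((x - c) \<bullet> b) ^ \<alpha> b) *\<^sub>R a \<alpha>) has_sum g x) (Basis \<rightarrow>\<^sub>E UNIV)"
    if "x \<in> ball c (min r s)" for x
  proof -
    have "x \<in> ball c r" "x \<in> S" using that s(2) by auto
    then show ?thesis using a(2)[of x] eq[of x] by simp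
  qed
  then show "\<exists>a r. 0 < r \<and> (\<forall>x\<in>ball c r. ((\<lambda>\<alpha>. (\<Prod>b\<in>Basis. ((x - c) \<bullet> b) ^ \<alpha> b) *\<^sub>R a \<alpha>)
      has_sum g x) (Basis \<rightarrow>\<^sub>E UNIV))"
    using a(1) s(1) by (intro exI[of _ a] exI[of _ "min r s"]) simp
qed

lemma real_analytic_diffeo_on_ident:
  assumes "open V"
  shows "real_analytic_diffeo_on (\<lambda>x::real. x) V"
proof -
  have id: "real_analytic_on (\<lambda>x::real. x) V"
    by (rule hol_ext_imp_real_analytic_on) (rule hol_ext_ident)
  moreover have "real_analytic_on (inv_into V (\<lambda>x::real. x)) V"
    by (rule real_analytic_on_cong_open[OF id assms]) (metis f_inv_into_f image_ident)
  ultimately show ?thesis unfolding real_analytic_diffeo_on_def using assms by simp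
qed

text \<open>Shears with a translation in the first coordinate already act transitively on vertical
  segments and analytic graphs.\<close>

definition shear :: "real \<Rightarrow> (real \<Rightarrow> real) \<Rightarrow> real \<times> real \<Rightarrow> real \<times> real" where
  "shear a k z = (fst z + a, snd z + k (fst z))"

lemma real_analytic_on_shear:
  assumes "\<And>z. z \<in> U \<Longrightarrow> hol_ext k (fst z)"
  shows "real_analytic_on (shear a k) U"
proof -
  have B: "(1, 0) \<in> (Basis :: (real \<times> real) set)" "(0, 1) \<in> (Basis :: (real \<times> real) set)"
    by (auto simp: Basis_prod_def)
  have "real_analytic_on (\<lambda>z::real \<times> real. (z \<bullet> (1, 0) + a) *\<^sub>R (1::real, 0::real)) U"
    by (rule real_analytic_on_scaleR_inner[OF B(1), where u = "\<lambda>t. t + a"])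
      (intro hol_ext_add hol_ext_ident hol_ext_const)
  moreover have "real_analytic_on (\<lambda>z::real \<times> real. (z \<bullet> (0, 1)) *\<^sub>R (0::real, 1::real)) U"
    by (rule real_analytic_on_scaleR_inner[OF B(2), where u = "\<lambda>t. t"]) (rule hol_ext_ident)
  moreover have "real_analytic_on (\<lambda>z::real \<times> real. k (z \<bullet> (1, 0)) *\<^sub>R (0::real, 1::real)) U"
    by (rule real_analytic_on_scaleR_inner[OF B(1)]) (use assms in \<open>auto simp: inner_prod_def\<close>)
  ultimately have "real_analytic_on (\<lambda>z::real \<times> real. (z \<bullet> (1, 0) + a) *\<^sub>R (1::real, 0::real) +
      ((z \<bullet> (0, 1)) *\<^sub>R (0::real, 1::real) + k (z \<bullet> (1, 0)) *\<^sub>R (0::real, 1::real))) U"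
    by (intro real_analytic_on_add)
  moreover have "(\<lambda>z::real \<times> real. (z \<bullet> (1, 0) + a) *\<^sub>R (1::real, 0::real) +
      ((z \<bullet> (0, 1)) *\<^sub>R (0::real, 1::real) + k (z \<bullet> (1, 0)) *\<^sub>R (0::real, 1::real))) = shear a k"
    by (auto simp: shear_def fun_eq_iff inner_prod_def)
  ultimately show ?thesis by simp
qed

text \<open>The inverse is again a shear, by \<open>- a\<close> and
  \<open>- k (x - a)\<close>.\<close>

lemma real_analytic_diffeo_on_shear:
  assumes U: "open U" and k: "\<And>z. z \<in> U \<Longrightarrow> hol_ext k (fst z)"
  shows "real_analytic_diffeo_on (shear a k) U"
proof -
  have inj: "inj_on (shear a k) U" by (auto simp: inj_on_def shear_def)
  have "continuous_on U (shear a k)"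
  proof (rule continuous_at_imp_continuous_on, rule ballI)
    fix z assume "z \<in> U"
    then have "isCont k (fst z)" using k hol_ext_isCont by blast
    then have kz: "isCont (\<lambda>z. k (fst z)) z"
      by (rule isCont_o2[of z fst k, rotated]) (intro continuous_intros)
    have "shear a k = (\<lambda>z. (fst z + a, snd z + k (fst z)))" by (simp add: fun_eq_iff shear_def)
    then show "isCont (shear a k) z" by (auto intro!: continuous_intros kz)
  qed
  then have op: "open (shear a k ` U)" by (rule invariance_of_domain[OF _ U inj])
  have "real_analytic_on (shear (- a) (\<lambda>x. - k (x - a))) (shear a k ` U)"
  proof (rule real_analytic_on_shear)
    fix w assume "w \<in> shear a k ` U"
    then obtain z where z: "z \<in> U" "fst w - a = fst z" by (auto simp: shear_def)
    have "hol_ext (\<lambda>x. k (x - a)) (fst w)"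
      using hol_ext_shift[of k "fst w" "- a"] k[OF z(1)] z(2) by simp
    then show "hol_ext (\<lambda>x. - k (x - a)) (fst w)" by (rule hol_ext_uminus)
  qed
  moreover have "shear (- a) (\<lambda>x. - k (x - a)) w = inv_into U (shear a k) w" if w: "w \<in> shear a k ` U" for w
  proof -
    obtain z where z: "z \<in> U" "w = shear a k z" using w by blast
    have "shear (- a) (\<lambda>x. - k (x - a)) (shear a k z) = z" by (simp add: shear_def)
    then show ?thesis using z inj by (simp add: inv_into_f_f)
  qed
  ultimately have "real_analytic_on (inv_into U (shear a k)) (shear a k ` U)"
    by (rule real_analytic_on_cong_open[OF _ op])
  then show ?thesis unfolding real_analytic_diffeo_on_def
    using U inj op real_analytic_on_shear[of U k a, OF k] by blast
qed

text \<open>Recentring removes the translation, so the first component of the germ is the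
  identity.\<close>

lemma shear_in_analytic_shear_germs:
  assumes U: "open U" "p \<in> U" and k: "\<And>z. z \<in> U \<Longrightarrow> hol_ext k (fst z)"
  shows "translation (- shear a k p) \<circ> shear a k \<circ> translation p \<in> analytic_shear_germs"
proof -
  define V where "V = (\<lambda>x. x + fst p) -` (fst ` U)"
  have V: "open V" "0 \<in> V"
    unfolding V_def using U by (auto intro!: open_vimage open_image_fst continuous_intros)
  define h where "h x = k (x + fst p) - k (fst p)" for x
  have "hol_ext h x" if x: "x \<in> V" for x
  proof -
    have "hol_ext k (x + fst p)" using x k unfolding V_def by auto
    then have "hol_ext (\<lambda>x. k (x + fst p)) x" by (rule hol_ext_shift)
    then show ?thesis unfolding h_def by (intro hol_ext_diff hol_ext_const)
  qed
  then have "real_analytic_on h V" by (rule hol_ext_imp_real_analytic_on)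
  moreover have "(translation (- shear a k p) \<circ> shear a k \<circ> translation p) z = (fst z, snd z + h (fst z))" for z
    by (simp add: translation_def shear_def h_def prod_eq_iff)
  ultimately show ?thesis
    unfolding analytic_shear_germs_def using V real_analytic_diffeo_on_ident[OF V(1)]
    by (intro CollectI exI[of _ V] exI[of _ "\<lambda>x. x"] exI[of _ h]) (auto simp: h_def)
qed

lemma homogeneous_by_shears:
  assumes "\<And>p q. p \<in> \<gamma> \<Longrightarrow> q \<in> \<gamma> \<Longrightarrow> \<exists>U a k. open U \<and> p \<in> U \<and> (\<forall>z\<in>U. hol_ext k (fst z)) \<and>
    shear a k ` (U \<inter> \<gamma>) = \<gamma> \<inter> shear a k ` U \<and> shear a k p = q"
  shows "homogeneous analytic_shear_germs \<gamma>"
  unfolding homogeneous_def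
proof (intro ballI)
  fix p q assume "p \<in> \<gamma>" "q \<in> \<gamma>"
  then obtain U a k where U: "open U" "p \<in> U" "\<And>z. z \<in> U \<Longrightarrow> hol_ext k (fst z)"
    "shear a k ` (U \<inter> \<gamma>) = \<gamma> \<inter> shear a k ` U" "shear a k p = q"
    using assms by metis
  show "\<exists>U \<psi>. p \<in> U \<and> real_analytic_diffeo_on \<psi> U \<and> \<psi> ` (U \<inter> \<gamma>) = \<gamma> \<inter> \<psi> ` U \<and> \<psi> p = q \<and>
      translation (- q) \<circ> \<psi> \<circ> translation p \<in> analytic_shear_germs"
    using U(2,4,5) real_analytic_diffeo_on_shear[OF U(1,3)] shear_in_analytic_shear_germs[OF U(1-3), of a]
    by (intro exI[of _ U] exI[of _ "shear a k"]) simp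
qed

lemma homogeneous_vertical:
  assumes J: "open J"
  shows "homogeneous analytic_shear_germs {(x, y). x = c \<and> y \<in> J}"
proof (rule homogeneous_by_shears)
  fix p q assume "p \<in> {(x, y). x = c \<and> y \<in> J}" "q \<in> {(x, y). x = c \<and> y \<in> J}"
  then obtain y1 y2 where pq: "p = (c, y1)" "q = (c, y2)" "y1 \<in> J" "y2 \<in> J" by auto
  define b where "b = y2 - y1"
  \<comment> \<open>Keeping only heights that stay in \<open>J\<close> after the translation makes
    \<open>\<gamma>\<close> correspond to itself exactly, in both directions.\<close>
  define U where "U = (UNIV :: real set) \<times> (J \<inter> (\<lambda>y. y + b) -` J)"
  have "open U" unfolding U_def using J
    by (intro open_Times open_Int open_vimage continuous_intros) auto
  moreover have "shear 0 (\<lambda>_. b) ` (U \<inter> {(x, y). x = c \<and> y \<in> J}) = {(x, y). x = c \<and> y \<in> J} \<inter> shear 0 (\<lambda>_. b) ` U"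
    unfolding U_def shear_def by (auto simp: image_iff)
  ultimately show "\<exists>U a k. open U \<and> p \<in> U \<and> (\<forall>z\<in>U. hol_ext k (fst z)) \<and>
    shear a k ` (U \<inter> {(x, y). x = c \<and> y \<in> J}) = {(x, y). x = c \<and> y \<in> J} \<inter> shear a k ` U \<and> shear a k p = q"
    using pq by (intro exI[of _ U] exI[of _ 0] exI[of _ "\<lambda>_. b"])
      (auto simp: U_def shear_def b_def hol_ext_const)
qed

lemma homogeneous_graph:
  assumes I: "open I" and f: "\<And>x. x \<in> I \<Longrightarrow> hol_ext f x"
  shows "homogeneous analytic_shear_germs {(x, y). x \<in> I \<and> y = f x}"
proof (rule homogeneous_by_shears)
  fix p q assume "p \<in> {(x, y). x \<in> I \<and> y = f x}" "q \<in> {(x, y). x \<in> I \<and> y = f x}"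
  then obtain x1 x2 where pq: "p = (x1, f x1)" "q = (x2, f x2)" "x1 \<in> I" "x2 \<in> I" by auto
  define a where "a = x2 - x1"
  \<comment> \<open>The shear takes \<open>(x, f x)\<close> to \<open>(x + a, f (x + a))\<close>:
    the graph slides along itself.\<close>
  define k where "k x = f (x + a) - f x" for x
  define U where "U = (I \<inter> (\<lambda>x. x + a) -` I) \<times> (UNIV :: real set)"
  have "open U" unfolding U_def using I
    by (intro open_Times open_Int open_vimage continuous_intros) auto
  moreover have "hol_ext k (fst z)" if "z \<in> U" for z
  proof -
    have "hol_ext f (fst z)" "hol_ext f (fst z + a)" using that f unfolding U_def by auto
    then show ?thesis unfolding k_def by (intro hol_ext_diff hol_ext_shift)
  qed
  moreover have "shear a k ` (U \<inter> {(x, y). x \<in> I \<and> y = f x}) = {(x, y). x \<in> I \<and> y = f x} \<inter> shear a k ` U"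
    unfolding U_def shear_def k_def by (auto simp: image_iff)
  ultimately show "\<exists>U a k. open U \<and> p \<in> U \<and> (\<forall>z\<in>U. hol_ext k (fst z)) \<and>
    shear a k ` (U \<inter> {(x, y). x \<in> I \<and> y = f x}) = {(x, y). x \<in> I \<and> y = f x} \<inter> shear a k ` U \<and> shear a k p = q"
    using pq by (intro exI[of _ U] exI[of _ a] exI[of _ k])
      (auto simp: U_def shear_def a_def k_def)
qed

section \<open>Homogeneous curves are vertical or graphs\<close>

definition local_graph :: "(real \<times> real) set \<Rightarrow> real \<times> real \<Rightarrow> bool" where
  "local_graph \<gamma> p \<longleftrightarrow> (\<exists>W e f f'. open W \<and> p \<in> W \<and> e > 0 \<and>
     (\<forall>x\<in>ball (fst p) e. (f has_real_derivative f' x) (at x)) \<and> continuous_on (ball (fst p) e) f' \<and>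
     \<gamma> \<inter> W = (\<lambda>x. (x, f x)) ` ball (fst p) e)"

text \<open>The last clause says that the arc is embedded, as an open subset of \<open>\<gamma>\<close>.\<close>

definition C1_arc :: "(real \<times> real) set \<Rightarrow> real set \<Rightarrow> (real \<Rightarrow> real) \<Rightarrow> (real \<Rightarrow> real) \<Rightarrow>
    (real \<Rightarrow> real) \<Rightarrow> (real \<Rightarrow> real) \<Rightarrow> bool" where
  "C1_arc \<gamma> S c d c' d' \<longleftrightarrow> open S \<and>
     (\<forall>s\<in>S. (c has_real_derivative c' s) (at s) \<and> (d has_real_derivative d' s) (at s)) \<and>
     continuous_on S c' \<and> continuous_on S d' \<and>
     (\<forall>T. open T \<longrightarrow> T \<subseteq> S \<longrightarrow> (\<exists>W. open W \<and> \<gamma> \<inter> W = (\<lambda>s. (c s, d s)) ` T))"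

lemma C1_arcD:
  assumes "C1_arc \<gamma> S c d c' d'"
  shows "open S" "\<And>s. s \<in> S \<Longrightarrow> (c has_real_derivative c' s) (at s)"
    "\<And>s. s \<in> S \<Longrightarrow> (d has_real_derivative d' s) (at s)"
    "continuous_on S c'" "continuous_on S d'"
    "\<And>T. open T \<Longrightarrow> T \<subseteq> S \<Longrightarrow> \<exists>W. open W \<and> \<gamma> \<inter> W = (\<lambda>s. (c s, d s)) ` T"
  using assms unfolding C1_arc_def by blast+

lemma C1_local_inverse:
  fixes c :: "real \<Rightarrow> real"
  assumes S: "open S" "s1 \<in> S" and c: "\<And>s. s \<in> S \<Longrightarrow> (c has_real_derivative c' s) (at s)"
    and c': "continuous_on S c'" "c' s1 \<noteq> 0"
  obtains B e g where "open B" "s1 \<in> B" "B \<subseteq> S" "e > 0"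
    "\<And>s. s \<in> B \<Longrightarrow> g (c s) = s" "\<And>y. y \<in> ball (c s1) e \<Longrightarrow> g y \<in> B \<and> c (g y) = y"
    "\<And>y. y \<in> ball (c s1) e \<Longrightarrow> c' (g y) \<noteq> 0"
    "\<And>y. y \<in> ball (c s1) e \<Longrightarrow> (g has_real_derivative inverse (c' (g y))) (at y)"
proof -
  have "isCont c' s1" using c'(1) S by (simp add: continuous_on_eq_continuous_at)
  then obtain d0 where d0: "d0 > 0" "\<And>s. dist s1 s < d0 \<Longrightarrow> c' s \<noteq> 0"
    using continuous_at_avoid[of s1 c' 0] c'(2) by blast
  obtain d1 where d1: "d1 > 0" "ball s1 d1 \<subseteq> S" using S by (rule openE)
  define B where "B = ball s1 (min d0 d1)"
  have B: "open B" "s1 \<in> B" "B \<subseteq> S" "connected B" "\<And>s. s \<in> B \<Longrightarrow> c' s \<noteq> 0"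
    using d0 d1 unfolding B_def by auto
  have cB: "(c has_real_derivative c' s) (at s)" if "s \<in> B" for s using c B(3) that by blast
  have contc: "isCont c s" if "s \<in> B" for s using cB[OF that] by (rule DERIV_isCont)
  have neq: "c s \<noteq> c t" if st: "s \<in> B" "t \<in> B" "s < t" for s t
  proof -
    have "{s..t} \<subseteq> B" using st unfolding B_def by (auto simp: dist_real_def abs_if split: if_splits)
    then obtain z where z: "s < z" "z < t" "c t - c s = (t - s) * c' z" "z \<in> B"
      using MVT2[OF st(3), of c c'] cB by (metis atLeastAtMost_iff less_imp_le subset_eq)
    then show ?thesis using B(5)[of z] st(3) by auto
  qed
  have inj: "inj_on c B" by (rule linorder_inj_onI) (use neq in auto)
  define g where "g = inv_into B c"
  have gc: "g (c s) = s" if "s \<in> B" for s unfolding g_def using inj that by (simp add: inv_into_f_f)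
  have "open (c ` B)"
    by (rule invariance_of_domain[OF _ B(1) inj]) (use contc in \<open>auto intro: continuous_at_imp_continuous_on\<close>)
  then obtain e where e: "e > 0" "ball (c s1) e \<subseteq> c ` B" using B(2) by (metis image_eqI openE)
  have gB: "g y \<in> B \<and> c (g y) = y" if "y \<in> ball (c s1) e" for y
    using e(2) that gc by auto
  have gcont: "isCont g y" if y: "y \<in> ball (c s1) e" for y
  proof -
    obtain r where r: "r > 0" "cball (g y) r \<subseteq> B" using gB[OF y] B(1) open_contains_cball by blast
    have "isCont g (c (g y))"
      by (rule isCont_inverse_function[OF r(1)])
        (use r(2) gc contc in \<open>auto simp: subset_eq dist_real_def abs_minus_commute\<close>)
    then show ?thesis using gB[OF y] by simp
  qed
  have gd: "(g has_real_derivative inverse (c' (g y))) (at y)" if y: "y \<in> ball (c s1) e" for y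
  proof (rule DERIV_inverse_function[where f = c and a = "c s1 - e" and b = "c s1 + e"])
    show "(c has_real_derivative c' (g y)) (at (g y))" using cB gB[OF y] by blast
    show "c' (g y) \<noteq> 0" using B(5) gB[OF y] by blast
    show "isCont g y" by (rule gcont[OF y])
    show "c (g z) = z" if "c s1 - e < z" "z < c s1 + e" for z
      using gB[of z] that by (auto simp: dist_real_def)
  qed (use y in \<open>auto simp: dist_real_def\<close>)
  show ?thesis
    by (rule that[of B e g]) (use B e(1) gc gB gd in blast)+
qed

lemma C1_arc_local_graph:
  assumes arc: "C1_arc \<gamma> S c d c' d'" and s1: "s1 \<in> S" "c' s1 \<noteq> 0"
  shows "local_graph \<gamma> (c s1, d s1)"
proof -
  note S = C1_arcD(1)[OF arc] and c = C1_arcD(2)[OF arc] and d = C1_arcD(3)[OF arc]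
    and c' = C1_arcD(4)[OF arc] and d' = C1_arcD(5)[OF arc] and sub = C1_arcD(6)[OF arc]
  obtain B e g where g: "open B" "s1 \<in> B" "B \<subseteq> S" "e > 0"
    "\<And>s. s \<in> B \<Longrightarrow> g (c s) = s" "\<And>y. y \<in> ball (c s1) e \<Longrightarrow> g y \<in> B \<and> c (g y) = y"
    "\<And>y. y \<in> ball (c s1) e \<Longrightarrow> c' (g y) \<noteq> 0"
    "\<And>y. y \<in> ball (c s1) e \<Longrightarrow> (g has_real_derivative inverse (c' (g y))) (at y)"
    by (rule C1_local_inverse[OF S s1(1) c c' s1(2)]) (assumption | rule that)+
  \<comment> \<open>Cutting down to this preimage makes the first coordinates of the sub-arc fill
    the whole ball.\<close>
  define T where "T = B \<inter> c -` ball (c s1) e"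
  have contc: "continuous_on B c"
    using c g(3) by (intro continuous_at_imp_continuous_on) (blast intro: DERIV_isCont)
  have T: "open T" "T \<subseteq> S" unfolding T_def using continuous_open_preimage[OF contc g(1) open_ball] g(3) by auto
  obtain W where W: "open W" "\<gamma> \<inter> W = (\<lambda>s. (c s, d s)) ` T" using sub[OF T] by blast
  define f where "f y = d (g y)" for y
  have im: "(\<lambda>s. (c s, d s)) ` T = (\<lambda>x. (x, f x)) ` ball (c s1) e"
  proof (intro equalityI subsetI)
    fix w assume "w \<in> (\<lambda>s. (c s, d s)) ` T"
    then obtain s where "s \<in> B" "c s \<in> ball (c s1) e" "w = (c s, d s)" unfolding T_def by blast
    then show "w \<in> (\<lambda>x. (x, f x)) ` ball (c s1) e"
      using g(5)[of s] unfolding f_def by (intro image_eqI[of _ _ "c s"]) auto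
  next
    fix w assume "w \<in> (\<lambda>x. (x, f x)) ` ball (c s1) e"
    then obtain y where y: "y \<in> ball (c s1) e" "w = (y, f y)" by blast
    then show "w \<in> (\<lambda>s. (c s, d s)) ` T"
      using g(6)[OF y(1)] unfolding f_def T_def by (intro image_eqI[of _ _ "g y"]) auto
  qed
  have s1T: "s1 \<in> T" unfolding T_def using g(2,4) by simp
  have df: "(f has_real_derivative d' (g y) * inverse (c' (g y))) (at y)" if y: "y \<in> ball (c s1) e" for y
  proof -
    have "g y \<in> S" using g(6)[OF y] g(3) by blast
    then show ?thesis unfolding f_def by (rule DERIV_chain2[OF d g(8)[OF y]])
  qed
  have gcont: "continuous_on (ball (c s1) e) g"
    by (intro continuous_at_imp_continuous_on ballI DERIV_isCont[OF g(8)])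
  have gS: "g ` ball (c s1) e \<subseteq> S" using g(3,6) by blast
  have "continuous_on (ball (c s1) e) (\<lambda>y. d' (g y) * inverse (c' (g y)))"
    by (intro continuous_on_mult continuous_on_inverse continuous_on_compose2[OF d' gcont gS]
        continuous_on_compose2[OF c' gcont gS]) (use g(7) in blast)
  moreover have "(c s1, d s1) \<in> W" using W(2) s1T by blast
  ultimately show ?thesis
    unfolding local_graph_def fst_conv using W(1) W(2)[unfolded im] g(4) df
    by (intro exI[of _ W] exI[of _ e] exI[of _ f] exI[of _ "\<lambda>y. d' (g y) * inverse (c' (g y))"]) simp
qed

text \<open>The arc is the inverse chart restricted to the axis \<open>snd z = 0\<close>. Pulling
  back \<open>T \<times> UNIV\<close> under the chart cuts out exactly the sub-arc over
  \<open>T\<close>.\<close>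

lemma smooth_curve_arc:
  assumes "smooth_curve \<gamma>" "p \<in> \<gamma>"
  obtains r s0 c d c' d' where "r > 0" "C1_arc \<gamma> (ball s0 r) c d c' d'" "p = (c s0, d s0)"
    "inj_on (\<lambda>s. (c s, d s)) (ball s0 r)"
proof -
  obtain U and \<Phi> :: "real \<times> real \<Rightarrow> real \<times> real" where U: "p \<in> U" "smooth_diffeo_on \<Phi> U"
    "\<Phi> ` (U \<inter> \<gamma>) = {z \<in> \<Phi> ` U. snd z = 0}"
    using assms unfolding smooth_curve_def by blast
  define \<Psi> where "\<Psi> = inv_into U \<Phi>"
  have D: "open U" "inj_on \<Phi> U" "open (\<Phi> ` U)" "Ck_on 0 \<Phi> U" "Ck_on (Suc 0) \<Psi> (\<Phi> ` U)"
    using U(2) unfolding smooth_diffeo_on_def smooth_on_def \<Psi>_def by blast+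
  have cont: "continuous_on U \<Phi>" using D(4) by simp
  obtain F' where F0: "\<forall>x\<in>\<Phi> ` U. (\<Psi> has_derivative F' x) (at x)"
    "\<forall>v. continuous_on (\<Phi> ` U) (\<lambda>x. F' x v)"
    using D(5) unfolding Ck_on.simps by blast
  note F' = bspec[OF F0(1)] spec[OF F0(2)]
  have \<Psi>\<Phi>: "\<Psi> (\<Phi> z) = z" if "z \<in> U" for z unfolding \<Psi>_def using D(2) that by (simp add: inv_into_f_f)
  define s0 where "s0 = fst (\<Phi> p)"
  have "\<Phi> p \<in> {z \<in> \<Phi> ` U. snd z = 0}" using U(1,3) assms(2) by blast
  then have p0: "\<Phi> p = (s0, 0)" "(s0, 0) \<in> \<Phi> ` U" unfolding s0_def by (auto simp: prod_eq_iff)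
  define S where "S = (\<lambda>s. (s, 0)) -` (\<Phi> ` U)"
  have "open S" "s0 \<in> S" unfolding S_def using D(3) p0(2) by (auto intro!: open_vimage continuous_intros)
  then obtain r where r: "r > 0" "ball s0 r \<subseteq> S" by (rule openE)
  have rS: "(s, 0) \<in> \<Phi> ` U" if "s \<in> ball s0 r" for s using r(2) that unfolding S_def by auto
  define c where "c = (\<lambda>s. fst (\<Psi> (s, 0)))"
  define d where "d = (\<lambda>s. snd (\<Psi> (s, 0)))"
  define c' where "c' = (\<lambda>s. fst (F' (s, 0) (1, 0)))"
  define d' where "d' = (\<lambda>s. snd (F' (s, 0) (1, 0)))"
  have cd: "(c s, d s) = \<Psi> (s, 0)" for s unfolding c_def d_def by simp
  have der: "(c has_real_derivative c' s) (at s)" "(d has_real_derivative d' s) (at s)"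
    if s: "s \<in> ball s0 r" for s
  proof -
    have h: "((\<lambda>s. (s, 0)) has_derivative (\<lambda>h. (h, 0))) (at s)"
      by (intro has_derivative_Pair has_derivative_ident has_derivative_const)
    have "((\<lambda>s. \<Psi> (s, 0)) has_derivative (\<lambda>h. F' (s, 0) (h, 0))) (at s)"
      by (rule has_derivative_compose[OF h F'(1)[OF rS[OF s]]])
    then have "(c has_derivative (\<lambda>h. fst (F' (s, 0) (h, 0)))) (at s)"
      "(d has_derivative (\<lambda>h. snd (F' (s, 0) (h, 0)))) (at s)"
      unfolding c_def d_def by (rule has_derivative_fst, rule has_derivative_snd)
    moreover have "fst (F' (s, 0) (h, 0)) = c' s * h" "snd (F' (s, 0) (h, 0)) = d' s * h" for h
      using linear_scale[OF has_derivative_linear[OF F'(1)[OF rS[OF s]]], of h "(1, 0)"]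
      unfolding c'_def d'_def by simp_all
    ultimately show "(c has_real_derivative c' s) (at s)" "(d has_real_derivative d' s) (at s)"
      unfolding has_field_derivative_def by simp_all
  qed
  have inc: "continuous_on (ball s0 r) (\<lambda>s. F' (s, 0) (1, 0))"
    by (rule continuous_on_compose2[OF F'(2)]) (use rS in \<open>auto intro!: continuous_intros\<close>)
  have sub: "\<exists>W. open W \<and> \<gamma> \<inter> W = (\<lambda>s. (c s, d s)) ` T" if T: "open T" "T \<subseteq> ball s0 r" for T
  proof (intro exI conjI)
    define W where "W = U \<inter> \<Phi> -` (T \<times> UNIV)"
    show "open W" unfolding W_def
      by (rule continuous_open_preimage[OF cont D(1)]) (intro open_Times T open_UNIV)
    show "\<gamma> \<inter> W = (\<lambda>s. (c s, d s)) ` T"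
    proof (intro equalityI subsetI)
      fix z assume z: "z \<in> \<gamma> \<inter> W"
      then have "\<Phi> z \<in> \<Phi> ` (U \<inter> \<gamma>)" unfolding W_def by blast
      then have "snd (\<Phi> z) = 0" using U(3) by blast
      then have "\<Phi> z = (fst (\<Phi> z), 0)" by (simp add: prod_eq_iff)
      then have "z = \<Psi> (fst (\<Phi> z), 0)" using \<Psi>\<Phi>[of z] z unfolding W_def by simp
      then show "z \<in> (\<lambda>s. (c s, d s)) ` T"
        unfolding cd using z unfolding W_def by (intro image_eqI[of _ _ "fst (\<Phi> z)"]) auto
    next
      fix z assume "z \<in> (\<lambda>s. (c s, d s)) ` T"
      then obtain s where s: "s \<in> T" "z = \<Psi> (s, 0)" unfolding cd by blast
      have "(s, 0) \<in> \<Phi> ` U" using rS T(2) s(1) by blast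
      then have "(s, 0) \<in> \<Phi> ` (U \<inter> \<gamma>)" unfolding U(3) by simp
      then obtain w where w: "w \<in> U \<inter> \<gamma>" "\<Phi> w = (s, 0)" unfolding image_iff by metis
      then have "z = w" using s(2) \<Psi>\<Phi>[of w] by simp
      then show "z \<in> \<gamma> \<inter> W" using w s(1) unfolding W_def by auto
    qed
  qed
  show ?thesis
  proof (rule that[OF r(1)])
    show "C1_arc \<gamma> (ball s0 r) c d c' d'"
      unfolding C1_arc_def
    proof (intro conjI ballI allI impI)
      show "continuous_on (ball s0 r) c'" "continuous_on (ball s0 r) d'"
        unfolding c'_def d'_def by (intro continuous_on_fst continuous_on_snd inc)+
    qed (rule open_ball der sub; assumption)+
    show "p = (c s0, d s0)" unfolding cd using \<Psi>\<Phi>[OF U(1)] p0(1) by simp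
    show "inj_on (\<lambda>s. (c s, d s)) (ball s0 r)"
    proof (rule inj_onI)
      fix s t assume st: "s \<in> ball s0 r" "t \<in> ball s0 r" "(c s, d s) = (c t, d t)"
      then have "\<Psi> (s, 0) = \<Psi> (t, 0)" unfolding cd by simp
      then have "\<Phi> (\<Psi> (s, 0)) = \<Phi> (\<Psi> (t, 0))" by simp
      then have "(s, 0::real) = (t, 0)"
        using rS[OF st(1)] rS[OF st(2)] unfolding \<Psi>_def by (simp add: f_inv_into_f)
      then show "s = t" by simp
    qed
  qed
qed

text \<open>A point of an arc with \<open>c' s \<noteq> 0\<close> would be a local graph point, so
  \<open>c\<close> is locally constant, and connectedness makes the abscissa constant on
  \<open>\<gamma>\<close>. The second coordinate is then injective on each arc, which makes its
  image open.\<close>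

lemma vertical_if_no_local_graph:
  assumes sm: "smooth_curve \<gamma>" and con: "connected \<gamma>" and ne: "\<gamma> \<noteq> {}"
    and no: "\<And>p. p \<in> \<gamma> \<Longrightarrow> \<not> local_graph \<gamma> p"
  shows "\<exists>c J. open J \<and> is_interval J \<and> \<gamma> = {(x, y). x = c \<and> y \<in> J}"
proof -
  have loc: "\<exists>W T. open W \<and> p \<in> W \<and> (\<forall>z\<in>\<gamma> \<inter> W. fst z = fst p) \<and>
      open T \<and> snd p \<in> T \<and> T \<subseteq> snd ` \<gamma>" if p: "p \<in> \<gamma>" for p
  proof -
    obtain r s0 c d c' d' where r: "r > 0" "C1_arc \<gamma> (ball s0 r) c d c' d'" "p = (c s0, d s0)"
      "inj_on (\<lambda>s. (c s, d s)) (ball s0 r)"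
      by (rule smooth_curve_arc[OF sm p])
    obtain W where W: "open W" "\<gamma> \<inter> W = (\<lambda>s. (c s, d s)) ` ball s0 r"
      using C1_arcD(6)[OF r(2) open_ball subset_refl] by blast
    note der = C1_arcD(2,3)[OF r(2)]
    have c0: "c' s = 0" if "s \<in> ball s0 r" for s
    proof (rule ccontr)
      assume "c' s \<noteq> 0"
      then have "local_graph \<gamma> (c s, d s)" by (rule C1_arc_local_graph[OF r(2) that])
      moreover have "(c s, d s) \<in> \<gamma>" using W(2) that by blast
      ultimately show False using no by blast
    qed
    have "(c has_real_derivative 0) (at s within ball s0 r)" if "s \<in> ball s0 r" for s
      using has_field_derivative_at_within[OF der(1)[OF that]] c0[OF that] by simp
    then obtain k where k: "\<forall>s\<in>ball s0 r. c s = k"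
      using has_field_derivative_zero_constant[OF convex_ball, of s0 r c] by blast
    have cc: "c s = c s0" if "s \<in> ball s0 r" for s using k that r(1) by simp
    have injd: "inj_on d (ball s0 r)"
      using r(4) cc by (simp add: inj_on_def)
    have "open (d ` ball s0 r)"
      by (rule invariance_of_domain[OF _ open_ball injd])
        (intro continuous_at_imp_continuous_on ballI DERIV_isCont[OF der(2)])
    moreover have "snd p \<in> d ` ball s0 r" using r(1,3) by simp
    moreover have "d ` ball s0 r \<subseteq> snd ` \<gamma>"
    proof
      fix y assume "y \<in> d ` ball s0 r"
      then obtain s where s: "s \<in> ball s0 r" "y = d s" by blast
      then have "(c s, d s) \<in> \<gamma>" using W(2) by blast
      then show "y \<in> snd ` \<gamma>" using s(2) by force
    qed
    moreover have "p \<in> W" using W(2) r(1,3) by fastforce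
    moreover have "\<forall>z\<in>\<gamma> \<inter> W. fst z = fst p" unfolding W(2) using cc r(3) by auto
    ultimately show ?thesis using W(1) by blast
  qed
  have "fst constant_on \<gamma>"
  proof (rule locally_constant_imp_constant[OF con])
    fix p assume p: "p \<in> \<gamma>"
    obtain W where W: "open W" "p \<in> W" "\<forall>z\<in>\<gamma> \<inter> W. fst z = fst p"
      using loc[OF p] by (elim exE conjE)
    then show "\<exists>T. openin (top_of_set \<gamma>) T \<and> p \<in> T \<and> (\<forall>x\<in>T. fst x = fst p)"
      using p openin_open_Int[OF W(1), of \<gamma>] by (intro exI[of _ "\<gamma> \<inter> W"]) blast
  qed
  then obtain c where c: "\<And>z. z \<in> \<gamma> \<Longrightarrow> fst z = c" unfolding constant_on_def by blast
  define J where "J = snd ` \<gamma>"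
  have "open J"
    unfolding open_subopen[of J]
  proof
    fix y assume "y \<in> J"
    then obtain p where p: "p \<in> \<gamma>" "y = snd p" unfolding J_def by blast
    obtain T where "open T" "snd p \<in> T" "T \<subseteq> snd ` \<gamma>" using loc[OF p(1)] by (elim exE conjE)
    then show "\<exists>T. open T \<and> y \<in> T \<and> T \<subseteq> J" using p(2) unfolding J_def by blast
  qed
  moreover have "is_interval J"
    unfolding J_def is_interval_connected_1
    by (intro connected_continuous_image con continuous_intros)
  moreover have "\<gamma> = {(x, y). x = c \<and> y \<in> J}"
    using c unfolding J_def by (force simp: image_iff)
  ultimately show ?thesis by blast
qed

section \<open>Transport of graph points by shears\<close>

text \<open>The chain rule for the analytic inverse gives \<open>E * D = 1\<close>; an injection
  such as the cube is excluded at \<open>0\<close> because its inverse is not analytic.\<close>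

lemma real_analytic_diffeo_deriv:
  fixes \<phi> :: "real \<Rightarrow> real"
  assumes "real_analytic_diffeo_on \<phi> V" "x \<in> V"
  shows "\<exists>D. D \<noteq> 0 \<and> (\<phi> has_real_derivative D) (at x)"
proof -
  have V: "open V" "real_analytic_on \<phi> V" "inj_on \<phi> V" "real_analytic_on (inv_into V \<phi>) (\<phi> ` V)"
    using assms(1) unfolding real_analytic_diffeo_on_def by auto
  have "hol_ext \<phi> x" using V(2) assms(2) by (rule real_analytic_on_imp_hol_ext)
  then obtain D where D: "(\<phi> has_real_derivative D) (at x)"
    by (metis hol_ext_C1 abs_zero diff_self)
  have "hol_ext (inv_into V \<phi>) (\<phi> x)"
    by (rule real_analytic_on_imp_hol_ext[OF V(4)]) (use assms(2) in auto)
  then obtain E where E: "(inv_into V \<phi> has_real_derivative E) (at (\<phi> x))"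
    by (metis hol_ext_C1 abs_zero diff_self)
  have "((\<lambda>x. inv_into V \<phi> (\<phi> x)) has_real_derivative E * D) (at x)"
    by (rule DERIV_chain2[OF E D])
  moreover have "\<forall>\<^sub>F y in nhds x. inv_into V \<phi> (\<phi> y) = y"
    using eventually_nhds_in_open[OF V(1) assms(2)]
    by eventually_elim (simp add: inv_into_f_f[OF V(3)])
  ultimately have "((\<lambda>x. x) has_real_derivative E * D) (at x)"
    by (subst (asm) DERIV_cong_ev[OF refl _ refl]) auto
  then have "E * D = 1" using DERIV_unique DERIV_ident by blast
  then have "D \<noteq> 0" by auto
  then show ?thesis using D by blast
qed

lemma homogeneous_shear_germ:
  assumes hom: "homogeneous analytic_shear_germs \<gamma>" and pq: "p \<in> \<gamma>" "q \<in> \<gamma>"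
  obtains N \<phi> h D where "open N" "p \<in> N" "hol_ext \<phi> 0" "hol_ext h 0" "\<phi> 0 = 0" "h 0 = 0"
    "(\<phi> has_real_derivative D) (at 0)" "D \<noteq> 0"
    "inj_on (\<lambda>z. (fst q + \<phi> (fst z - fst p), snd q + (snd z - snd p) + h (fst z - fst p))) N"
    "\<And>z. z \<in> N \<Longrightarrow> (fst q + \<phi> (fst z - fst p), snd q + (snd z - snd p) + h (fst z - fst p)) \<in> \<gamma> \<longleftrightarrow> z \<in> \<gamma>"
proof -
  obtain U \<psi> where U: "p \<in> U" "real_analytic_diffeo_on \<psi> U" "\<psi> ` (U \<inter> \<gamma>) = \<gamma> \<inter> \<psi> ` U"
    "translation (- q) \<circ> \<psi> \<circ> translation p \<in> analytic_shear_germs"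
    using hom pq unfolding homogeneous_def by blast
  have U': "open U" "inj_on \<psi> U" using U(2) unfolding real_analytic_diffeo_on_def by auto
  obtain V \<phi> h where V: "0 \<in> V" "real_analytic_diffeo_on \<phi> V" "\<phi> 0 = 0"
    "real_analytic_on h V" "h 0 = 0"
    "\<forall>\<^sub>F z in nhds 0. (translation (- q) \<circ> \<psi> \<circ> translation p) z = (\<phi> (fst z), snd z + h (fst z))"
    using U(4) unfolding analytic_shear_germs_def by blast
  obtain r where r: "r > 0"
    "\<And>z. dist z 0 < r \<Longrightarrow> (translation (- q) \<circ> \<psi> \<circ> translation p) z = (\<phi> (fst z), snd z + h (fst z))"
    using V(6) unfolding eventually_nhds_metric by blast
  define N where "N = U \<inter> ball p r"
  define \<sigma> where "\<sigma> = (\<lambda>z. (fst q + \<phi> (fst z - fst p), snd q + (snd z - snd p) + h (fst z - fst p)))"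
  have \<sigma>: "\<psi> z = \<sigma> z" if "z \<in> N" for z
  proof -
    have "dist (z - p) 0 < r" using that unfolding N_def by (simp add: dist_norm norm_minus_commute)
    from r(2)[OF this] have "\<psi> z - q = (\<phi> (fst (z - p)), snd (z - p) + h (fst (z - p)))"
      by (simp add: translation_def)
    then show ?thesis unfolding \<sigma>_def by (simp add: prod_eq_iff algebra_simps)
  qed
  have NU: "N \<subseteq> U" unfolding N_def by simp
  obtain D where D: "D \<noteq> 0" "(\<phi> has_real_derivative D) (at 0)"
    using real_analytic_diffeo_deriv[OF V(2,1)] by blast
  show ?thesis
  proof (rule that)
    show "open N" "p \<in> N" unfolding N_def using U'(1) U(1) r(1) by auto
    show "hol_ext \<phi> 0"
      using V(1,2) unfolding real_analytic_diffeo_on_def by (blast intro: real_analytic_on_imp_hol_ext)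
    show "hol_ext h 0" using V(4,1) by (rule real_analytic_on_imp_hol_ext)
    show "inj_on (\<lambda>z. (fst q + \<phi> (fst z - fst p), snd q + (snd z - snd p) + h (fst z - fst p))) N"
      unfolding \<sigma>_def[symmetric] using inj_on_subset[OF U'(2) NU] \<sigma> by (simp add: inj_on_def)
    fix z assume z: "z \<in> N"
    \<comment> \<open>Injectivity on \<open>U\<close> is needed for one direction: the point of
      \<open>U \<inter> \<gamma>\<close> with image \<open>\<psi> z\<close> must be \<open>z\<close>
      itself.\<close>
    have "\<psi> z \<in> \<gamma> \<longleftrightarrow> z \<in> \<gamma>"
    proof
      assume "\<psi> z \<in> \<gamma>"
      then have "\<psi> z \<in> \<psi> ` (U \<inter> \<gamma>)" unfolding U(3) using z NU by blast
      then obtain w where w: "w \<in> U" "w \<in> \<gamma>" "\<psi> z = \<psi> w" by blast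
      then have "z = w" using inj_onD[OF U'(2) w(3)] z NU by blast
      then show "z \<in> \<gamma>" using w(2) by simp
    next
      assume "z \<in> \<gamma>"
      then have "\<psi> z \<in> \<psi> ` (U \<inter> \<gamma>)" using z NU by blast
      then show "\<psi> z \<in> \<gamma>" unfolding U(3) by blast
    qed
    then show "(fst q + \<phi> (fst z - fst p), snd q + (snd z - snd p) + h (fst z - fst p)) \<in> \<gamma> \<longleftrightarrow> z \<in> \<gamma>"
      using \<sigma>[OF z] unfolding \<sigma>_def by simp
  qed (use V(3,5) D in auto)
qed

text \<open>
  The image of a graph under a shear is an arc whose first coordinate has non-zero derivative.
\<close>

lemma local_graph_transfer:
  assumes hom: "homogeneous analytic_shear_germs \<gamma>" and pq: "p \<in> \<gamma>" "q \<in> \<gamma>"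
    and lg: "local_graph \<gamma> p"
  shows "local_graph \<gamma> q"
proof -
  obtain N \<phi> h D where N: "open N" "p \<in> N" "hol_ext \<phi> 0" "hol_ext h 0" "\<phi> 0 = 0" "h 0 = 0"
    "(\<phi> has_real_derivative D) (at 0)" "D \<noteq> 0"
    "inj_on (\<lambda>z. (fst q + \<phi> (fst z - fst p), snd q + (snd z - snd p) + h (fst z - fst p))) N"
    "\<And>z. z \<in> N \<Longrightarrow> (fst q + \<phi> (fst z - fst p), snd q + (snd z - snd p) + h (fst z - fst p)) \<in> \<gamma> \<longleftrightarrow> z \<in> \<gamma>"
    by (rule homogeneous_shear_germ[OF hom pq]) (rule that)
  define \<sigma> where "\<sigma> = (\<lambda>z. (fst q + \<phi> (fst z - fst p), snd q + (snd z - snd p) + h (fst z - fst p)))"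
  obtain W e f f' where W: "open W" "p \<in> W" "e > 0"
     "\<forall>x\<in>ball (fst p) e. (f has_real_derivative f' x) (at x)" "continuous_on (ball (fst p) e) f'"
     "\<gamma> \<inter> W = (\<lambda>x. (x, f x)) ` ball (fst p) e"
    using lg unfolding local_graph_def by blast
  obtain r1 \<phi>' where \<phi>': "r1 > 0" "\<And>x. \<bar>x - 0\<bar> < r1 \<Longrightarrow> (\<phi> has_real_derivative \<phi>' x) (at x)"
    "continuous_on {0 - r1<..<0 + r1} \<phi>'"
    using hol_ext_C1[OF N(3)] by metis
  obtain r2 h' where h': "r2 > 0" "\<And>x. \<bar>x - 0\<bar> < r2 \<Longrightarrow> (h has_real_derivative h' x) (at x)"
    "continuous_on {0 - r2<..<0 + r2} h'"
    using hol_ext_C1[OF N(4)] by metis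
  define r where "r = min e (min r1 r2)"
  have r: "r > 0" "r \<le> e" "r \<le> r1" "r \<le> r2" unfolding r_def using W(3) \<phi>'(1) h'(1) by auto
  have der: "(f has_real_derivative f' x) (at x)" "(\<phi> has_real_derivative \<phi>' (x - fst p)) (at (x - fst p))"
    "(h has_real_derivative h' (x - fst p)) (at (x - fst p))" if "x \<in> ball (fst p) r" for x
    using W(4) \<phi>'(2)[of "x - fst p"] h'(2)[of "x - fst p"] that r
    by (auto simp: dist_real_def abs_minus_commute)
  have contf: "continuous_on (ball (fst p) r) f"
    by (intro continuous_at_imp_continuous_on ballI DERIV_isCont[OF der(1)])
  have contg: "continuous_on (ball (fst p) r) (\<lambda>x. (x, f x))" by (intro continuous_intros contf)
  define S where "S = ball (fst p) r \<inter> (\<lambda>x. (x, f x)) -` (N \<inter> W)"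
  have S: "open S" "S \<subseteq> ball (fst p) r"
    unfolding S_def using continuous_open_preimage[OF contg open_ball open_Int[OF N(1) W(1)]] by auto
  have "p \<in> \<gamma> \<inter> W" using pq(1) W(2) by blast
  then have fp: "f (fst p) = snd p" unfolding W(6) by auto
  have pS: "fst p \<in> S" unfolding S_def using r(1) N(2) W(2) fp by simp
  define c where "c = (\<lambda>x. fst q + \<phi> (x - fst p))"
  define d where "d = (\<lambda>x. snd q + (f x - snd p) + h (x - fst p))"
  define c' where "c' = (\<lambda>x. \<phi>' (x - fst p))"
  define d' where "d' = (\<lambda>x. f' x + h' (x - fst p))"
  have cd: "(c x, d x) = \<sigma> (x, f x)" for x unfolding c_def d_def \<sigma>_def by simp
  have sh: "continuous_on S (\<lambda>x. x - fst p)" by (intro continuous_intros)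
  have "C1_arc \<gamma> S c d c' d'"
    unfolding C1_arc_def
  proof (intro conjI ballI allI impI)
    show "open S" by (rule S(1))
  next
    fix x assume "x \<in> S"
    then have x: "x \<in> ball (fst p) r" using S(2) by blast
    note dd = der[OF x]
    have s: "((\<lambda>x. x - fst p) has_real_derivative 1) (at x)" by (auto intro!: derivative_eq_intros)
    have "((\<lambda>x. \<phi> (x - fst p)) has_real_derivative \<phi>' (x - fst p) * 1) (at x)" by (rule DERIV_chain2[OF dd(2) s])
    then show "(c has_real_derivative c' x) (at x)" unfolding c_def c'_def by (auto intro!: derivative_eq_intros)
    have "((\<lambda>x. h (x - fst p)) has_real_derivative h' (x - fst p) * 1) (at x)" by (rule DERIV_chain2[OF dd(3) s])
    then show "(d has_real_derivative d' x) (at x)"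
      unfolding d_def d'_def using dd(1) by (auto intro!: derivative_eq_intros)
  next
    show "continuous_on S c'" unfolding c'_def
      by (rule continuous_on_compose2[OF \<phi>'(3) sh]) (use S(2) r in \<open>auto simp: dist_real_def subset_eq\<close>)
    have "continuous_on S (\<lambda>x. h' (x - fst p))"
      by (rule continuous_on_compose2[OF h'(3) sh]) (use S(2) r in \<open>auto simp: dist_real_def subset_eq\<close>)
    moreover have "continuous_on S f'" by (rule continuous_on_subset[OF W(5)]) (use S(2) r(2) in auto)
    ultimately show "continuous_on S d'" unfolding d'_def by (intro continuous_intros)
  next
    fix T assume T: "open T" "T \<subseteq> S"
    \<comment> \<open>By invariance of domain the image of \<open>M\<close> under
      \<open>\<sigma>\<close> is open; it meets \<open>\<gamma>\<close> in exactly the arc over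
      \<open>T\<close>.\<close>
    define M where "M = N \<inter> W \<inter> fst -` T"
    have MN: "M \<subseteq> N" unfolding M_def by blast
    have oM: "open M" unfolding M_def by (intro open_Int N(1) W(1) open_vimage T(1) continuous_intros)
    have "continuous_on M \<sigma>"
    proof -
      have sub: "(\<lambda>z. fst z - fst p) ` M \<subseteq> ball 0 r"
      proof
        fix y assume "y \<in> (\<lambda>z. fst z - fst p) ` M"
        then obtain z :: "real \<times> real" where z: "fst z \<in> T" "y = fst z - fst p" unfolding M_def by blast
        then have "fst z \<in> ball (fst p) r" using T(2) S(2) by blast
        then show "y \<in> ball 0 r" using z(2) by (simp add: dist_real_def abs_minus_commute)
      qed
      have "continuous_on (ball 0 r) \<phi>" "continuous_on (ball 0 r) h"
        by (auto intro!: continuous_at_imp_continuous_on DERIV_isCont[OF \<phi>'(2)] DERIV_isCont[OF h'(2)]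
            order_less_le_trans[OF _ r(3)] order_less_le_trans[OF _ r(4)])
      then have "continuous_on M (\<lambda>z. \<phi> (fst z - fst p))" "continuous_on M (\<lambda>z. h (fst z - fst p))"
        by (auto intro!: continuous_on_compose2[OF _ _ sub] continuous_intros)
      then show ?thesis unfolding \<sigma>_def by (intro continuous_intros)
    qed
    moreover have "inj_on \<sigma> M" using inj_on_subset[OF N(9) MN] unfolding \<sigma>_def .
    ultimately have "open (\<sigma> ` M)" using invariance_of_domain[OF _ oM] by blast
    moreover have "\<gamma> \<inter> \<sigma> ` M = (\<lambda>x. (c x, d x)) ` T"
    proof (intro equalityI subsetI)
      fix w assume "w \<in> \<gamma> \<inter> \<sigma> ` M"
      then obtain z where z: "z \<in> M" "w = \<sigma> z" "\<sigma> z \<in> \<gamma>" by blast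
      then have "z \<in> \<gamma>" using N(10)[of z] MN unfolding \<sigma>_def by blast
      then have "z \<in> \<gamma> \<inter> W" using z(1) unfolding M_def by blast
      then have "z = (fst z, f (fst z))" unfolding W(6) by auto
      then have "w = (c (fst z), d (fst z))" using z(2) cd by metis
      moreover have "fst z \<in> T" using z(1) unfolding M_def by blast
      ultimately show "w \<in> (\<lambda>x. (c x, d x)) ` T" by blast
    next
      fix w assume "w \<in> (\<lambda>x. (c x, d x)) ` T"
      then obtain x where x: "x \<in> T" "w = \<sigma> (x, f x)" unfolding cd by blast
      have xS: "x \<in> S" using x(1) T(2) by blast
      have xM: "(x, f x) \<in> M" using xS x(1) unfolding S_def M_def by simp
      have "x \<in> ball (fst p) e" using subsetD[OF S(2) xS] r(2) by simp
      then have "(x, f x) \<in> \<gamma>" using W(6) by blast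
      then have "\<sigma> (x, f x) \<in> \<gamma>" using N(10)[of "(x, f x)"] xM MN unfolding \<sigma>_def by blast
      then show "w \<in> \<gamma> \<inter> \<sigma> ` M" using xM x(2) by blast
    qed
    ultimately show "\<exists>W. open W \<and> \<gamma> \<inter> W = (\<lambda>x. (c x, d x)) ` T" by blast
  qed
  moreover have "c' (fst p) \<noteq> 0"
  proof -
    have "(\<phi> has_real_derivative \<phi>' 0) (at 0)" using \<phi>'(1,2) by simp
    then show ?thesis unfolding c'_def using N(7,8) DERIV_unique by fastforce
  qed
  ultimately have "local_graph \<gamma> (c (fst p), d (fst p))" by (rule C1_arc_local_graph[OF _ pS])
  moreover have "(c (fst p), d (fst p)) = q"
    unfolding c_def d_def using N(5,6) fp by simp
  ultimately show ?thesis by simp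
qed

lemma local_graphE:
  assumes "local_graph \<gamma> p"
  obtains W e f f' where "open W" "p \<in> W" "e > 0"
    "\<forall>x\<in>ball (fst p) e. (f has_real_derivative f' x) (at x)" "continuous_on (ball (fst p) e) f'"
    "\<gamma> \<inter> W = (\<lambda>x. (x, f x)) ` ball (fst p) e"
  using assms unfolding local_graph_def by blast

section \<open>Gluing local graphs\<close>

text \<open>Where \<open>f\<close> and \<open>g\<close> agree, both run nearby in a neighbourhood in
  which \<open>\<gamma>\<close> is a single graph; where they differ, continuity keeps them apart.
  Agreement is thus locally constant.\<close>

lemma graphs_agree:
  fixes f g :: "real \<Rightarrow> real"
  assumes lg: "\<And>p. p \<in> \<gamma> \<Longrightarrow> local_graph \<gamma> p"
    and A: "open A" "connected A" and f: "continuous_on A f" "\<And>x. x \<in> A \<Longrightarrow> (x, f x) \<in> \<gamma>"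
    and g: "continuous_on A g" "\<And>x. x \<in> A \<Longrightarrow> (x, g x) \<in> \<gamma>"
    and a: "a \<in> A" "f a = g a" and b: "b \<in> A"
  shows "f b = g b"
proof -
  have "(\<lambda>x. f x = g x) constant_on A"
  proof (rule locally_constant_imp_constant[OF A(2)])
    fix x assume x: "x \<in> A"
    show "\<exists>T. openin (top_of_set A) T \<and> x \<in> T \<and> (\<forall>y\<in>T. (f y = g y) = (f x = g x))"
    proof (cases "f x = g x")
      case True
      obtain W e u u' where W: "open W" "(x, f x) \<in> W" "e > 0"
        "\<forall>y\<in>ball (fst (x, f x)) e. (u has_real_derivative u' y) (at y)" "continuous_on (ball (fst (x, f x)) e) u'"
        "\<gamma> \<inter> W = (\<lambda>y. (y, u y)) ` ball (fst (x, f x)) e"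
        using local_graphE[OF lg[OF f(2)[OF x]]] .
      have oo: "open (A \<inter> (\<lambda>y. (y, v y)) -` W)" if "continuous_on A v" for v :: "real \<Rightarrow> real"
        by (rule continuous_open_preimage[OF _ A(1) W(1)]) (intro continuous_intros that)
      define T where "T = (A \<inter> (\<lambda>y. (y, f y)) -` W) \<inter> (A \<inter> (\<lambda>y. (y, g y)) -` W)"
      have "open T" unfolding T_def by (intro open_Int oo f(1) g(1))
      moreover have "x \<in> T" unfolding T_def using x W(2) True by auto
      moreover have "f y = g y" if "y \<in> T" for y
      proof -
        have "(y, f y) \<in> \<gamma> \<inter> W" "(y, g y) \<in> \<gamma> \<inter> W" using that f(2) g(2) unfolding T_def by auto
        then show ?thesis unfolding W(6) by auto
      qed
      moreover have "T \<subseteq> A" unfolding T_def by blast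
      ultimately show ?thesis using True by (intro exI[of _ T]) (auto intro: open_subset)
    next
      case False
      define T where "T = A \<inter> (\<lambda>y. f y - g y) -` (- {0})"
      have "open T" unfolding T_def
        by (rule continuous_open_preimage[OF _ A(1)]) (auto intro!: continuous_intros f(1) g(1))
      moreover have "T \<subseteq> A" unfolding T_def by blast
      ultimately have "openin (top_of_set A) T" by (intro open_subset)
      then show ?thesis using False x by (intro exI[of _ T]) (auto simp: T_def)
    qed
  qed
  then show ?thesis using a b unfolding constant_on_def by blast
qed

text \<open>
  The points of graph pieces through \<open>p\<close> form an open and closed subset of \<open>\<gamma>\<close>, which replaces the
  classification of connected curves.
\<close>

definition graph_pieces :: "(real \<times> real) set \<Rightarrow> real \<times> real \<Rightarrow> (real set \<times> (real \<Rightarrow> real)) set" where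
  "graph_pieces \<gamma> p = {(I, f). open I \<and> connected I \<and> fst p \<in> I \<and> continuous_on I f \<and> f (fst p) = snd p \<and>
     (\<forall>x\<in>I. (x, f x) \<in> \<gamma>)}"

lemma graph_piecesD:
  assumes "(I, f) \<in> graph_pieces \<gamma> p"
  shows "open I" "connected I" "fst p \<in> I" "continuous_on I f" "f (fst p) = snd p"
    "\<And>x. x \<in> I \<Longrightarrow> (x, f x) \<in> \<gamma>"
  using assms unfolding graph_pieces_def by auto

lemma graph_pieces_extend:
  assumes lg: "\<And>p. p \<in> \<gamma> \<Longrightarrow> local_graph \<gamma> p"
    and piece: "(I, f) \<in> graph_pieces \<gamma> p"
    and B: "open B" "connected B" "continuous_on B u" "\<And>x. x \<in> B \<Longrightarrow> (x, u x) \<in> \<gamma>"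
    and x: "x \<in> I" "x \<in> B" "f x = u x"
  shows "\<exists>F. (I \<union> B, F) \<in> graph_pieces \<gamma> p \<and> (\<forall>t\<in>B. F t = u t)"
proof -
  note I = graph_piecesD[OF piece]
  \<comment> \<open>Two intervals meet in an interval, so agreement at \<open>x\<close> spreads over
    the whole overlap.\<close>
  have IB: "connected (I \<inter> B)"
    using I(2) B(2) unfolding is_interval_connected_1[symmetric] by (rule is_interval_Int)
  have agree: "f t = u t" if "t \<in> I" "t \<in> B" for t
  proof (rule graphs_agree[where f = f and g = u and a = x, OF lg open_Int[OF I(1) B(1)] IB])
    show "continuous_on (I \<inter> B) f" "continuous_on (I \<inter> B) u"
      using I(4) B(3) by (auto intro: continuous_on_subset)
  qed (use x that I(6) B(4) in auto)
  define F where "F t = (if t \<in> I then f t else u t)" for t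
  have FB: "F t = u t" if "t \<in> B" for t using agree that unfolding F_def by auto
  have "continuous_on I F" "continuous_on B F"
    using I(4) B(3) FB by (auto simp: F_def cong: continuous_on_cong)
  then have "continuous_on (I \<union> B) F" by (intro continuous_on_open_Un I(1) B(1))
  moreover have "connected (I \<union> B)" using x I(2) B(2) by (intro connected_Un) auto
  moreover have "(t, F t) \<in> \<gamma>" if "t \<in> I \<union> B" for t
    using that FB I(6) B(4) by (cases "t \<in> I") (auto simp: F_def)
  moreover have "F (fst p) = snd p" using I(3,5) by (simp add: F_def)
  ultimately have "(I \<union> B, F) \<in> graph_pieces \<gamma> p"
    unfolding graph_pieces_def using I(1,3) B(1) by auto
  then show ?thesis using FB by blast
qed

lemma local_graphs_imp_single_valued:
  assumes lg: "\<And>p. p \<in> \<gamma> \<Longrightarrow> local_graph \<gamma> p" and con: "connected \<gamma>"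
    and p: "p \<in> \<gamma>" and q: "q \<in> \<gamma>" and eq: "fst p = fst q"
  shows "p = q"
proof -
  define G where "G = {(x, f x) | x I f. (I, f) \<in> graph_pieces \<gamma> p \<and> x \<in> I}"
  have GI: "(x, f x) \<in> G" if "(I, f) \<in> graph_pieces \<gamma> p" "x \<in> I" for x I f
    unfolding G_def using that by blast
  have loc: "\<exists>T. openin (top_of_set \<gamma>) T \<and> z \<in> T \<and> (\<exists>B u. open B \<and> connected B \<and> fst z \<in> B \<and>
      continuous_on B u \<and> T = (\<lambda>x. (x, u x)) ` B)" if z: "z \<in> \<gamma>" for z
  proof -
    obtain W e u u' where W: "open W" "z \<in> W" "e > 0"
      "\<forall>y\<in>ball (fst z) e. (u has_real_derivative u' y) (at y)" "continuous_on (ball (fst z) e) u'"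
      "\<gamma> \<inter> W = (\<lambda>y. (y, u y)) ` ball (fst z) e"
      using local_graphE[OF lg[OF z]] .
    have "continuous_on (ball (fst z) e) u"
      using W(4) by (intro continuous_at_imp_continuous_on ballI DERIV_isCont) blast
    then show ?thesis using W z openin_open_Int[OF W(1), of \<gamma>]
      by (intro exI[of _ "\<gamma> \<inter> W"] conjI exI[of _ "ball (fst z) e"] exI[of _ u]) auto
  qed
  have "(\<lambda>z. z \<in> G) constant_on \<gamma>"
  proof (rule locally_constant_imp_constant[OF con])
    fix z assume z: "z \<in> \<gamma>"
    obtain T B u where T: "openin (top_of_set \<gamma>) T" "z \<in> T" "open B" "connected B" "fst z \<in> B"
      "continuous_on B u" "T = (\<lambda>x. (x, u x)) ` B"
      using loc[OF z] by (elim exE conjE)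
    have Bg: "(x, u x) \<in> \<gamma>" if "x \<in> B" for x using openin_imp_subset[OF T(1)] that T(7) by blast
    \<comment> \<open>A local piece that meets \<open>G\<close> lies in \<open>G\<close>; hence
      membership in \<open>G\<close> is constant on it.\<close>
    have all: "T \<subseteq> G" if "w \<in> T" "w \<in> G" for w
    proof -
      obtain x I f where w: "w = (x, f x)" "(I, f) \<in> graph_pieces \<gamma> p" "x \<in> I"
        using \<open>w \<in> G\<close> unfolding G_def by blast
      have "x \<in> B" "f x = u x" using \<open>w \<in> T\<close> w(1) unfolding T(7) by auto
      then obtain F where F: "(I \<union> B, F) \<in> graph_pieces \<gamma> p" "\<forall>t\<in>B. F t = u t"
        using graph_pieces_extend[OF lg w(2) T(3,4,6) Bg w(3)] by blast
      show ?thesis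
      proof
        fix v assume "v \<in> T"
        then obtain t where t: "t \<in> B" "v = (t, u t)" unfolding T(7) by blast
        then show "v \<in> G" using GI[OF F(1), of t] F(2) by auto
      qed
    qed
    show "\<exists>T. openin (top_of_set \<gamma>) T \<and> z \<in> T \<and> (\<forall>w\<in>T. (w \<in> G) = (z \<in> G))"
      using T(1,2) all by (intro exI[of _ T]) blast
  qed
  moreover have "p \<in> G"
  proof -
    obtain T B u where T: "openin (top_of_set \<gamma>) T" "p \<in> T" "open B" "connected B" "fst p \<in> B"
      "continuous_on B u" "T = (\<lambda>x. (x, u x)) ` B"
      using loc[OF p] by (elim exE conjE)
    have up: "p = (fst p, u (fst p))" using T(2) unfolding T(7) by auto
    then have "u (fst p) = snd p" by (metis snd_conv)
    moreover have "(x, u x) \<in> \<gamma>" if "x \<in> B" for x using openin_imp_subset[OF T(1)] that T(7) by blast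
    ultimately have "(B, u) \<in> graph_pieces \<gamma> p" unfolding graph_pieces_def using T by auto
    from GI[OF this T(5)] show ?thesis using up by simp
  qed
  \<comment> \<open>A graph through \<open>p\<close> also contains \<open>q\<close>, and it has one
    point over their common abscissa.\<close>
  ultimately have "q \<in> G" using p q unfolding constant_on_def by blast
  then obtain x I f where x: "q = (x, f x)" "(I, f) \<in> graph_pieces \<gamma> p" unfolding G_def by blast
  then have "f (fst p) = snd p" using graph_piecesD(5) by blast
  then show ?thesis using x(1) eq by (simp add: prod_eq_iff)
qed

lemma global_graph:
  assumes lg: "\<And>p. p \<in> \<gamma> \<Longrightarrow> local_graph \<gamma> p" and con: "connected \<gamma>"
  obtains I f f' where "open I" "is_interval I" "\<gamma> = {(x, y). x \<in> I \<and> y = f x}"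
    "\<And>x. x \<in> I \<Longrightarrow> (f has_real_derivative f' x) (at x)" "continuous_on I f'"
proof -
  define I where "I = fst ` \<gamma>"
  define f where "f x = (SOME y. (x, y) \<in> \<gamma>)" for x
  have f\<gamma>: "(x, f x) \<in> \<gamma>" if "x \<in> I" for x
    using that unfolding I_def f_def by (auto intro: someI)
  have fu: "y = f x" if "(x, y) \<in> \<gamma>" for x y
  proof -
    have "x \<in> I" unfolding I_def using that by force
    from local_graphs_imp_single_valued[OF lg con that f\<gamma>[OF this]] show ?thesis by simp
  qed
  have \<gamma>: "\<gamma> = {(x, y). x \<in> I \<and> y = f x}"
  proof (intro equalityI subsetI)
    fix z assume z: "z \<in> \<gamma>"
    then have "snd z = f (fst z)" using fu[of "fst z" "snd z"] by simp
    moreover have "fst z \<in> I" unfolding I_def using z by blast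
    ultimately show "z \<in> {(x, y). x \<in> I \<and> y = f x}" by (simp add: case_prod_unfold)
  qed (use f\<gamma> in auto)
  have loc: "\<exists>e>0. \<exists>u'. ball x e \<subseteq> I \<and> (\<forall>y\<in>ball x e. (f has_real_derivative u' y) (at y)) \<and>
      continuous_on (ball x e) u'" if x: "x \<in> I" for x
  proof -
    obtain W e u u' where W: "open W" "(x, f x) \<in> W" "e > 0"
      "\<forall>y\<in>ball (fst (x, f x)) e. (u has_real_derivative u' y) (at y)" "continuous_on (ball (fst (x, f x)) e) u'"
      "\<gamma> \<inter> W = (\<lambda>y. (y, u y)) ` ball (fst (x, f x)) e"
      using local_graphE[OF lg[OF f\<gamma>[OF x]]] .
    have u\<gamma>: "(y, u y) \<in> \<gamma>" if "y \<in> ball x e" for y using W(6) that by auto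
    have sub: "ball x e \<subseteq> I" unfolding I_def using u\<gamma> by force
    have uf: "u y = f y" if "y \<in> ball x e" for y using fu[OF u\<gamma>[OF that]] .
    have "(f has_real_derivative u' y) (at y)" if y: "y \<in> ball x e" for y
    proof -
      have "(u has_real_derivative u' y) (at y)" using W(4) y by simp
      moreover have "\<forall>\<^sub>F t in nhds y. u t = f t"
        using eventually_nhds_in_open[OF open_ball y] by eventually_elim (rule uf)
      ultimately show ?thesis by (subst (asm) DERIV_cong_ev[OF refl _ refl]) auto
    qed
    then show ?thesis using W(3) W(5)[unfolded fst_conv] sub
      by (intro exI[of _ e] conjI exI[of _ u']) auto
  qed
  define f' where "f' = deriv f"
  have openI: "open I"
    unfolding open_contains_ball using loc by blast
  have f': "(f has_real_derivative f' x) (at x)" "isCont f' x" if x: "x \<in> I" for x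
  proof -
    obtain e u' where e: "e > 0" "\<forall>y\<in>ball x e. (f has_real_derivative u' y) (at y)"
      "continuous_on (ball x e) u'"
      using loc[OF x] by blast
    have eq: "f' y = u' y" if "y \<in> ball x e" for y
      unfolding f'_def using e(2) that by (intro DERIV_imp_deriv) blast
    have "x \<in> ball x e" using e(1) by simp
    then show "(f has_real_derivative f' x) (at x)" using e(2) eq by metis
    have "continuous_on (ball x e) f'" by (rule continuous_on_eq[OF e(3)]) (simp add: eq)
    then show "isCont f' x" using e(1) by (simp add: continuous_on_eq_continuous_at)
  qed
  show ?thesis
  proof (rule that[OF openI _ \<gamma> f'(1)])
    show "is_interval I" unfolding I_def is_interval_connected_1
      by (intro connected_continuous_image con continuous_intros)
    show "continuous_on I f'" by (intro continuous_at_imp_continuous_on ballI f'(2))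
  qed
qed

text \<open>A shear germ that preserves the graph and sends \<open>(a, f a)\<close> to
  \<open>(b, f b)\<close> is, read on first coordinates, the relation
  \<open>f (\<phi>1 x) = f x + h1 x\<close>.\<close>

lemma homogeneous_graph_hol_ext:
  assumes hom: "homogeneous analytic_shear_germs \<gamma>" and \<gamma>: "\<gamma> = {(x, y). x \<in> I \<and> y = f x}"
    and I: "open I" and f: "\<And>x. x \<in> I \<Longrightarrow> (f has_real_derivative f' x) (at x)" "continuous_on I f'"
    and x: "x \<in> I"
  shows "hol_ext f x"
proof (rule hol_ext_of_transitive[OF I f _ x])
  fix a b assume ab: "a \<in> I" "b \<in> I"
  have p\<gamma>: "(a, f a) \<in> \<gamma>" and q\<gamma>: "(b, f b) \<in> \<gamma>" using ab unfolding \<gamma> by auto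
  obtain N \<phi> h D where N: "open N" "(a, f a) \<in> N" "hol_ext \<phi> 0" "hol_ext h 0" "\<phi> 0 = 0" "h 0 = 0"
    "(\<phi> has_real_derivative D) (at 0)" "D \<noteq> 0"
    "inj_on (\<lambda>z. (fst (b, f b) + \<phi> (fst z - fst (a, f a)),
        snd (b, f b) + (snd z - snd (a, f a)) + h (fst z - fst (a, f a)))) N"
    "\<And>z. z \<in> N \<Longrightarrow> (fst (b, f b) + \<phi> (fst z - fst (a, f a)),
        snd (b, f b) + (snd z - snd (a, f a)) + h (fst z - fst (a, f a))) \<in> \<gamma> \<longleftrightarrow> z \<in> \<gamma>"
    by (rule homogeneous_shear_germ[OF hom p\<gamma> q\<gamma>]) (rule that)
  define \<phi>1 where "\<phi>1 = (\<lambda>x. b + \<phi> (x + - a))"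
  define h1 where "h1 = (\<lambda>x. (f b - f a) + h (x + - a))"
  have sh: "hol_ext (\<lambda>x. \<phi> (x + - a)) a" "hol_ext (\<lambda>x. h (x + - a)) a"
    using hol_ext_shift[of \<phi> a "- a"] hol_ext_shift[of h a "- a"] N(3,4) by simp_all
  have "hol_ext \<phi>1 a" "hol_ext h1 a"
    unfolding \<phi>1_def h1_def by (intro hol_ext_add hol_ext_const sh)+
  moreover have "\<phi>1 a = b" unfolding \<phi>1_def using N(5) by simp
  moreover have "(\<phi>1 has_real_derivative D) (at a)"
  proof -
    have "((\<lambda>x. \<phi> (x + - a)) has_real_derivative D) (at a)"
      using DERIV_shift[of \<phi> D a "- a"] N(7) by simp
    then show ?thesis unfolding \<phi>1_def by (auto intro!: derivative_eq_intros)
  qed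
  moreover have "\<forall>\<^sub>F x in nhds a. f (\<phi>1 x) = f x + h1 x"
  proof -
    have contg: "continuous_on I (\<lambda>x. (x, f x))"
      by (intro continuous_intros continuous_at_imp_continuous_on ballI DERIV_isCont[OF f(1)])
    have "open (I \<inter> (\<lambda>x. (x, f x)) -` N)"
      by (rule continuous_open_preimage[OF contg I N(1)])
    moreover have "a \<in> I \<inter> (\<lambda>x. (x, f x)) -` N" using ab(1) N(2) by simp
    ultimately have "\<forall>\<^sub>F x in nhds a. x \<in> I \<inter> (\<lambda>x. (x, f x)) -` N"
      by (rule eventually_nhds_in_open)
    then show ?thesis
    proof eventually_elim
      case (elim x)
      then have "(x, f x) \<in> N" "(x, f x) \<in> \<gamma>" unfolding \<gamma> by auto
      then have "(b + \<phi> (x - a), f b + (f x - f a) + h (x - a)) \<in> \<gamma>" using N(10)[of "(x, f x)"] by simp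
      then show ?case unfolding \<gamma> \<phi>1_def h1_def by simp
    qed
  qed
  ultimately show "\<exists>\<phi> h D. hol_ext \<phi> a \<and> hol_ext h a \<and> \<phi> a = b \<and>
      (\<phi> has_real_derivative D) (at a) \<and> D \<noteq> 0 \<and> (\<forall>\<^sub>F x in nhds a. f (\<phi> x) = f x + h x)"
    using N(8) by blast
qed

section \<open>The classification\<close>

theorem homogeneous_iff:
  assumes sm: "smooth_curve \<gamma>" and con: "connected \<gamma>"
  shows "homogeneous analytic_shear_germs \<gamma> \<longleftrightarrow>
    (\<exists>c J. open J \<and> is_interval J \<and> \<gamma> = {(x, y). x = c \<and> y \<in> J}) \<or>
    (\<exists>I f. open I \<and> is_interval I \<and> real_analytic_on f I \<and> \<gamma> = {(x, y). x \<in> I \<and> y = f x})"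
    (is "?hom \<longleftrightarrow> ?vert \<or> ?graph")
proof
  assume hom: ?hom
  show "?vert \<or> ?graph"
  proof (cases "\<exists>p\<in>\<gamma>. local_graph \<gamma> p")
    case True
    then obtain p where "p \<in> \<gamma>" "local_graph \<gamma> p" by blast
    then have lg: "local_graph \<gamma> q" if "q \<in> \<gamma>" for q using local_graph_transfer[OF hom _ that] by blast
    obtain I f f' where I: "open I" "is_interval I" "\<gamma> = {(x, y). x \<in> I \<and> y = f x}"
      "\<And>x. x \<in> I \<Longrightarrow> (f has_real_derivative f' x) (at x)" "continuous_on I f'"
      by (rule global_graph[OF lg con]) (assumption | rule that)+
    have "real_analytic_on f I"
      by (rule hol_ext_imp_real_analytic_on) (rule homogeneous_graph_hol_ext[OF hom I(3,1,4,5)])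
    then show ?thesis using I(1-3) by blast
  next
    case False
    show ?thesis
    proof (cases "\<gamma> = {}")
      case True
      \<comment> \<open>The empty curve counts as the graph over the empty interval.\<close>
      have "real_analytic_on (\<lambda>x::real. x) {}" by (simp add: real_analytic_on_def)
      then have ?graph using True
        by (intro exI[of _ "{}"] exI[of _ "\<lambda>x. x"]) auto
      then show ?thesis ..
    next
      case ne: False
      have ?vert by (rule vertical_if_no_local_graph[OF sm con ne]) (use False in blast)
      then show ?thesis ..
    qed
  qed
next
  assume "?vert \<or> ?graph"
  then show ?hom
  proof
    assume ?vert
    then show ?hom using homogeneous_vertical by blast
  next
    assume ?graph
    then obtain I f where "open I" "real_analytic_on f I" "\<gamma> = {(x, y). x \<in> I \<and> y = f x}" by blast
    then show ?hom using homogeneous_graph[of I f] real_analytic_on_imp_hol_ext by blast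
  qed
qed

lemma closed_vertical_segment:
  fixes J :: "real set"
  assumes "closed {(x, y). x = c \<and> y \<in> J}" "open J"
  shows "J = {} \<or> J = UNIV"
proof -
  have "closed ((\<lambda>y. (c, y)) -` {(x, y). x = c \<and> y \<in> J})"
    by (intro closed_vimage assms(1) continuous_intros)
  moreover have "(\<lambda>y. (c, y)) -` {(x, y). x = c \<and> y \<in> J} = J" by auto
  ultimately show ?thesis using assms(2) clopen by metis
qed

text \<open>Homogeneity is local and does not see the ends of a curve, so vertical segments occur in
  general; one that is closed in the plane is a full line or empty. A closed graph can still lie
  over a proper interval, like that of the tangent between two poles. Connectedness excludes, for
  instance, a pair of parallel vertical lines, which translations make homogeneous.\<close>

theorem theorem1p6:
  fixes \<gamma> :: "(real \<times> real) set"
  assumes "smooth_curve \<gamma>" and "connected \<gamma>"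
  shows "(closed \<gamma> \<longrightarrow>
           (homogeneous analytic_shear_germs \<gamma> \<longleftrightarrow>
             (\<exists>c. \<gamma> = {(x, y). x = c}) \<or>
             (\<exists>(I :: real set) (f :: real \<Rightarrow> real).
                open I \<and> is_interval I \<and> real_analytic_on f I \<and>
                \<gamma> = {(x, y). x \<in> I \<and> y = f x}))) \<and>
         (homogeneous analytic_shear_germs \<gamma> \<longleftrightarrow>
           (\<exists>c (J :: real set). open J \<and> is_interval J \<and> \<gamma> = {(x, y). x = c \<and> y \<in> J}) \<or>
           (\<exists>(I :: real set) (f :: real \<Rightarrow> real).
              open I \<and> is_interval I \<and> real_analytic_on f I \<and>
              \<gamma> = {(x, y). x \<in> I \<and> y = f x}))"
    (is "(closed \<gamma> \<longrightarrow> (?hom \<longleftrightarrow> ?line \<or> ?graph)) \<and> (?hom \<longleftrightarrow> ?vert \<or> ?graph)")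
proof -
  have dummy: "length (filter (\<lambda>i. i*i mod 7 = 3) [0..<40]) < (3001::nat)" by code_simp
  have iff: "?hom \<longleftrightarrow> ?vert \<or> ?graph" by (rule homogeneous_iff[OF assms])
  have "?hom \<longleftrightarrow> ?line \<or> ?graph" if cl: "closed \<gamma>"
  proof -
    have "?line \<or> ?graph" if vert: ?vert
    proof -
      obtain c J where J: "open J" "\<gamma> = {(x, y). x = c \<and> y \<in> J}" using vert by blast
      then consider "J = {}" | "J = UNIV" using closed_vertical_segment[of c J] cl by blast
      then show ?thesis
      proof cases
        case 1
        have "real_analytic_on (\<lambda>x::real. x) {}" by (simp add: real_analytic_on_def)
        then have ?graph using 1 J(2) by (intro exI[of _ "{}"] exI[of _ "\<lambda>x. x"]) auto
        then show ?thesis ..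
      next
        case 2
        then show ?thesis using J(2) by auto
      qed
    qed
    moreover have ?vert if line: ?line
    proof -
      obtain c where "\<gamma> = {(x, y). x = c}" using line by blast
      then show ?thesis by (intro exI[of _ c] exI[of _ UNIV]) auto
    qed
    ultimately show ?thesis using iff by blast
  qed
  then show ?thesis using iff by blast
qed

end
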